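(* Let $p>1$ with $p\in(d/2,d]$, let $\gamma_+,\gamma_-\ge 0$ with $\gamma_++\gamma_->0$, and let $0<\lambda\le\Lambda$. Let $F:\mathcal{S}(d)\to\mathbb{R}$ be convex and satisfy $$\lambda\|M\|\le F(M)\le\Lambda\|M\|\quad\text{for every } M\in\mathcal{S}(d).$$ Let $g\in W^{2,p}(B_1)$ be a nontrivial function, and define $$I[u]:=\int_{B_1}[F(D^2u)]^p+\gamma_+\max(u,0)-\gamma_-\min(u,0)\,dx.$$ Then there exists $u^*\in W^{2,p}(B_1)\cap W^{1,p}_g(B_1)$ such that $$I[u^*]\le I[u]\quad\text{for all } u\in W^{2,p}(B_1)\cap W^{1,p}_g(B_1).$$
   Context: $B_1$ is the open unit ball of $\mathbb{R}^d$ centered at the origin. $\mathcal{S}(d)$ is the space of real symmetric $d\times d$ matrices, with a matrix norm $\|\cdot\|$. For $g\in W^{2,p}(B_1)$, $u\in W^{2,p}(B_1)\cap W^{1,p}_g(B_1)$ means that $u\in W^{2,p}(B_1)$ and $u-g\in W^{1,p}_0(B_1)$. *)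

theory Defs
  imports "HOL-Analysis.Analysis" "HOL-Library.Multiset"
begin

definition partial_deriv :: "'n \<Rightarrow> (real ^ 'n \<Rightarrow> real) \<Rightarrow> real ^ 'n \<Rightarrow> real" where
  "partial_deriv i f = (\<lambda>x. frechet_derivative f (at x) (axis i 1))"

primrec partial_derivs :: "'n list \<Rightarrow> (real ^ 'n \<Rightarrow> real) \<Rightarrow> real ^ 'n \<Rightarrow> real" where
  "partial_derivs [] f = f"
| "partial_derivs (i # is) f = partial_deriv i (partial_derivs is f)"

text \<open>Differentiability of all iterated partial derivatives makes all of them continuous,
  so this is the usual class of infinitely differentiable functions.\<close>

definition smooth :: "(real ^ 'n \<Rightarrow> real) \<Rightarrow> bool" where
  "smooth f \<longleftrightarrow> (\<forall>is x. partial_derivs is f differentiable (at x))"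

definition test_functions :: "(real ^ 'n) set \<Rightarrow> (real ^ 'n \<Rightarrow> real) set" where
  "test_functions U =
     {\<phi>. smooth \<phi> \<and> compact (closure {x. \<phi> x \<noteq> 0}) \<and> closure {x. \<phi> x \<noteq> 0} \<subseteq> U}"

text \<open>Elements of Lebesgue and Sobolev spaces on \<open>U\<close> are represented by functions on the whole
  space; values outside \<open>U\<close> and on null sets are irrelevant.\<close>

definition Lp :: "(real ^ 'n) set \<Rightarrow> real \<Rightarrow> (real ^ 'n \<Rightarrow> real) set" where
  "Lp U p = {f. f \<in> borel_measurable (lebesgue_on U)
               \<and> integrable (lebesgue_on U) (\<lambda>x. \<bar>f x\<bar> powr p)}"

definition locally_integrable_on :: "(real ^ 'n \<Rightarrow> real) \<Rightarrow> (real ^ 'n) set \<Rightarrow> bool"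
    (infix \<open>locally'_integrable'_on\<close> 50) where
  "f locally_integrable_on U \<longleftrightarrow>
     (\<forall>K. compact K \<and> K \<subseteq> U \<longrightarrow> f absolutely_integrable_on K)"

text \<open>A multi-index is a multiset of coordinates: its order is its size, and the second-order
  index for the coordinates \<open>i\<close> and \<open>j\<close> is \<open>{#i, j#}\<close>. The classical derivatives of test
  functions do not depend on the enumeration \<open>is\<close> of the multi-index.\<close>

definition is_weak_deriv ::
    "(real ^ 'n) set \<Rightarrow> 'n multiset \<Rightarrow> (real ^ 'n \<Rightarrow> real) \<Rightarrow> (real ^ 'n \<Rightarrow> real) \<Rightarrow> bool" where
  "is_weak_deriv U \<alpha> f v \<longleftrightarrow>
     f locally_integrable_on U \<and> v locally_integrable_on U \<and>
     (\<forall>\<phi>\<in>test_functions U. \<forall>is. mset is = \<alpha> \<longrightarrow>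
        (LINT x|lebesgue_on U. f x * partial_derivs is \<phi> x)
          = (-1) ^ size \<alpha> * (LINT x|lebesgue_on U. v x * \<phi> x))"

text \<open>Some representative of the weak derivative, which is unique up to null sets.\<close>

definition weak_deriv ::
    "(real ^ 'n) set \<Rightarrow> 'n multiset \<Rightarrow> (real ^ 'n \<Rightarrow> real) \<Rightarrow> real ^ 'n \<Rightarrow> real" where
  "weak_deriv U \<alpha> f = (SOME v. is_weak_deriv U \<alpha> f v)"

definition sobolev :: "(real ^ 'n) set \<Rightarrow> nat \<Rightarrow> real \<Rightarrow> (real ^ 'n \<Rightarrow> real) set" where
  "sobolev U k p =
     {f \<in> Lp U p. \<forall>\<alpha>. size \<alpha> \<le> k \<longrightarrow> (\<exists>v\<in>Lp U p. is_weak_deriv U \<alpha> f v)}"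

definition sobolev_norm :: "(real ^ 'n) set \<Rightarrow> nat \<Rightarrow> real \<Rightarrow> (real ^ 'n \<Rightarrow> real) \<Rightarrow> real" where
  "sobolev_norm U k p f =
     (\<Sum>\<alpha> | size \<alpha> \<le> k. LINT x|lebesgue_on U. \<bar>weak_deriv U \<alpha> f x\<bar> powr p) powr (1 / p)"

lemma finite_multi_indices: "finite {\<alpha> :: ('n::finite) multiset. size \<alpha> \<le> k}"
proof -
  have "{\<alpha> :: 'n multiset. size \<alpha> \<le> k} \<subseteq> mset ` {is. set is \<subseteq> UNIV \<and> length is \<le> k}"
  proof
    fix \<alpha> :: "'n multiset"
    assume "\<alpha> \<in> {\<alpha>. size \<alpha> \<le> k}"
    moreover obtain "is" where "mset is = \<alpha>"
      using ex_mset by blast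
    ultimately show "\<alpha> \<in> mset ` {is. set is \<subseteq> UNIV \<and> length is \<le> k}"
      by (auto simp flip: size_mset)
  qed
  then show ?thesis
    using finite_lists_length_le[of "UNIV :: 'n set" k] by (meson finite finite_imageI finite_subset)
qed

definition sobolev0 :: "(real ^ 'n) set \<Rightarrow> nat \<Rightarrow> real \<Rightarrow> (real ^ 'n \<Rightarrow> real) set" where
  "sobolev0 U k p =
     {f \<in> sobolev U k p.
        \<forall>\<epsilon>>0. \<exists>\<phi>\<in>test_functions U. sobolev_norm U k p (\<lambda>x. f x - \<phi> x) < \<epsilon>}"

definition admissible ::
    "(real ^ 'n) set \<Rightarrow> real \<Rightarrow> (real ^ 'n \<Rightarrow> real) \<Rightarrow> (real ^ 'n \<Rightarrow> real) set" where
  "admissible U p g = {u \<in> sobolev U 2 p. (\<lambda>x. u x - g x) \<in> sobolev0 U 1 p}"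

definition sym_matrices :: "(real ^ 'n ^ 'n) set" where
  "sym_matrices = {M. transpose M = M}"

definition is_norm_on :: "'a::real_vector set \<Rightarrow> ('a \<Rightarrow> real) \<Rightarrow> bool" where
  "is_norm_on V N \<longleftrightarrow>
     (\<forall>x\<in>V. 0 \<le> N x) \<and>
     (\<forall>x\<in>V. N x = 0 \<longleftrightarrow> x = 0) \<and>
     (\<forall>x\<in>V. \<forall>c. N (c *\<^sub>R x) = \<bar>c\<bar> * N x) \<and>
     (\<forall>x\<in>V. \<forall>y\<in>V. N (x + y) \<le> N x + N y)"

definition weak_hessian ::
    "(real ^ 'n) set \<Rightarrow> (real ^ 'n \<Rightarrow> real) \<Rightarrow> real ^ 'n \<Rightarrow> real ^ 'n ^ 'n" where
  "weak_hessian U u x = (\<chi> i j. weak_deriv U {#i, j#} u x)"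

lemma weak_hessian_sym: "weak_hessian U u x \<in> sym_matrices"
  by (simp add: sym_matrices_def weak_hessian_def transpose_def add_mset_commute)

definition energy ::
    "(real ^ 'n) set \<Rightarrow> (real ^ 'n ^ 'n \<Rightarrow> real) \<Rightarrow> real \<Rightarrow> real \<Rightarrow> real \<Rightarrow> (real ^ 'n \<Rightarrow> real) \<Rightarrow> real"
  where
  "energy U F p \<gamma>1 \<gamma>2 u =
     (LINT x|lebesgue_on U.
        F (weak_hessian U u x) powr p + \<gamma>1 * max (u x) 0 - \<gamma>2 * min (u x) 0)"

end

theory Submission
  imports Defs
begin

text \<open>The direct method, with weak compactness replaced by uniform convexity. The sublevel sets of the
  energy above its infimum are nested and closed under midpoints, and the \<open>p\<close>-th power of the
  \<open>L\<^sup>p\<close> norm of the Hessian is bounded on them. This power is a uniformly convex functional, so its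
  almost minimizers on the sublevel sets form a minimizing sequence of the energy whose Hessians
  converge in \<open>L\<^sup>p\<close>. Differences of admissible functions vanish on the boundary, hence have Hessians
  that control all their lower order derivatives (a Poincare inequality on lines, applied to the
  function and to its first derivatives, which have mean zero on lines). The sequence therefore
  converges in \<open>W\<^sup>2\<^sup>,\<^sup>p\<close>, and Fatou's lemma shows that the limit is a minimizer.\<close>

section \<open>Smooth functions and test functions\<close>

text \<open>Uniform convexity has to come from an auxiliary functional because the energy need not
  have it: level sets of \<open>F\<close> may contain segments, and minimizers may fail to be
  unique. The auxiliary functional only decides which near minimizers are picked. Its inequality is
  proved for pairs of reals by compactness and then integrated, which treats all exponents p > 1
  alike.

  The obstacle is the gradient: admissible differences are limits of test functions only to first
  order, so their first derivatives carry no boundary values. What survives the limit is the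
  vanishing of the line integrals of each derivative in its own direction. Lines are handled by
  Tonelli and translation invariance of Lebesgue measure instead of representatives that are
  absolutely continuous on lines.

  Integrals of p-th powers replace norms throughout; factors such as 2^p and 5^p are the price for
  not using the inequalities of Minkowski and Hoelder. A weak derivative is a chosen representative,
  so identities between derivatives hold almost everywhere.\<close>

definition flat_exp :: "nat \<Rightarrow> real \<Rightarrow> real" where
  "flat_exp k t = (if t > 0 then (1 / t) ^ k * exp (- 1 / t) else 0)"

text \<open>The index \<open>k\<close> makes the family of flat functions closed under
  differentiation up to linear combinations, so smoothness needs no induction on explicit formulas.
  At 0 the right difference quotient becomes y^(k+1) / exp y with y = 1/h, which tends to 0.\<close>

lemma flat_exp_has_real_derivative:
  "(flat_exp k has_real_derivative flat_exp (k + 2) t - k * flat_exp (k + 1) t) (at t)"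
proof -
  consider "t > 0" | "t < 0" | "t = 0" by linarith
  then show ?thesis
  proof cases
    case 1
    have "((\<lambda>t. (1 / t) ^ k) has_real_derivative - (k * (1 / t) ^ (k + 1))) (at t)"
    proof (cases k)
      case (Suc m)
      have "((\<lambda>t. 1 / t) has_real_derivative - ((1 / t) ^ 2)) (at t)"
        using 1 by (auto intro!: derivative_eq_intros simp: power2_eq_square)
      from DERIV_power[OF this, of k] show ?thesis
        using Suc by (simp add: power2_eq_square mult_ac)
    qed simp
    moreover have "((\<lambda>t. exp (- 1 / t)) has_real_derivative (1 / t) ^ 2 * exp (- 1 / t)) (at t)"
      using 1 by (auto intro!: derivative_eq_intros simp: power2_eq_square)
    ultimately have "((\<lambda>t. (1 / t) ^ k * exp (- 1 / t)) has_real_derivative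
       - (k * (1 / t) ^ (k + 1)) * exp (- 1 / t) + ((1 / t) ^ 2 * exp (- 1 / t)) * (1 / t) ^ k) (at t)"
      by (rule DERIV_mult)
    then have *: "((\<lambda>t. (1 / t) ^ k * exp (- 1 / t)) has_real_derivative
        flat_exp (k + 2) t - k * flat_exp (k + 1) t) (at t)"
      using 1 by (simp add: flat_exp_def power2_eq_square mult_ac)
    show ?thesis
      by (rule has_field_derivative_transform_within_open[OF *, of "{0<..}"])
         (use 1 in \<open>auto simp: flat_exp_def\<close>)
  next
    case 2
    have "((\<lambda>t. 0) has_real_derivative 0) (at t)" by simp
    from has_field_derivative_transform_within_open[OF this, of "{..<0}" "flat_exp k"]
    show ?thesis using 2 by (auto simp: flat_exp_def)
  next
    case 3
    have "((\<lambda>y. y ^ Suc k / exp y) \<longlongrightarrow> 0) (at_top :: real filter)"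
      by (rule tendsto_power_div_exp_0)
    then have "((\<lambda>h. inverse h ^ Suc k / exp (inverse h)) \<longlongrightarrow> 0) (at_right (0::real))"
      by (rule filterlim_compose[OF _ filterlim_inverse_at_top_right])
    then have R: "((\<lambda>h. flat_exp k h / h) \<longlongrightarrow> 0) (at_right 0)"
      by (rule Lim_transform_eventually)
         (auto simp: eventually_at_filter flat_exp_def exp_minus field_simps)
    have L: "((\<lambda>h. flat_exp k h / h) \<longlongrightarrow> 0) (at_left 0)"
      by (rule tendsto_eventually) (auto simp: eventually_at_filter flat_exp_def)
    have "((\<lambda>h. flat_exp k h / h) \<longlongrightarrow> 0) (at 0)"
      using L R by (simp add: filterlim_at_split)
    then have "(flat_exp k has_real_derivative 0) (at 0)"
      by (simp add: has_field_derivative_iff flat_exp_def)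
    then show ?thesis using 3 by (simp add: flat_exp_def)
  qed
qed

lemma flat_exp_range: "0 \<le> flat_exp 0 t" "flat_exp 0 t < 1"
  and flat_exp_eq_0_iff: "flat_exp 0 t = 0 \<longleftrightarrow> t \<le> 0"
  by (auto simp: flat_exp_def)

text \<open>An algebra that is closed under partial derivatives and consists of differentiable functions
  consists of smooth functions.\<close>

inductive_set smooth_alg :: "(real ^ 'n \<Rightarrow> real) set" where
  base: "smooth f \<Longrightarrow> f \<in> smooth_alg"
| flat: "(\<lambda>x. flat_exp k (s * x $ i + c)) \<in> smooth_alg"
| const: "(\<lambda>_. c) \<in> smooth_alg"
| add: "f \<in> smooth_alg \<Longrightarrow> g \<in> smooth_alg \<Longrightarrow> (\<lambda>x. f x + g x) \<in> smooth_alg"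
| mult: "f \<in> smooth_alg \<Longrightarrow> g \<in> smooth_alg \<Longrightarrow> (\<lambda>x. f x * g x) \<in> smooth_alg"

lemma partial_deriv_eqI:
  "(f has_derivative D) (at x) \<Longrightarrow> partial_deriv i f x = D (axis i 1)"
  unfolding partial_deriv_def by (metis frechet_derivative_at)

lemma partial_derivs_append: "partial_derivs (is @ js) f = partial_derivs is (partial_derivs js f)"
  by (induction "is") auto

lemma smooth_partial_derivs: "smooth f \<Longrightarrow> smooth (partial_derivs is f)"
  unfolding smooth_def by (metis partial_derivs_append)

lemma smooth_partial_deriv: "smooth f \<Longrightarrow> smooth (partial_deriv i f)"
  using smooth_partial_derivs[of f "[i]"] by simp

lemma smooth_differentiable: "smooth f \<Longrightarrow> f differentiable (at x)"
  unfolding smooth_def by (metis partial_derivs.simps(1))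

lemma smooth_continuous_on: "smooth f \<Longrightarrow> continuous_on A f"
  by (meson continuous_at_imp_continuous_on differentiable_imp_continuous_within smooth_differentiable)

lemma flat_exp_coord_has_derivative:
  fixes x :: "real ^ 'n"
  shows "((\<lambda>x. flat_exp k (s * x $ i + c)) has_derivative
    (\<lambda>v. (flat_exp (k + 2) (s * x $ i + c) - k * flat_exp (k + 1) (s * x $ i + c)) * (s * v $ i)))
    (at x)"
proof -
  have 1: "((\<lambda>x::real^'n. s * x $ i + c) has_derivative (\<lambda>v. s * v $ i)) (at x)"
    by (auto intro!: derivative_eq_intros bounded_linear_imp_has_derivative
        bounded_linear_vec_nth)
  have "(flat_exp k has_derivative
      (*) (flat_exp (k + 2) (s * x $ i + c) - k * flat_exp (k + 1) (s * x $ i + c)))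
      (at (s * x $ i + c))"
    using flat_exp_has_real_derivative[of k "s * x $ i + c"] by (simp add: has_field_derivative_def)
  from has_derivative_compose[OF 1 this] show ?thesis by simp
qed

lemma smooth_alg_differentiable: "f \<in> smooth_alg \<Longrightarrow> f differentiable (at x)"
proof (induction rule: smooth_alg.induct)
  case (flat k s i c)
  then show ?case using flat_exp_coord_has_derivative differentiable_def by blast
qed (auto intro: smooth_differentiable)

lemma partial_deriv_add:
  assumes "f differentiable (at x)" "g differentiable (at x)"
  shows "partial_deriv i (\<lambda>x. f x + g x) x = partial_deriv i f x + partial_deriv i g x"
  by (rule partial_deriv_eqI[THEN trans])
     (auto intro!: has_derivative_add frechet_derivative_works[THEN iffD1] assms simp: partial_deriv_def)

lemma partial_deriv_mult:
  assumes "f differentiable (at x)" "g differentiable (at x)"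
  shows "partial_deriv i (\<lambda>x. f x * g x) x = f x * partial_deriv i g x + partial_deriv i f x * g x"
  by (rule partial_deriv_eqI[THEN trans])
     (auto intro!: has_derivative_mult frechet_derivative_works[THEN iffD1] assms simp: partial_deriv_def)

lemma smooth_alg_partial_deriv:
  fixes f :: "real ^ 'n \<Rightarrow> real"
  shows "f \<in> smooth_alg \<Longrightarrow> partial_deriv i f \<in> smooth_alg"
proof (induction rule: smooth_alg.induct)
  case (base f)
  then show ?case by (auto intro: smooth_alg.base smooth_partial_deriv)
next
  case (flat k s j c)
  have "partial_deriv i (\<lambda>x::real^'n. flat_exp k (s * x $ j + c)) =
    (\<lambda>x. (flat_exp (k + 2) (s * x $ j + c) + (- real k) * flat_exp (k + 1) (s * x $ j + c))
       * (s * axis i 1 $ j))"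
    by (rule ext) (simp add: partial_deriv_eqI[OF flat_exp_coord_has_derivative])
  then show ?case by (simp only:) (intro smooth_alg.intros)
next
  case (const c)
  have "partial_deriv i (\<lambda>x::real^'n. c) = (\<lambda>_. 0)"
    by (rule ext) (simp add: partial_deriv_eqI[OF has_derivative_const])
  then show ?case by (simp add: smooth_alg.const)
next
  case (add f g)
  have "partial_deriv i (\<lambda>x. f x + g x) = (\<lambda>x. partial_deriv i f x + partial_deriv i g x)"
    by (rule ext) (simp add: partial_deriv_add add.hyps smooth_alg_differentiable)
  then show ?case using add by (simp add: smooth_alg.add)
next
  case (mult f g)
  have "partial_deriv i (\<lambda>x. f x * g x) = (\<lambda>x. f x * partial_deriv i g x + partial_deriv i f x * g x)"
    by (rule ext) (simp add: partial_deriv_mult mult.hyps smooth_alg_differentiable)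
  then show ?case using mult by (simp add: smooth_alg.add smooth_alg.mult)
qed

text \<open>Turns the closure rules of the inductive set into closure rules for
  \<open>smooth\<close>, which avoids a Leibniz formula for iterated derivatives.\<close>

lemma smooth_alg_eq: "smooth_alg = Collect smooth"
proof -
  have "partial_derivs is f \<in> smooth_alg" if "f \<in> smooth_alg" for f :: "real ^ 'n \<Rightarrow> real" and "is"
    using that by (induction "is") (auto intro: smooth_alg_partial_deriv)
  then have "smooth f" if "f \<in> smooth_alg" for f :: "real ^ 'n \<Rightarrow> real"
    unfolding smooth_def using that smooth_alg_differentiable by blast
  then show ?thesis
    by (auto intro: smooth_alg.base)
qed

lemma smooth_flat_exp: "smooth (\<lambda>x. flat_exp k (s * x $ i + c))"
  and smooth_const: "smooth (\<lambda>_. a)"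
  and smooth_add: "smooth f \<Longrightarrow> smooth g \<Longrightarrow> smooth (\<lambda>x. f x + g x)"
  and smooth_mult: "smooth f \<Longrightarrow> smooth g \<Longrightarrow> smooth (\<lambda>x. f x * g x)"
  using smooth_alg.intros unfolding smooth_alg_eq by auto

lemma smooth_prod: "(\<And>i. i \<in> I \<Longrightarrow> smooth (f i)) \<Longrightarrow> smooth (\<lambda>x. \<Prod>i\<in>I. f i x)"
  by (induction I rule: infinite_finite_induct) (auto intro: smooth_const smooth_mult)

lemma smooth_power: "smooth f \<Longrightarrow> smooth (\<lambda>x. f x ^ k)"
  by (induction k) (auto intro: smooth_const smooth_mult)

section \<open>Translations and supports of test functions\<close>

lemma has_derivative_shift:
  assumes "(f has_derivative D) (at (x + h))"
  shows "((\<lambda>x. f (x + h)) has_derivative D) (at x)"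
proof -
  have "((\<lambda>x. x + h) has_derivative (\<lambda>v. v)) (at x)"
    by (auto intro!: derivative_eq_intros)
  from has_derivative_compose[OF this assms] show ?thesis .
qed

lemma partial_derivs_shift:
  assumes "smooth f"
  shows "partial_derivs is (\<lambda>x. f (x + h)) = (\<lambda>x. partial_derivs is f (x + h))"
proof (induction "is")
  case (Cons i "is")
  have "partial_derivs is f differentiable (at (x + h))" for x
    using assms smooth_def by blast
  then show ?case
    by (auto simp: Cons fun_eq_iff partial_deriv_def[of i "partial_derivs is f"]
        intro!: partial_deriv_eqI has_derivative_shift frechet_derivative_works[THEN iffD1])
qed auto

lemma smooth_shift: "smooth f \<Longrightarrow> smooth (\<lambda>x. f (x + h))"
  unfolding smooth_def
proof (intro allI)
  fix "is" x assume *: "\<forall>is x. partial_derivs is f differentiable at x"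
  then have "((\<lambda>x. partial_derivs is f (x + h)) has_derivative
     frechet_derivative (partial_derivs is f) (at (x + h))) (at x)"
    by (intro has_derivative_shift frechet_derivative_works[THEN iffD1]) auto
  then show "partial_derivs is (\<lambda>x. f (x + h)) differentiable at x"
    using partial_derivs_shift[of f "is" h] * unfolding smooth_def differentiable_def by auto
qed

text \<open>The complement of the support is open, so each iterated derivative vanishes near the
  point and the next one vanishes at it.\<close>

lemma partial_derivs_zero_off_support:
  assumes "x \<notin> closure {x. f x \<noteq> 0}"
  shows "partial_derivs is f x = 0"
  using assms
proof (induction "is" arbitrary: x)
  case Nil
  then show ?case using closure_subset[of "{x. f x \<noteq> 0}"] by auto
next
  case (Cons i "is")
  let ?O = "- closure {x. f x \<noteq> 0}"
  have "((\<lambda>_. 0) has_derivative (\<lambda>_. 0)) (at x)" by simp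
  then have "(partial_derivs is f has_derivative (\<lambda>_. 0)) (at x)"
    by (rule has_derivative_transform_within_open[of _ _ _ _ ?O]) (use Cons in auto)
  then show ?case by (simp add: partial_deriv_eqI)
qed

lemma test_functions_smooth: "\<phi> \<in> test_functions U \<Longrightarrow> smooth \<phi>"
  by (simp add: test_functions_def)

lemma compact_closure_subset:
  fixes A :: "'a::heine_borel set"
  shows "compact K \<Longrightarrow> closure A \<subseteq> K \<Longrightarrow> compact (closure A)"
  by (metis closed_closure compact_Int_closed inf.absorb_iff2)

lemma test_functions_partial_derivs:
  assumes "\<phi> \<in> test_functions U"
  shows "partial_derivs is \<phi> \<in> test_functions U"
proof -
  have sub: "closure {x. partial_derivs is \<phi> x \<noteq> 0} \<subseteq> closure {x. \<phi> x \<noteq> 0}"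
    using partial_derivs_zero_off_support[of _ \<phi> "is"] by (intro closure_minimal) auto
  moreover from this have "compact (closure {x. partial_derivs is \<phi> x \<noteq> 0})"
    using assms by (intro compact_closure_subset) (auto simp: test_functions_def)
  ultimately show ?thesis
    using assms smooth_partial_derivs[of \<phi> "is"] by (auto simp: test_functions_def)
qed

lemma test_functions_subset_support:
  assumes "\<phi> \<in> test_functions U" "smooth \<psi>" "\<And>x. \<phi> x = 0 \<Longrightarrow> \<psi> x = 0"
  shows "\<psi> \<in> test_functions U"
proof -
  have sub: "closure {x. \<psi> x \<noteq> 0} \<subseteq> closure {x. \<phi> x \<noteq> 0}"
    using assms(3) by (intro closure_mono) auto
  moreover from this have "compact (closure {x. \<psi> x \<noteq> 0})"
    using assms(1) by (intro compact_closure_subset) (auto simp: test_functions_def)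
  ultimately show ?thesis
    using assms by (auto simp: test_functions_def)
qed

lemma test_functions_zero: "(\<lambda>_. 0) \<in> test_functions U"
  by (simp add: test_functions_def smooth_const)

lemma test_functions_scale:
  assumes "\<phi> \<in> test_functions U" shows "(\<lambda>x. c * \<phi> x) \<in> test_functions U"
  using assms by (rule test_functions_subset_support)
    (auto intro: smooth_mult smooth_const test_functions_smooth[OF assms])

lemma test_functions_mult:
  assumes "\<phi> \<in> test_functions U" "smooth \<psi>" shows "(\<lambda>x. \<phi> x * \<psi> x) \<in> test_functions U"
  using assms(1) by (rule test_functions_subset_support)
    (auto intro: smooth_mult test_functions_smooth assms)

lemma test_functions_add:
  assumes "\<phi> \<in> test_functions U" "\<psi> \<in> test_functions U"
  shows "(\<lambda>x. \<phi> x + \<psi> x) \<in> test_functions U"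
proof -
  let ?K = "closure {x. \<phi> x \<noteq> 0} \<union> closure {x. \<psi> x \<noteq> 0}"
  have K: "compact ?K" "?K \<subseteq> U"
    using assms by (auto simp: test_functions_def)
  have sub: "closure {x. \<phi> x + \<psi> x \<noteq> 0} \<subseteq> ?K"
    unfolding closure_Un[symmetric] by (intro closure_mono) auto
  then have "compact (closure {x. \<phi> x + \<psi> x \<noteq> 0})"
    using K(1) by (rule compact_closure_subset[rotated])
  then show ?thesis
    using assms sub K(2) by (auto simp: test_functions_def intro: smooth_add)
qed

lemma test_functions_shift:
  assumes "\<phi> \<in> test_functions U"  and "\<And>x. x \<in> U \<Longrightarrow> x - h \<in> V"
  shows "(\<lambda>x. \<phi> (x + h)) \<in> test_functions V"
proof -
  have eq: "closure {x. \<phi> (x + h) \<noteq> 0} = (\<lambda>x. - h + x) ` closure {x. \<phi> x \<noteq> 0}"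
  proof -
    have "{x. \<phi> (x + h) \<noteq> 0} = (\<lambda>x. - h + x) ` {x. \<phi> x \<noteq> 0}"
      by (auto simp: image_iff) (metis add.commute add_diff_cancel diff_add_cancel minus_add_cancel)
    then show ?thesis by (simp add: closure_translation closure_translation_subtract)
  qed
  have "compact (closure {x. \<phi> x \<noteq> 0})" "closure {x. \<phi> x \<noteq> 0} \<subseteq> U"
    using assms by (auto simp: test_functions_def)
  then show ?thesis
    using assms(2) smooth_shift[of \<phi> h] assms(1) unfolding test_functions_def mem_Collect_eq eq
    by (auto intro!: compact_continuous_image continuous_intros simp del: compact_closure)
qed

lemma test_functions_support:
  "\<phi> \<in> test_functions U \<Longrightarrow> x \<notin> U \<Longrightarrow> partial_derivs is \<phi> x = 0"
  by (rule partial_derivs_zero_off_support) (auto simp: test_functions_def)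

lemma test_functions_bounded:
  assumes "\<phi> \<in> test_functions U"
  obtains C where "\<And>x. \<bar>partial_derivs is \<phi> x\<bar> \<le> C"
proof -
  let ?K = "closure {x. \<phi> x \<noteq> 0}"
  have "compact (partial_derivs is \<phi> ` ?K)"
    using assms by (intro compact_continuous_image smooth_continuous_on smooth_partial_derivs)
       (auto simp: test_functions_def)
  then obtain C where C: "\<And>x. x \<in> ?K \<Longrightarrow> \<bar>partial_derivs is \<phi> x\<bar> \<le> C"
    using compact_imp_bounded[THEN bounded_iff[THEN iffD1]] by fastforce
  show ?thesis
  proof
    show "\<bar>partial_derivs is \<phi> x\<bar> \<le> max C 0" for x
      using C[of x] partial_derivs_zero_off_support[of x \<phi> "is"] by (cases "x \<in> ?K") auto
  qed
qed

text \<open>A product of flat functions of the signed distances to the faces. The strict upper bound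
  1 is wanted because powers of 1 - \<psi> must tend to 0 on the box.\<close>

lemma box_bump_exists:
  fixes a b :: "real ^ 'n"
  obtains \<psi> where "smooth \<psi>" "\<And>x. 0 \<le> \<psi> x" "\<And>x. \<psi> x < 1" "\<And>x. 0 < \<psi> x \<longleftrightarrow> x \<in> box a b"
proof
  define \<psi> :: "real ^ 'n \<Rightarrow> real" where "\<psi> x = (\<Prod>i\<in>UNIV. flat_exp 0 (x $ i - a $ i) * flat_exp 0 (b $ i - x $ i))" for x
  have 1: "0 \<le> flat_exp 0 s * flat_exp 0 t" "flat_exp 0 s * flat_exp 0 t < 1" for s t
    using mult_strict_mono[OF flat_exp_range(2) flat_exp_range(2), of t s] flat_exp_range
    by (auto simp: mult_ac)
  show "smooth \<psi>"
    unfolding \<psi>_def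
    using smooth_flat_exp[of 0 1 _ "- a $ _"] smooth_flat_exp[of 0 "-1" _ "b $ _"]
    by (intro smooth_prod smooth_mult) auto
  show nn: "0 \<le> \<psi> x" for x unfolding \<psi>_def using 1 by (intro prod_nonneg) auto
  show "\<psi> x < 1" for x
  proof -
    let ?f = "\<lambda>i. flat_exp 0 (x $ i - a $ i) * flat_exp 0 (b $ i - x $ i)"
    \<comment> \<open>All factors are below 1, but an empty product would equal 1. Since index types
      are nonempty, an arbitrary coordinate can be split off to get strictness.\<close>
    have "\<psi> x = ?f undefined * (\<Prod>i\<in>UNIV - {undefined}. ?f i)"
      unfolding \<psi>_def by (rule prod.remove) auto
    also have "\<dots> \<le> ?f undefined * 1"
      by (intro mult_left_mono prod_le_1) (use 1 in \<open>auto intro: less_imp_le\<close>)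
    also have "\<dots> < 1" using 1 by simp
    finally show ?thesis .
  qed
  show "0 < \<psi> x \<longleftrightarrow> x \<in> box a b" for x
    using nn[of x] unfolding less_le \<psi>_def
    by (auto simp: mem_box_cart flat_exp_eq_0_iff) (metis not_le)+
qed

section \<open>Lebesgue spaces on bounded open sets\<close>

text \<open>Bounding the sum by twice the larger summand gives a triangle inequality up to a
  constant for p-th powers.\<close>

lemma abs_add_powr_le:
  fixes a b p :: real
  assumes "p \<ge> 0"
  shows "\<bar>a + b\<bar> powr p \<le> 2 powr p * (\<bar>a\<bar> powr p + \<bar>b\<bar> powr p)"
proof -
  have "\<bar>a + b\<bar> powr p \<le> (2 * max \<bar>a\<bar> \<bar>b\<bar>) powr p"
    using assms by (intro powr_mono2) auto
  also have "\<dots> = 2 powr p * max \<bar>a\<bar> \<bar>b\<bar> powr p"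
    by (simp add: powr_mult)
  also have "\<dots> \<le> 2 powr p * (\<bar>a\<bar> powr p + \<bar>b\<bar> powr p)"
    by (intro mult_left_mono) (auto simp: max_def)
  finally show ?thesis .
qed

text \<open>Above the threshold \<delta> the factor |a|^(1-p) is at most \<delta>^(1-p). After
  integration this plays the role of Hoelder's inequality: \<delta> is fixed small first, then the
  p-th powers are made small.\<close>

lemma abs_le_delta_powr:
  fixes a p \<delta> :: real
  assumes "p \<ge> 1" "\<delta> > 0"
  shows "\<bar>a\<bar> \<le> \<delta> + \<delta> powr (1 - p) * \<bar>a\<bar> powr p"
proof (cases "\<bar>a\<bar> \<le> \<delta>")
  case True
  then show ?thesis by (simp add: add_increasing2)
next
  case False
  have "\<bar>a\<bar> = \<bar>a\<bar> powr (1 - p) * \<bar>a\<bar> powr p"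
    using False assms by (simp flip: powr_add)
  also have "\<dots> \<le> \<delta> powr (1 - p) * \<bar>a\<bar> powr p"
    using False assms by (intro mult_right_mono powr_mono2') auto
  finally show ?thesis using assms by linarith
qed

locale sobolev_domain =
  fixes U :: "(real ^ 'n) set" and p :: real
  assumes open_U: "open U" and bounded_U: "bounded U" and p_gt_1: "p > 1"
begin

abbreviation M :: "(real ^ 'n) measure" where "M \<equiv> lebesgue_on U"

definition Ip :: "(real ^ 'n \<Rightarrow> real) \<Rightarrow> real" where
  "Ip f = (LINT x|M. \<bar>f x\<bar> powr p)"

lemma U_sets: "U \<in> sets lebesgue" and U_sets_borel: "U \<in> sets borel"
  using open_U by auto

lemma finite_measure_M: "finite_measure M"
  using open_U bounded_U by (intro finite_measure_lebesgue_on lmeasurable_open)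

lemma Lp_borel: "f \<in> Lp U p \<Longrightarrow> f \<in> borel_measurable M"
  and Lp_integrable_powr: "f \<in> Lp U p \<Longrightarrow> integrable M (\<lambda>x. \<bar>f x\<bar> powr p)"
  by (auto simp: Lp_def)

lemma Lp_integrable:
  assumes "f \<in> Lp U p" shows "integrable M f"
proof (rule Bochner_Integration.integrable_bound)
  interpret finite_measure M by (rule finite_measure_M)
  show "integrable M (\<lambda>x. 1 + \<bar>f x\<bar> powr p)"
    using Lp_integrable_powr[OF assms] by auto
  show "AE x in M. norm (f x) \<le> norm (1 + \<bar>f x\<bar> powr p)"
    using abs_le_delta_powr[of p 1] p_gt_1 by (auto simp: add_increasing)
qed (use assms in \<open>simp add: Lp_borel\<close>)

lemma Lp_add:
  assumes "f \<in> Lp U p" "g \<in> Lp U p"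
  shows "(\<lambda>x. f x + g x) \<in> Lp U p"
proof -
  have [measurable]: "f \<in> borel_measurable M" "g \<in> borel_measurable M"
    using assms by (auto simp: Lp_borel)
  have "integrable M (\<lambda>x. \<bar>f x + g x\<bar> powr p)"
    by (rule Bochner_Integration.integrable_bound[of _ "\<lambda>x. 2 powr p * (\<bar>f x\<bar> powr p + \<bar>g x\<bar> powr p)"])
       (use assms abs_add_powr_le[of p] p_gt_1 in \<open>auto intro: Lp_integrable_powr\<close>)
  then show ?thesis by (simp add: Lp_def)
qed

lemma Lp_scale:
  assumes "f \<in> Lp U p" shows "(\<lambda>x. c * f x) \<in> Lp U p"
  using assms by (auto simp: Lp_def abs_mult powr_mult)

lemma Lp_diff: "f \<in> Lp U p \<Longrightarrow> g \<in> Lp U p \<Longrightarrow> (\<lambda>x. f x - g x) \<in> Lp U p"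
  using Lp_add[of f "\<lambda>x. -1 * g x"] Lp_scale[of g "-1"] by simp

lemma Ip_nonneg: "0 \<le> Ip f"
  unfolding Ip_def by (intro integral_nonneg_AE) auto

lemma Ip_scale: "Ip (\<lambda>x. c * f x) = \<bar>c\<bar> powr p * Ip f"
  by (simp add: Ip_def abs_mult powr_mult)

lemma Ip_add_le:
  assumes "f \<in> Lp U p" "g \<in> Lp U p"
  shows "Ip (\<lambda>x. f x + g x) \<le> 2 powr p * (Ip f + Ip g)"
proof -
  have "Ip (\<lambda>x. f x + g x) \<le> (LINT x|M. 2 powr p * (\<bar>f x\<bar> powr p + \<bar>g x\<bar> powr p))"
    unfolding Ip_def using assms abs_add_powr_le[of p] p_gt_1
    by (intro integral_mono) (auto intro!: Lp_integrable_powr Lp_add)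
  also have "\<dots> = 2 powr p * (Ip f + Ip g)"
    using assms by (simp add: Ip_def Lp_integrable_powr)
  finally show ?thesis .
qed

lemma Ip_diff_le:
  assumes "f \<in> Lp U p" "g \<in> Lp U p"
  shows "Ip (\<lambda>x. f x - g x) \<le> 2 powr p * (Ip f + Ip g)"
  using Ip_add_le[OF assms(1) Lp_scale[OF assms(2), of "-1"]] Ip_scale[of "-1" g] by simp

lemma Ip_cong_AE:
  assumes "f \<in> borel_measurable M" "g \<in> borel_measurable M" "AE x in M. f x = g x"
  shows "Ip f = Ip g"
  unfolding Ip_def using assms by (intro integral_cong_AE) auto

lemma L1_le_Ip:
  assumes "f \<in> Lp U p" "\<delta> > 0"
  shows "(LINT x|M. \<bar>f x\<bar>) \<le> \<delta> * measure M U + \<delta> powr (1 - p) * Ip f"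
proof -
  interpret finite_measure M by (rule finite_measure_M)
  have "(LINT x|M. \<bar>f x\<bar>) \<le> (LINT x|M. \<delta> + \<delta> powr (1 - p) * \<bar>f x\<bar> powr p)"
    using assms abs_le_delta_powr[of p \<delta>] p_gt_1
    by (intro integral_mono) (auto simp: Lp_integrable_powr Lp_integrable)
  also have "\<dots> = \<delta> * measure M U + \<delta> powr (1 - p) * Ip f"
    using assms by (simp add: Ip_def Lp_integrable_powr mult.commute)
  finally show ?thesis .
qed

lemma L1_small:
  assumes "e > 0"
  obtains d where "d > 0" "\<And>f. f \<in> Lp U p \<Longrightarrow> Ip f < d \<Longrightarrow> (LINT x|M. \<bar>f x\<bar>) < e"
proof -
  \<comment> \<open>The added 1 allows division by \<open>m\<close> when \<open>U\<close> has
    measure zero; \<delta> is such that the constant part contributes at most e / 2.\<close>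
  define m where "m = measure M U + 1"
  have m: "m > 0" unfolding m_def by (simp add: add_nonneg_pos)
  define \<delta> where "\<delta> = e / (2 * m)"
  have \<delta>: "\<delta> > 0" using m assms by (simp add: \<delta>_def)
  have \<delta>p: "\<delta> powr (1 - p) > 0" using \<delta> by simp
  show thesis
  proof
    show "e / (2 * \<delta> powr (1 - p)) > 0" using \<delta>p assms by simp
    fix f assume f: "f \<in> Lp U p" "Ip f < e / (2 * \<delta> powr (1 - p))"
    have "\<delta> * measure M U \<le> \<delta> * m" using \<delta> by (simp add: m_def)
    also have "\<delta> * m = e / 2" using m by (simp add: \<delta>_def)
    finally have 1: "\<delta> * measure M U \<le> e / 2" .
    have 2: "\<delta> powr (1 - p) * Ip f < e / 2"
      using f(2) \<delta>p by (simp add: field_simps)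
    show "(LINT x|M. \<bar>f x\<bar>) < e"
      using L1_le_Ip[OF f(1) \<delta>] 1 2 by linarith
  qed
qed

lemma L1_tendsto:
  assumes "\<And>n. f n \<in> Lp U p" "(\<lambda>n. Ip (f n)) \<longlonglongrightarrow> 0"
  shows "(\<lambda>n. LINT x|M. \<bar>f n x\<bar>) \<longlonglongrightarrow> 0"
proof (rule LIMSEQ_I)
  fix e :: real assume "e > 0"
  then obtain d where d: "d > 0" "\<And>f. f \<in> Lp U p \<Longrightarrow> Ip f < d \<Longrightarrow> (LINT x|M. \<bar>f x\<bar>) < e"
    using L1_small by metis
  obtain N where "\<And>n. n \<ge> N \<Longrightarrow> Ip (f n) < d"
    using LIMSEQ_D[OF assms(2) d(1)] Ip_nonneg by auto
  then show "\<exists>no. \<forall>n\<ge>no. norm ((LINT x|M. \<bar>f n x\<bar>) - 0) < e"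
    using d(2) assms(1) by (intro exI[of _ N]) auto
qed

text \<open>The Riesz-Fischer theorem. On a finite measure space an L^p Cauchy sequence is Cauchy in
  L^1, hence has a subsequence that is Cauchy almost everywhere; Fatou's lemma along it carries the
  L^p Cauchy estimate over to the limit.\<close>

lemma Lp_complete:
  assumes s: "\<And>n. s n \<in> Lp U p"
    and C: "\<And>e. e > 0 \<Longrightarrow> \<exists>N. \<forall>i\<ge>N. \<forall>j\<ge>N. Ip (\<lambda>x. s i x - s j x) < e"
  obtains f where "f \<in> Lp U p" "(\<lambda>n. Ip (\<lambda>x. s n x - f x)) \<longlonglongrightarrow> 0"
proof -
  have [measurable]: "s n \<in> borel_measurable M" for n using s by (simp add: Lp_borel)
  have "\<exists>N. \<forall>i\<ge>N. \<forall>j\<ge>N. (LINT x|M. norm (s i x - s j x)) < e" if e: "e > 0" for e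
  proof -
    obtain d where d: "d > 0" "\<And>f. f \<in> Lp U p \<Longrightarrow> Ip f < d \<Longrightarrow> (LINT x|M. \<bar>f x\<bar>) < e"
      using L1_small[OF e] by blast
    obtain N where "\<forall>i\<ge>N. \<forall>j\<ge>N. Ip (\<lambda>x. s i x - s j x) < d" using C[OF d(1)] by blast
    then have "\<forall>i\<ge>N. \<forall>j\<ge>N. (LINT x|M. norm (s i x - s j x)) < e"
      using d(2)[OF Lp_diff[OF s s]] by simp
    then show ?thesis ..
  qed
  then obtain r where r: "strict_mono r" "AE x in M. Cauchy (\<lambda>i. s (r i) x)"
    by (rule cauchy_L1_AE_cauchy_subseq[of M s, OF Lp_integrable[OF s]]) auto
  define f where "f x = lim (\<lambda>i. s (r i) x)" for x
  have [measurable]: "f \<in> borel_measurable M" unfolding f_def by measurable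
  have ae: "AE x in M. (\<lambda>i. s (r i) x) \<longlonglongrightarrow> f x"
    using r(2) by eventually_elim (simp add: f_def Cauchy_convergent_iff convergent_LIMSEQ_iff)
  \<comment> \<open>Fatou in the index of the subsequence with \<open>n\<close> fixed gives
    integrability and the estimate at once.\<close>
  have key: "integrable M (\<lambda>x. \<bar>s n x - f x\<bar> powr p) \<and> Ip (\<lambda>x. s n x - f x) \<le> e"
    if e: "e > 0" and N: "\<And>i j. i \<ge> N \<Longrightarrow> j \<ge> N \<Longrightarrow> Ip (\<lambda>x. s i x - s j x) < e" and n: "n \<ge> N" for e N n
  proof -
    have "(\<integral>\<^sup>+x. ennreal (\<bar>s n x - f x\<bar> powr p) \<partial>M) =
       (\<integral>\<^sup>+x. liminf (\<lambda>i. ennreal (\<bar>s n x - s (r i) x\<bar> powr p)) \<partial>M)"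
    proof (rule nn_integral_cong_AE, use ae in eventually_elim)
      case (elim x)
      have "(\<lambda>i. ennreal (\<bar>s n x - s (r i) x\<bar> powr p)) \<longlonglongrightarrow> ennreal (\<bar>s n x - f x\<bar> powr p)"
        using p_gt_1 by (intro tendsto_ennrealI tendsto_powr2 tendsto_intros elim) (auto simp: eventually_sequentially)
      then show ?case by (intro lim_imp_Liminf[symmetric]) auto
    qed
    also have "\<dots> \<le> liminf (\<lambda>i. \<integral>\<^sup>+x. ennreal (\<bar>s n x - s (r i) x\<bar> powr p) \<partial>M)"
      by (rule nn_integral_liminf) measurable
    also have "\<dots> \<le> ennreal e"
    proof (rule Liminf_le)
      show "\<forall>\<^sub>F i in sequentially. (\<integral>\<^sup>+x. ennreal (\<bar>s n x - s (r i) x\<bar> powr p) \<partial>M) \<le> ennreal e"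
        unfolding eventually_sequentially
      proof (intro exI[of _ N] allI impI)
        fix i assume "N \<le> i"
        then have "r i \<ge> N" using seq_suble[OF r(1), of i] by simp
        then have "Ip (\<lambda>x. s n x - s (r i) x) < e" using N n by simp
        moreover have "(\<integral>\<^sup>+x. ennreal (\<bar>s n x - s (r i) x\<bar> powr p) \<partial>M) = ennreal (Ip (\<lambda>x. s n x - s (r i) x))"
          unfolding Ip_def by (rule nn_integral_eq_integral) (use Lp_diff[OF s s] in \<open>auto simp: Lp_def\<close>)
        ultimately show "(\<integral>\<^sup>+x. ennreal (\<bar>s n x - s (r i) x\<bar> powr p) \<partial>M) \<le> ennreal e"
          by (simp add: ennreal_leI)
      qed
    qed auto
    finally have *: "(\<integral>\<^sup>+x. ennreal (\<bar>s n x - f x\<bar> powr p) \<partial>M) \<le> ennreal e" .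
    then have i: "integrable M (\<lambda>x. \<bar>s n x - f x\<bar> powr p)"
      by (intro integrableI_bounded) (auto simp: le_less_trans)
    then have "ennreal (Ip (\<lambda>x. s n x - f x)) \<le> ennreal e"
      using * by (subst (asm) nn_integral_eq_integral) (auto simp: Ip_def)
    then show ?thesis using i e by simp
  qed
  obtain N1 where "\<forall>i\<ge>N1. \<forall>j\<ge>N1. Ip (\<lambda>x. s i x - s j x) < 1" using C[of 1] by auto
  with key[of 1 N1 N1] have "(\<lambda>x. s N1 x - f x) \<in> Lp U p" by (simp add: Lp_def)
  \<comment> \<open>The limit is \<open>s N1\<close> minus the difference just shown to lie in
    L^p.\<close>
  from Lp_diff[OF s[of N1] this] have f: "f \<in> Lp U p" by simp
  show thesis
  proof (rule that[OF f], rule LIMSEQ_I)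
    fix e :: real assume e: "e > 0"
    then obtain N where "\<forall>i\<ge>N. \<forall>j\<ge>N. Ip (\<lambda>x. s i x - s j x) < e / 2" using C[of "e / 2"] by auto
    then have "Ip (\<lambda>x. s n x - f x) \<le> e / 2" if "n \<ge> N" for n using key[of "e / 2" N n] e that by simp
    then show "\<exists>no. \<forall>n\<ge>no. norm (Ip (\<lambda>x. s n x - f x) - 0) < e"
      using e Ip_nonneg by (intro exI[of _ N]) (fastforce simp: )
  qed
qed

text \<open>Applying the L^1 subsequence theorem to the sum of all absolute values yields one
  subsequence that serves every index.\<close>

lemma Lp_AE_subseq:
  assumes "finite A" "\<And>a n. a \<in> A \<Longrightarrow> f a n \<in> Lp U p"
    "\<And>a. a \<in> A \<Longrightarrow> (\<lambda>n. Ip (f a n)) \<longlonglongrightarrow> 0"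
  obtains r where "strict_mono r" "AE x in M. \<forall>a\<in>A. (\<lambda>n. f a (r n) x) \<longlonglongrightarrow> 0"
proof -
  define h where "h n x = (\<Sum>a\<in>A. \<bar>f a n x\<bar>)" for n x
  have h: "integrable M (h n)" for n
    unfolding h_def using assms Lp_integrable by (intro Bochner_Integration.integrable_sum) auto
  have "(\<lambda>n. LINT x|M. h n x) = (\<lambda>n. \<Sum>a\<in>A. LINT x|M. \<bar>f a n x\<bar>)"
    unfolding h_def using assms Lp_integrable by (intro ext Bochner_Integration.integral_sum) auto
  moreover have "\<dots> \<longlonglongrightarrow> 0"
    using L1_tendsto assms by (intro tendsto_null_sum) auto
  ultimately have "(\<lambda>n. LINT x|M. norm (h n x)) \<longlonglongrightarrow> 0"
    by (simp add: h_def sum_nonneg)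
  from tendsto_L1_AE_subseq[OF h this]
  obtain r where r: "strict_mono r" "AE x in M. (\<lambda>n. h (r n) x) \<longlonglongrightarrow> 0" by auto
  show thesis
  proof (rule that[OF r(1)], use r(2) in eventually_elim)
    case (elim x)
    show ?case
    proof
      fix a assume a: "a \<in> A"
      have "(\<lambda>n. \<bar>f a (r n) x\<bar>) \<longlonglongrightarrow> 0"
        by (rule tendsto_sandwich[OF _ _ tendsto_const elim])
           (auto simp: h_def a assms(1) intro!: always_eventually member_le_sum)
      then show "(\<lambda>n. f a (r n) x) \<longlonglongrightarrow> 0" by (simp add: tendsto_rabs_zero_iff)
    qed
  qed
qed

lemma Lp_loc:
  assumes "f \<in> Lp U p" shows "f locally_integrable_on U"
proof -
  have "set_integrable lebesgue U f"
    using Lp_integrable[OF assms] U_sets by (simp add: set_integrable_def integrable_restrict_space)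
  then show ?thesis
    unfolding locally_integrable_on_def using set_integrable_subset compact_imp_closed
    by (metis borel_closed sets_completionI_sets sets_lborel)
qed

end

section \<open>Weak derivatives\<close>

text \<open>On the compact support \<open>f\<close> is integrable, and \<phi> is bounded; the
  indicator of the support changes nothing in the product.\<close>

lemma test_functions_integrable:
  assumes f: "f locally_integrable_on U" and \<phi>: "\<phi> \<in> test_functions U"
  shows "integrable lebesgue (\<lambda>x. f x * \<phi> x)"
proof -
  let ?K = "closure {x. \<phi> x \<noteq> 0}"
  have K: "compact ?K" "?K \<subseteq> U" using \<phi> by (auto simp: test_functions_def)
  obtain C where C: "\<And>x. \<bar>\<phi> x\<bar> \<le> C" using test_functions_bounded[OF \<phi>, of "[]"] by auto
  have int: "integrable lebesgue (\<lambda>x. indicator ?K x * f x)"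
    using f K by (auto simp: locally_integrable_on_def set_integrable_def)
  have [measurable]: "\<phi> \<in> borel_measurable lebesgue"
    using smooth_continuous_on[OF test_functions_smooth[OF \<phi>], of UNIV]
    by (intro measurable_completion) (simp add: borel_measurable_continuous_onI)
  have "integrable lebesgue (\<lambda>x. (indicator ?K x * f x) * \<phi> x)"
  proof (rule Bochner_Integration.integrable_bound)
    show "integrable lebesgue (\<lambda>x. C * (indicator ?K x * f x))" using int by simp
    show "(\<lambda>x. (indicator ?K x * f x) * \<phi> x) \<in> borel_measurable lebesgue"
      using borel_measurable_integrable[OF int] by measurable
    show "AE x in lebesgue. norm ((indicator ?K x * f x) * \<phi> x) \<le> norm (C * (indicator ?K x * f x))"
    proof (rule AE_I2)
      fix x
      have "\<bar>\<phi> x\<bar> \<le> \<bar>C\<bar>" using C[of x] by linarith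
      then show "norm ((indicator ?K x * f x) * \<phi> x) \<le> norm (C * (indicator ?K x * f x))"
        by (simp add: abs_mult mult.commute mult_right_mono)
    qed
  qed
  moreover have "(\<lambda>x. (indicator ?K x * f x) * \<phi> x) = (\<lambda>x. f x * \<phi> x)"
    using closure_subset[of "{x. \<phi> x \<noteq> 0}"] by (auto simp: fun_eq_iff indicator_def)
  ultimately show ?thesis by simp
qed

text \<open>Moves test integrals from \<open>U\<close> to the whole space, where translation
  invariance and Fubini apply directly.\<close>

lemma test_functions_integral:
  fixes f :: "real ^ 'n \<Rightarrow> real"
  assumes \<phi>: "\<phi> \<in> test_functions U" and U: "U \<in> sets lebesgue"
  shows "(LINT x|lebesgue_on U. f x * partial_derivs is \<phi> x) =
    (LINT x|lebesgue. f x * partial_derivs is \<phi> x)"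
proof -
  have "(\<lambda>x. indicator U x *\<^sub>R (f x * partial_derivs is \<phi> x)) = (\<lambda>x. f x * partial_derivs is \<phi> x)"
    using test_functions_support[OF \<phi>, of _ "is"] by (auto simp: fun_eq_iff indicator_def)
  then show ?thesis using U by (subst integral_restrict_space) auto
qed

text \<open>Open boxes form an intersection-stable generator of the Borel sets, so a Dynkin class
  argument extends the vanishing integrals to all Borel sets.\<close>

lemma AE_lborel_zero_if_box_integrals:
  fixes g :: "'a::euclidean_space \<Rightarrow> real"
  assumes g: "integrable lborel g" and box: "\<And>a b. (LINT x|lborel. indicator (box a b) x * g x) = 0"
  shows "AE x in lborel. g x = 0"
proof (rule sigma_finite_measure.density_zero[OF sigma_finite_lborel g])
  have [measurable]: "g \<in> borel_measurable borel" using g by simp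
  have ind: "integrable lborel (\<lambda>x. indicator A x * g x)" if "A \<in> sets borel" for A
    using integrable_mult_indicator[OF _ g, of A] that by simp
  \<comment> \<open>Complements require the integral over the whole space, which is not a box; it is
    the limit of integrals over growing boxes.\<close>
  have tot: "(LINT x|lborel. g x) = 0"
  proof -
    define B where "B n = box (- real n *\<^sub>R One) (real n *\<^sub>R (One::'a))" for n
    have "(\<lambda>n. LINT x|lborel. indicator (B n) x * g x) \<longlonglongrightarrow> (LINT x|lborel. g x)"
    proof (rule integral_dominated_convergence[where w = "\<lambda>x. \<bar>g x\<bar>"])
      show "AE x in lborel. (\<lambda>n. indicator (B n) x * g x) \<longlonglongrightarrow> g x"
      proof (rule AE_I2, rule tendsto_eventually)
        fix x :: 'a
        obtain N where N: "norm x < real N" using reals_Archimedean2 by blast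
        have "x \<in> B n" if "n \<ge> N" for n
        proof -
          have "\<bar>x \<bullet> i\<bar> < real n" if "i \<in> Basis" for i
            using Basis_le_norm[OF that, of x] N \<open>n \<ge> N\<close> by linarith
          then show ?thesis by (auto simp: B_def mem_box abs_less_iff minus_less_iff)
        qed
        then show "\<forall>\<^sub>F n in sequentially. indicator (B n) x * g x = g x"
          by (auto simp: eventually_sequentially indicator_def intro!: exI[of _ N])
      qed
    qed (use g in \<open>auto simp: B_def abs_mult indicator_def\<close>)
    moreover have "(\<lambda>n. LINT x|lborel. indicator (B n) x * g x) = (\<lambda>n. 0)"
      unfolding B_def box ..
    ultimately show ?thesis using LIMSEQ_unique tendsto_const by metis
  qed
  fix A :: "'a set" assume "A \<in> sets lborel"
  then have A: "A \<in> sigma_sets UNIV (range (\<lambda>(a, b). box a b))"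
    by (simp add: borel_eq_box)
  have "Int_stable (range (\<lambda>(a, b). box a (b::'a)))"
    by (auto simp: Int_stable_def box_Int_box)
  moreover have "range (\<lambda>(a, b). box a (b::'a)) \<subseteq> Pow UNIV" by simp
  moreover note A
  ultimately have "A \<in> sets borel \<and> (LINT x|lborel. indicator A x * g x) = 0"
  proof (induction rule: sigma_sets_induct_disjoint)
    case (compl A)
    have "(LINT x|lborel. indicator (UNIV - A) x * g x) =
        (LINT x|lborel. g x - indicator A x * g x)"
      by (intro Bochner_Integration.integral_cong) (auto simp: indicator_def)
    also have "\<dots> = 0" using compl tot ind g by (subst Bochner_Integration.integral_diff) auto
    finally show ?case using compl by auto
  next
    case (union A)
    have [measurable]: "A i \<in> sets borel" for i using union(3) by blast
    have "(\<lambda>n. LINT x|lborel. (\<Sum>i<n. indicator (A i) x * g x)) \<longlonglongrightarrow> (LINT x|lborel. indicator (\<Union>i. A i) x * g x)"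
    proof (rule integral_dominated_convergence[where w = "\<lambda>x. \<bar>g x\<bar>"])
      have eq: "(\<Sum>i<n. indicator (A i) x * g x) = indicator (\<Union>i<n. A i) x * g x" for n x
        using union(1) by (subst indicator_UN_disjoint)
          (auto simp: sum_distrib_right disjoint_family_on_def)
      show "AE x in lborel. (\<lambda>n. \<Sum>i<n. indicator (A i) x * g x) \<longlonglongrightarrow> indicator (\<Union>i. A i) x * g x"
      proof (rule AE_I2, rule tendsto_eventually)
        fix x
        show "\<forall>\<^sub>F n in sequentially. (\<Sum>i<n. indicator (A i) x * g x) = indicator (\<Union>i. A i) x * g x"
        proof (cases "x \<in> (\<Union>i. A i)")
          case True
          then obtain k where "x \<in> A k" by auto
          then show ?thesis
            unfolding eq eventually_sequentially
            by (intro exI[of _ "Suc k"]) (auto simp: indicator_def)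
        next
          case False
          then show ?thesis unfolding eq by (auto simp: indicator_def)
        qed
      qed
      show "AE x in lborel. norm (\<Sum>i<n. indicator (A i) x * g x) \<le> \<bar>g x\<bar>" for n
        unfolding eq by (auto simp: indicator_def)
      show "integrable lborel (\<lambda>x. \<bar>g x\<bar>)" using g by simp
    qed measurable
    moreover have "(LINT x|lborel. (\<Sum>i<n. indicator (A i) x * g x)) = 0" for n
      using union ind by (subst Bochner_Integration.integral_sum) auto
    ultimately have "(LINT x|lborel. indicator (\<Union>i. A i) x * g x) = 0"
      by (simp only: LIMSEQ_const_iff)
    then show ?case using union by auto
  next
    case (basic A)
    then obtain a b where "A = box a b" by auto
    then show ?case using box[of a b] by simp
  qed simp
  then show "set_lebesgue_integral lborel A g = 0"
    by (simp add: set_lebesgue_integral_def)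
qed

text \<open>If \<open>0 \<le> \<psi> < 1\<close> is a smooth bump that is positive exactly on a box, then the functions
  \<open>1 - (1 - \<psi>) ^ k\<close> converge to the indicator function of the box.\<close>

lemma box_integral_zero:
  fixes f :: "real ^ 'n \<Rightarrow> real"
  assumes f: "f locally_integrable_on U" and ab: "cbox a b \<subseteq> U"
    and z: "\<And>\<phi>. \<phi> \<in> test_functions U \<Longrightarrow> (LINT x|lebesgue. f x * \<phi> x) = 0"
  shows "(LINT x|lebesgue. indicator (box a b) x * f x) = 0"
proof -
  obtain \<psi> where \<psi>: "smooth \<psi>" "\<And>x. 0 \<le> \<psi> x" "\<And>x. \<psi> x < 1" "\<And>x. 0 < \<psi> x \<longleftrightarrow> x \<in> box a b"
    using box_bump_exists[of a b] by blast
  have \<psi>0: "\<psi> x = 0 \<longleftrightarrow> x \<notin> box a b" for x using \<psi>(2,4)[of x] by auto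
  define \<phi> where "\<phi> k x = 1 - (1 - \<psi> x) ^ k" for k x
  have sm: "smooth (\<phi> k)" for k
  proof -
    have "smooth (\<lambda>x. 1 + (- 1) * (1 + (- 1) * \<psi> x) ^ k)"
      using \<psi>(1) by (intro smooth_add smooth_mult smooth_power smooth_const)
    then show ?thesis by (simp add: \<phi>_def[abs_def])
  qed
  have supp: "\<phi> k x = 0" if "x \<notin> box a b" for k x using that by (simp add: \<phi>_def \<psi>0[symmetric])
  have range: "0 \<le> \<phi> k x" "\<phi> k x \<le> 1" for k x
    using \<psi>(2,3)[of x] by (auto simp: \<phi>_def intro!: power_le_one)
  have \<phi>: "\<phi> k \<in> test_functions U" for k
  proof -
    have "closure {x. \<phi> k x \<noteq> 0} \<subseteq> cbox a b"
      using supp[of _ k] box_subset_cbox[of a b] by (intro closure_minimal) auto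
    then show ?thesis
      using sm ab unfolding test_functions_def
      by (auto simp del: compact_closure intro: compact_closure_subset[OF compact_cbox])
  qed
  have int: "integrable lebesgue (\<lambda>x. indicator (cbox a b) x * f x)"
    using f ab by (auto simp: locally_integrable_on_def set_integrable_def)
  have eq: "f x * \<phi> k x = (indicator (cbox a b) x * f x) * \<phi> k x" for k x
    using supp[of x k] box_subset_cbox[of a b] by (auto simp: indicator_def)
  have [measurable]: "(\<lambda>x. f x * \<phi> k x) \<in> borel_measurable lebesgue" for k
    using test_functions_integrable[OF f \<phi>] by blast
  have "(\<lambda>k. LINT x|lebesgue. f x * \<phi> k x) \<longlonglongrightarrow> (LINT x|lebesgue. indicator (box a b) x * f x)"
  proof (rule integral_dominated_convergence[where w = "\<lambda>x. \<bar>indicator (cbox a b) x * f x\<bar>"])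
    have "(\<lambda>x. indicator (box a b) x * (indicator (cbox a b) x * f x)) \<in> borel_measurable lebesgue"
      by (intro borel_measurable_times[OF _ borel_measurable_integrable[OF int]] borel_measurable_indicator) auto
    also have "(\<lambda>x. indicator (box a b) x * (indicator (cbox a b) x * f x)) = (\<lambda>x. indicator (box a b) x * f x)"
      using box_subset_cbox[of a b] by (auto simp: indicator_def fun_eq_iff)
    finally show "(\<lambda>x. indicator (box a b) x * f x) \<in> borel_measurable lebesgue" .
    show "AE x in lebesgue. (\<lambda>k. f x * \<phi> k x) \<longlonglongrightarrow> indicator (box a b) x * f x"
    proof (rule AE_I2)
      fix x
      show "(\<lambda>k. f x * \<phi> k x) \<longlonglongrightarrow> indicator (box a b) x * f x"
      proof (cases "x \<in> box a b")
        case True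
        then have "(\<lambda>k. f x * (1 - (1 - \<psi> x) ^ k)) \<longlonglongrightarrow> f x * (1 - 0)"
          using \<psi>(3,4)[of x] by (intro tendsto_intros LIMSEQ_power_zero) auto
        then show ?thesis using True by (simp add: \<phi>_def)
      qed (simp add: supp)
    qed
    show "AE x in lebesgue. norm (f x * \<phi> k x) \<le> \<bar>indicator (cbox a b) x * f x\<bar>" for k
    proof (rule AE_I2)
      fix x show "norm (f x * \<phi> k x) \<le> \<bar>indicator (cbox a b) x * f x\<bar>"
        unfolding eq using mult_left_mono[of "\<bar>\<phi> k x\<bar>" 1 "\<bar>indicator (cbox a b) x * f x\<bar>"] range[of k x]
        by (simp add: abs_mult)
    qed
  qed (use int in auto)
  then show ?thesis by (simp add: z[OF \<phi>] LIMSEQ_const_iff)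
qed

text \<open>The fundamental lemma of the calculus of variations. An open set is a countable union of
  closed boxes, and on each of them integrals over smaller open boxes are limits of test
  integrals.\<close>

lemma AE_zero_if_test_integrals:
  fixes f :: "real ^ 'n \<Rightarrow> real"
  assumes U: "open U" and f: "f locally_integrable_on U"
    and z: "\<And>\<phi>. \<phi> \<in> test_functions U \<Longrightarrow> (LINT x|lebesgue. f x * \<phi> x) = 0"
  shows "AE x in lebesgue. x \<in> U \<longrightarrow> f x = 0"
proof -
  obtain D where D: "countable D" "D \<subseteq> Pow U" "\<And>X. X \<in> D \<Longrightarrow> \<exists>a b. X = cbox a b" "\<Union>D = U"
    using open_countable_Union_open_cbox[OF U] by metis
  have "AE x in lebesgue. x \<in> X \<longrightarrow> f x = 0" if XD: "X \<in> D" for X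
  proof -
    obtain a b where X: "X = cbox a b" using D(3)[OF XD] by blast
    then have sub: "cbox a b \<subseteq> U" using D(2) XD by auto
    have int: "integrable lebesgue (\<lambda>x. indicator (cbox a b) x * f x)"
      using f sub by (auto simp: locally_integrable_on_def set_integrable_def)
    \<comment> \<open>The box criterion is about \<open>lborel\<close>, while \<open>f\<close> is
      only Lebesgue measurable, so a Borel version of its restriction to the closed box is
      examined.\<close>
    obtain g where [measurable]: "g \<in> borel_measurable lborel"
      and ae: "AE x in lborel. indicator (cbox a b) x * f x = g x"
      using completion_ex_borel_measurable_real[OF borel_measurable_integrable[OF int]] by blast
    have aeL: "AE x in lebesgue. indicator (cbox a b) x * f x = g x"
      using ae by (rule AE_completion)
    have "integrable lebesgue g"
      using int by (rule Bochner_Integration.integrable_cong_AE[THEN iffD1, rotated -1]) (use aeL in \<open>auto intro: measurable_completion borel_measurable_integrable[OF int]\<close>)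
    then have gi: "integrable lborel g" by (simp add: integrable_completion)
    have "AE x in lborel. g x = 0"
    proof (rule AE_lborel_zero_if_box_integrals[OF gi])
      fix c d
      obtain a' b' where box': "box c d \<inter> box a b = box a' b'"
        by (simp add: box_Int_box)
      \<comment> \<open>The intersection with the closed box must be traded for the intersection
        with the open box, which is again an open box; the boundary is a null set.\<close>
      have cb: "AE x in lebesgue. x \<notin> cbox a b - box a b"
      proof -
        have "cbox a b - box a b \<in> null_sets lborel"
          using negligible_frontier_interval[of a b] by (simp add: negligible_iff_null_sets null_sets_def)
        then have "cbox a b - box a b \<in> null_sets lebesgue" by (rule null_sets_completionI)
        then show ?thesis by (rule AE_not_in)
      qed
      have "(LINT x|lborel. indicator (box c d) x * g x) = (LINT x|lebesgue. indicator (box c d) x * g x)"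
        by (simp add: integral_completion)
      also have "\<dots> = (LINT x|lebesgue. indicator (box a' b') x * f x)"
      proof (rule integral_cong_AE)
        have "(\<lambda>x. indicator (box a' b') x * (indicator (cbox a b) x * f x)) \<in> borel_measurable lebesgue"
          by (intro borel_measurable_times[OF _ borel_measurable_integrable[OF int]] borel_measurable_indicator) auto
        also have "(\<lambda>x. indicator (box a' b') x * (indicator (cbox a b) x * f x)) = (\<lambda>x. indicator (box a' b') x * f x)"
          using box_subset_cbox[of a b] box' by (auto simp: indicator_def fun_eq_iff)
        finally show "(\<lambda>x. indicator (box a' b') x * f x) \<in> borel_measurable lebesgue" .
        show "AE x in lebesgue. indicator (box c d) x * g x = indicator (box a' b') x * f x"
          using aeL cb
        proof eventually_elim
          case (elim x)
          then show ?case using box' box_subset_cbox[of a b]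
            by (cases "x \<in> box c d"; cases "x \<in> box a b"; cases "x \<in> cbox a b") (auto simp: indicator_def)
        qed
      qed (rule measurable_completion, measurable)
      also have "\<dots> = 0"
      \<comment> \<open>Only for a nonempty open box is the closed box its closure and hence
        contained in the larger closed box.\<close>
      proof (cases "box a' b' = {}")
        case False
        then have "cbox a' b' = closure (box a' b')" by (simp add: closure_box)
        also have "\<dots> \<subseteq> cbox a b"
          using box' box_subset_cbox[of a b] by (intro closure_minimal) auto
        finally show ?thesis using sub by (intro box_integral_zero[OF f _ z]) auto
      qed simp
      finally show "(LINT x|lborel. indicator (box c d) x * g x) = 0" .
    qed
    then have "AE x in lebesgue. g x = 0" by (rule AE_completion)
    with aeL show ?thesis
      by eventually_elim (auto simp: X indicator_def)
  qed
  then have "AE x in lebesgue. \<forall>X\<in>D. x \<in> X \<longrightarrow> f x = 0"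
    unfolding AE_ball_countable[OF D(1)] by blast
  then show ?thesis unfolding D(4)[symmetric] by eventually_elim blast
qed

section \<open>Uniqueness, linearity and closedness of weak derivatives\<close>

lemma locally_integrable_on_add:
  "f locally_integrable_on U \<Longrightarrow> g locally_integrable_on U \<Longrightarrow> (\<lambda>x. f x + g x) locally_integrable_on U"
  by (simp add: locally_integrable_on_def)

lemma locally_integrable_on_scale:
  "f locally_integrable_on U \<Longrightarrow> (\<lambda>x. c * f x) locally_integrable_on U"
  by (auto simp: locally_integrable_on_def)

lemma locally_integrable_on_diff:
  "f locally_integrable_on U \<Longrightarrow> g locally_integrable_on U \<Longrightarrow> (\<lambda>x. f x - g x) locally_integrable_on U"
  using locally_integrable_on_add[of f U "\<lambda>x. -1 * g x"] locally_integrable_on_scale[of g U "-1"] by simp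

lemma is_weak_deriv_iff:
  fixes f v :: "real ^ 'n \<Rightarrow> real"
  assumes "open U"
  shows "is_weak_deriv U \<alpha> f v \<longleftrightarrow> f locally_integrable_on U \<and> v locally_integrable_on U \<and>
     (\<forall>\<phi>\<in>test_functions U. \<forall>is. mset is = \<alpha> \<longrightarrow>
        (LINT x|lebesgue. f x * partial_derivs is \<phi> x) = (-1) ^ size \<alpha> * (LINT x|lebesgue. v x * \<phi> x))"
proof -
  have U: "U \<in> sets lebesgue" using assms by auto
  show ?thesis
    unfolding is_weak_deriv_def
    using test_functions_integral[OF _ U, of _ f] test_functions_integral[OF _ U, of _ v "[]"]
    by simp
qed

lemma is_weak_deriv_unique:
  assumes U: "open U" and "is_weak_deriv U \<alpha> f v" "is_weak_deriv U \<alpha> f w"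
  shows "AE x in lebesgue_on U. v x = w x"
proof -
  have v: "v locally_integrable_on U" and w: "w locally_integrable_on U"
    using assms by (auto simp: is_weak_deriv_def)
  obtain "is" where "is": "mset is = \<alpha>" using ex_mset by blast
  have "AE x in lebesgue. x \<in> U \<longrightarrow> v x - w x = 0"
  proof (rule AE_zero_if_test_integrals[OF U locally_integrable_on_diff[OF v w]])
    fix \<phi> assume \<phi>: "\<phi> \<in> test_functions U"
    have "(LINT x|lebesgue. v x * \<phi> x) = (LINT x|lebesgue. w x * \<phi> x)"
      using assms \<phi> "is" unfolding is_weak_deriv_iff[OF U] by fastforce
    then show "(LINT x|lebesgue. (v x - w x) * \<phi> x) = 0"
      using test_functions_integrable[OF v \<phi>] test_functions_integrable[OF w \<phi>]
      by (simp add: left_diff_distrib)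
  qed
  then show ?thesis
    using U by (subst AE_restrict_space_iff) auto
qed

lemma is_weak_deriv_weak_deriv: "is_weak_deriv U \<alpha> f v \<Longrightarrow> is_weak_deriv U \<alpha> f (weak_deriv U \<alpha> f)"
  unfolding weak_deriv_def by (rule someI[where P = "is_weak_deriv U \<alpha> f"])

text \<open>The way to compute with the chosen representative: any weak derivative that can be
  exhibited agrees with it almost everywhere.\<close>

lemma weak_deriv_AE:
  "open U \<Longrightarrow> is_weak_deriv U \<alpha> f v \<Longrightarrow> AE x in lebesgue_on U. weak_deriv U \<alpha> f x = v x"
  by (rule is_weak_deriv_unique) (auto intro: is_weak_deriv_weak_deriv)

lemma is_weak_deriv_add:
  assumes U: "open U" and d: "is_weak_deriv U \<alpha> f v" "is_weak_deriv U \<alpha> g w"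
  shows "is_weak_deriv U \<alpha> (\<lambda>x. f x + g x) (\<lambda>x. v x + w x)"
proof -
  have l: "f locally_integrable_on U" "v locally_integrable_on U" "g locally_integrable_on U" "w locally_integrable_on U"
    using d by (auto simp: is_weak_deriv_def)
  show ?thesis
    unfolding is_weak_deriv_iff[OF U]
  proof (intro conjI ballI allI impI locally_integrable_on_add l)
    fix \<phi> "is" assume \<phi>: "\<phi> \<in> test_functions U" and "is": "mset is = \<alpha>"
    have "(LINT x|lebesgue. f x * partial_derivs is \<phi> x) = (-1) ^ size \<alpha> * (LINT x|lebesgue. v x * \<phi> x)"
      "(LINT x|lebesgue. g x * partial_derivs is \<phi> x) = (-1) ^ size \<alpha> * (LINT x|lebesgue. w x * \<phi> x)"
      using d \<phi> "is" unfolding is_weak_deriv_iff[OF U] by auto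
    then show "(LINT x|lebesgue. (f x + g x) * partial_derivs is \<phi> x) =
        (-1) ^ size \<alpha> * (LINT x|lebesgue. (v x + w x) * \<phi> x)"
      using l[THEN test_functions_integrable, OF \<phi>]
        l[THEN test_functions_integrable, OF test_functions_partial_derivs[OF \<phi>]]
      by (simp add: distrib_right distrib_left)
  qed
qed

lemma is_weak_deriv_scale:
  assumes U: "open U" and d: "is_weak_deriv U \<alpha> f v"
  shows "is_weak_deriv U \<alpha> (\<lambda>x. c * f x) (\<lambda>x. c * v x)"
  using d unfolding is_weak_deriv_iff[OF U] by (auto intro: locally_integrable_on_scale simp: mult.assoc)

lemma is_weak_deriv_diff:
  assumes U: "open U" and d: "is_weak_deriv U \<alpha> f v" "is_weak_deriv U \<alpha> g w"
  shows "is_weak_deriv U \<alpha> (\<lambda>x. f x - g x) (\<lambda>x. v x - w x)"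
  using is_weak_deriv_add[OF U d(1) is_weak_deriv_scale[OF U d(2), of "-1"]] by simp

lemma is_weak_deriv_empty: "f locally_integrable_on U \<Longrightarrow> is_weak_deriv U {#} f f"
  by (simp add: is_weak_deriv_def)

text \<open>Test functions are closed under partial derivatives, so the classical derivative of a test
  function can be shifted to it.\<close>

lemma is_weak_deriv_of_weak_deriv:
  assumes U: "open U" and d: "is_weak_deriv U {#i#} f v" "is_weak_deriv U {#i, i#} f w"
  shows "is_weak_deriv U {#i#} v w"
  unfolding is_weak_deriv_iff[OF U]
proof (intro conjI ballI allI impI)
  fix \<phi> "is" assume \<phi>: "\<phi> \<in> test_functions U" and "is": "mset is = {#i#}"
  then have [simp]: "is = [i]" by simp
  have "(LINT x|lebesgue. f x * partial_derivs [i, i] \<phi> x) = (LINT x|lebesgue. w x * \<phi> x)"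
    using d(2) \<phi> unfolding is_weak_deriv_iff[OF U] by (auto dest!: bspec[of _ _ \<phi>] spec[of _ "[i, i]"])
  moreover have "(LINT x|lebesgue. f x * partial_derivs [i] (partial_derivs [i] \<phi>) x) =
      - (LINT x|lebesgue. v x * partial_derivs [i] \<phi> x)"
    using d(1) test_functions_partial_derivs[OF \<phi>, of "[i]"] unfolding is_weak_deriv_iff[OF U] by fastforce
  ultimately show "(LINT x|lebesgue. v x * partial_derivs is \<phi> x) =
      (-1) ^ size {#i#} * (LINT x|lebesgue. w x * \<phi> x)"
    by simp
qed (use d in \<open>auto simp: is_weak_deriv_def\<close>)

context sobolev_domain
begin

text \<open>Derivatives of a test function are bounded, so L^1 convergence suffices, and L^p
  convergence on a finite measure space implies it.\<close>

lemma Lp_test_integral_tendsto: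
  assumes "\<And>n. f n \<in> Lp U p" "h \<in> Lp U p" "(\<lambda>n. Ip (\<lambda>x. f n x - h x)) \<longlonglongrightarrow> 0"
    and \<phi>: "\<phi> \<in> test_functions U"
  shows "(\<lambda>n. LINT x|lebesgue. f n x * partial_derivs is \<phi> x)
    \<longlonglongrightarrow> (LINT x|lebesgue. h x * partial_derivs is \<phi> x)"
proof -
  let ?\<psi> = "partial_derivs is \<phi>"
  have \<psi>: "?\<psi> \<in> test_functions U" by (rule test_functions_partial_derivs[OF \<phi>])
  obtain C where C: "\<And>x. \<bar>?\<psi> x\<bar> \<le> C" using test_functions_bounded[OF \<phi>] by blast
  have i: "integrable M (\<lambda>x. u x * ?\<psi> x)" if "u \<in> Lp U p" for u
    using integrable_mult_indicator[OF U_sets test_functions_integrable[OF Lp_loc[OF that] \<psi>]] U_sets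
    by (subst integrable_restrict_space) auto
  have "(\<lambda>n. (LINT x|M. f n x * ?\<psi> x) - (LINT x|M. h x * ?\<psi> x)) \<longlonglongrightarrow> 0"
  proof (rule Lim_null_comparison)
    show "\<forall>\<^sub>F n in sequentially. norm ((LINT x|M. f n x * ?\<psi> x) - (LINT x|M. h x * ?\<psi> x)) \<le> C * (LINT x|M. \<bar>f n x - h x\<bar>)"
    proof (rule always_eventually, rule allI)
      fix n
      have d: "(\<lambda>x. f n x - h x) \<in> Lp U p" using assms by (intro Lp_diff)
      have "(LINT x|M. f n x * ?\<psi> x) - (LINT x|M. h x * ?\<psi> x) = (LINT x|M. (f n x - h x) * ?\<psi> x)"
        using i assms by (simp add: left_diff_distrib)
      also have "norm \<dots> \<le> (LINT x|M. C * \<bar>f n x - h x\<bar>)"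
        by (rule Bochner_Integration.integral_norm_bound_integral)
           (use i[OF d] d C in \<open>auto simp: Lp_integrable abs_mult mult.commute mult_right_mono\<close>)
      finally show "norm ((LINT x|M. f n x * ?\<psi> x) - (LINT x|M. h x * ?\<psi> x)) \<le> C * (LINT x|M. \<bar>f n x - h x\<bar>)"
        by simp
    qed
    show "(\<lambda>n. C * (LINT x|M. \<bar>f n x - h x\<bar>)) \<longlonglongrightarrow> 0"
      using assms by (intro tendsto_mult_right_zero L1_tendsto Lp_diff)
  qed
  then show ?thesis
    unfolding LIM_zero_iff test_functions_integral[OF \<phi> U_sets] .
qed

text \<open>The identity defining a weak derivative passes to the limit on both sides, so weak
  differentiation is a closed operation in L^p.\<close>

lemma is_weak_deriv_limit:
  assumes f: "\<And>n. f n \<in> Lp U p" "h \<in> Lp U p" "(\<lambda>n. Ip (\<lambda>x. f n x - h x)) \<longlonglongrightarrow> 0"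
    and g: "\<And>n. g n \<in> Lp U p" "k \<in> Lp U p" "(\<lambda>n. Ip (\<lambda>x. g n x - k x)) \<longlonglongrightarrow> 0"
    and d: "\<And>n. is_weak_deriv U \<alpha> (f n) (g n)"
  shows "is_weak_deriv U \<alpha> h k"
  unfolding is_weak_deriv_iff[OF open_U]
proof (intro conjI ballI allI impI)
  fix \<phi> "is" assume \<phi>: "\<phi> \<in> test_functions U" and "is": "mset is = \<alpha>"
  have "(\<lambda>n. (-1) ^ size \<alpha> * (LINT x|lebesgue. g n x * \<phi> x)) \<longlonglongrightarrow>
      (-1) ^ size \<alpha> * (LINT x|lebesgue. k x * \<phi> x)"
    using Lp_test_integral_tendsto[OF g \<phi>, of "[]"] by (intro tendsto_mult_left) simp
  moreover have "(\<lambda>n. (-1) ^ size \<alpha> * (LINT x|lebesgue. g n x * \<phi> x)) =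
      (\<lambda>n. LINT x|lebesgue. f n x * partial_derivs is \<phi> x)"
    using d \<phi> "is" unfolding is_weak_deriv_iff[OF open_U] by auto
  ultimately show "(LINT x|lebesgue. h x * partial_derivs is \<phi> x) = (-1) ^ size \<alpha> * (LINT x|lebesgue. k x * \<phi> x)"
    using LIMSEQ_unique[OF Lp_test_integral_tendsto[OF f \<phi>, of "is"]] by simp
qed (use f g in \<open>auto intro: Lp_loc\<close>)

end

section \<open>Integration along lines\<close>

lemma nn_integral_lborel_shift:
  fixes f :: "'a::euclidean_space \<Rightarrow> ennreal"
  assumes [measurable]: "f \<in> borel_measurable borel"
  shows "(\<integral>\<^sup>+x. f (x + h) \<partial>lborel) = (\<integral>\<^sup>+x. f x \<partial>lborel)"
proof -
  have "(\<integral>\<^sup>+x. f x \<partial>lborel) = (\<integral>\<^sup>+x. f x \<partial>distr lborel borel ((+) h))"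
    by (simp add: lborel_distr_plus)
  also have "\<dots> = (\<integral>\<^sup>+x. f (x + h) \<partial>lborel)"
    by (subst nn_integral_distr) (auto simp: add.commute)
  finally show ?thesis ..
qed

lemma integral_lborel_shift:
  fixes f :: "'a::euclidean_space \<Rightarrow> real"
  assumes [measurable]: "f \<in> borel_measurable borel"
  shows "(LINT x|lborel. f (x + h)) = (LINT x|lborel. f x)"
proof -
  have "(LINT x|lborel. f x) = (LINT x|distr lborel borel ((+) h). f x)"
    by (simp add: lborel_distr_plus)
  also have "\<dots> = (LINT x|lborel. f (x + h))"
    by (subst integral_distr) (auto simp: add.commute)
  finally show ?thesis ..
qed

text \<open>After Tonelli, translation invariance makes the integral over x independent of t. This
  is how estimates along single lines become estimates on the whole space.\<close>

lemma nn_integral_lines: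
  fixes f :: "'a::euclidean_space \<Rightarrow> ennreal"
  assumes [measurable]: "f \<in> borel_measurable borel" and "a \<le> b"
  shows "(\<integral>\<^sup>+x. \<integral>\<^sup>+t. indicator {a..b} t * f (x + (c * t) *\<^sub>R e) \<partial>lborel \<partial>lborel) =
    ennreal (b - a) * (\<integral>\<^sup>+x. f x \<partial>lborel)"
proof -
  have "(\<integral>\<^sup>+x. \<integral>\<^sup>+t. indicator {a..b} t * f (x + (c * t) *\<^sub>R e) \<partial>lborel \<partial>lborel) =
    (\<integral>\<^sup>+t. \<integral>\<^sup>+x. indicator {a..b} t * f (x + (c * t) *\<^sub>R e) \<partial>lborel \<partial>lborel)"
    by (rule lborel_pair.Fubini'[symmetric]) measurable
  also have "\<dots> = (\<integral>\<^sup>+t. indicator {a..b} t * (\<integral>\<^sup>+x. f x \<partial>lborel) \<partial>lborel)"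
    by (simp add: nn_integral_cmult nn_integral_lborel_shift)
  also have "\<dots> = ennreal (b - a) * (\<integral>\<^sup>+x. f x \<partial>lborel)"
    using assms(2) by (simp add: nn_integral_multc)
  finally show ?thesis .
qed

text \<open>Supplies the hypothesis of Fubini's theorem, and also the integrability along the line
  through almost every point.\<close>

lemma integrable_lines:
  fixes f :: "'a::euclidean_space \<Rightarrow> real"
  assumes f: "integrable lborel f" and "a \<le> b"
  shows "integrable (lborel \<Otimes>\<^sub>M lborel) (\<lambda>(x, t). indicator {a..b} t * f (x + (c * t) *\<^sub>R e))"
proof (rule integrableI_bounded)
  have [measurable]: "f \<in> borel_measurable borel" using f by auto
  show "(\<lambda>(x, t). indicator {a..b} t * f (x + (c * t) *\<^sub>R e)) \<in> borel_measurable (lborel \<Otimes>\<^sub>M lborel)"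
    by measurable
  have "(\<integral>\<^sup>+z. ennreal (norm (case z of (x, t) \<Rightarrow> indicator {a..b} t * f (x + (c * t) *\<^sub>R e)))
      \<partial>(lborel \<Otimes>\<^sub>M lborel)) =
    (\<integral>\<^sup>+x. \<integral>\<^sup>+t. indicator {a..b} t * ennreal \<bar>f (x + (c * t) *\<^sub>R e)\<bar> \<partial>lborel \<partial>lborel)"
    by (subst lborel.nn_integral_fst[symmetric])
       (auto intro!: nn_integral_cong simp: indicator_def)
  also have "\<dots> = ennreal (b - a) * (\<integral>\<^sup>+x. ennreal \<bar>f x\<bar> \<partial>lborel)"
    using nn_integral_lines[of "\<lambda>x. ennreal \<bar>f x\<bar>" a b c e] assms(2) by simp
  also have "\<dots> < \<infinity>"
    using f unfolding integrable_iff_bounded by (simp add: ennreal_mult_less_top)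
  finally show "(\<integral>\<^sup>+z. ennreal (norm (case z of (x, t) \<Rightarrow> indicator {a..b} t * f (x + (c * t) *\<^sub>R e)))
      \<partial>(lborel \<Otimes>\<^sub>M lborel)) < \<infinity>" .
qed

lemma smooth_line_derivative:
  assumes "smooth \<phi>"
  shows "((\<lambda>t. \<phi> (x + (c * t) *\<^sub>R axis i 1)) has_real_derivative
    c * partial_deriv i \<phi> (x + (c * t) *\<^sub>R axis i 1)) (at t)"
proof -
  let ?D = "frechet_derivative \<phi> (at (x + (c * t) *\<^sub>R axis i 1))"
  have D: "(\<phi> has_derivative ?D) (at (x + (c * t) *\<^sub>R axis i 1))"
    using smooth_differentiable[OF assms] by (simp add: frechet_derivative_works)
  have "((\<lambda>t. x + (c * t) *\<^sub>R axis i 1) has_derivative (\<lambda>h. (c * h) *\<^sub>R axis i 1)) (at t)"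
    by (auto intro!: derivative_eq_intros)
  from has_derivative_compose[OF this D]
  have "((\<lambda>t. \<phi> (x + (c * t) *\<^sub>R axis i 1)) has_derivative (\<lambda>h. ?D ((c * h) *\<^sub>R axis i 1))) (at t)" .
  moreover have "(\<lambda>h. ?D ((c * h) *\<^sub>R axis i 1)) = (*) (c * partial_deriv i \<phi> (x + (c * t) *\<^sub>R axis i 1))"
    using has_derivative_linear[OF D] by (simp add: partial_deriv_def linear_scale fun_eq_iff mult_ac)
  ultimately show ?thesis by (simp add: has_field_derivative_def)
qed

text \<open>The factor \<open>c\<close> admits scaled and reversed parametrizations; a negative one
  occurs when a difference quotient is moved onto a test function.\<close>

lemma smooth_line_FTC:
  assumes \<phi>: "smooth \<phi>" and "a \<le> b"
  shows "has_bochner_integral lborel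
    (\<lambda>t. indicator {a..b} t * (c * partial_deriv i \<phi> (x + (c * t) *\<^sub>R axis i 1)))
    (\<phi> (x + (c * b) *\<^sub>R axis i 1) - \<phi> (x + (c * a) *\<^sub>R axis i 1))"
proof -
  have "isCont (\<lambda>t. c * partial_deriv i \<phi> (x + (c * t) *\<^sub>R axis i 1)) t" for t
  proof -
    have "continuous_on UNIV (\<lambda>t. c * partial_deriv i \<phi> (x + (c * t) *\<^sub>R axis i 1))"
      by (intro continuous_intros continuous_on_compose2[OF smooth_continuous_on[OF smooth_partial_deriv[OF \<phi>], of UNIV]]) auto
    then show ?thesis by (simp add: continuous_on_eq_continuous_at)
  qed
  from has_bochner_integral_FTC_Icc_real[OF assms(2) smooth_line_derivative[OF \<phi>] this]
  show ?thesis by (simp add: mult.commute)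
qed

lemma test_functions_borel:
  fixes \<phi> :: "real ^ 'n \<Rightarrow> real"
  assumes "\<phi> \<in> test_functions U"
  shows "partial_derivs is \<phi> \<in> borel_measurable borel"
  using smooth_continuous_on[OF smooth_partial_derivs[OF test_functions_smooth[OF assms]]]
  by (rule borel_measurable_continuous_onI)

lemma test_functions_integrable_lborel:
  fixes \<phi> :: "real ^ 'n \<Rightarrow> real"
  assumes \<phi>: "\<phi> \<in> test_functions U"
  shows "integrable lborel \<phi>"
proof -
  have l: "(\<lambda>_::real^'n. 1) locally_integrable_on U"
    by (auto simp: locally_integrable_on_def set_integrable_def fmeasurable_def integrable_indicator_iff
        dest!: lmeasurable_compact)
  have "\<phi> \<in> borel_measurable lborel" using test_functions_borel[OF \<phi>, of "[]"] by simp
  with test_functions_integrable[OF l \<phi>] show ?thesis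
    by (simp add: integrable_completion)
qed

text \<open>Averaging over the translates in direction \<open>i\<close> turns the integral of \<open>\<partial>\<^sub>i\<phi>\<close> into the integral of
  a difference of two translates of \<open>\<phi>\<close>.\<close>

lemma integral_partial_deriv_zero:
  fixes \<phi> :: "real ^ 'n \<Rightarrow> real"
  assumes \<phi>: "\<phi> \<in> test_functions U"
  shows "(LINT x|lborel. partial_deriv i \<phi> x) = 0"
proof -
  have [measurable]: "\<phi> \<in> borel_measurable borel" "partial_deriv i \<phi> \<in> borel_measurable borel"
    using test_functions_borel[OF \<phi>, of "[]"] test_functions_borel[OF \<phi>, of "[i]"] by auto
  have i: "integrable lborel \<phi>" "integrable lborel (partial_deriv i \<phi>)"
    using test_functions_integrable_lborel[OF \<phi>]
      test_functions_integrable_lborel[OF test_functions_partial_derivs[OF \<phi>, of "[i]"]] by auto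
  have i': "integrable lborel (\<lambda>x. \<phi> (x + h))" for h
    by (rule integrableI_bounded)
       (use i(1) nn_integral_lborel_shift[of "\<lambda>x. ennreal (norm (\<phi> x))" h] in \<open>auto simp: integrable_iff_bounded\<close>)
  have "0 = (LINT x|lborel. \<phi> (x + (1 * 1) *\<^sub>R axis i 1) - \<phi> (x + (1 * 0) *\<^sub>R axis i 1))"
    using i(1) i' by (simp add: integral_lborel_shift)
  also have "\<dots> = (LINT x|lborel. LINT t|lborel. indicator {0..1} t * partial_deriv i \<phi> (x + (1 * t) *\<^sub>R axis i 1))"
    using smooth_line_FTC[OF test_functions_smooth[OF \<phi>], of 0 1 1 i, THEN has_bochner_integral_integral_eq]
    by (intro Bochner_Integration.integral_cong refl) simp
  also have "\<dots> = (LINT t|lborel. LINT x|lborel. indicator {0..1} t * partial_deriv i \<phi> (x + (1 * t) *\<^sub>R axis i 1))"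
    using integrable_lines[OF i(2), of 0 1 1 "axis i 1"]
    by (intro lborel_pair.Fubini_integral[symmetric]) simp
  also have "\<dots> = (LINT t|lborel. indicator {0..1::real} t * (LINT x|lborel. partial_deriv i \<phi> x))"
    by (simp add: integral_lborel_shift)
  also have "\<dots> = (LINT x|lborel. partial_deriv i \<phi> x)"
    by simp
  finally show ?thesis ..
qed

text \<open>Integration by parts: the product of two smooth functions, one of them a test function,
  is a test function, and its derivative integrates to 0.\<close>

lemma is_weak_deriv_test_function:
  fixes \<phi> :: "real ^ 'n \<Rightarrow> real"
  assumes U: "open U" and \<phi>: "\<phi> \<in> test_functions U"
  shows "is_weak_deriv U {#i#} \<phi> (partial_deriv i \<phi>)"
proof -
  have d: "\<psi> locally_integrable_on U" if "\<psi> \<in> test_functions U" for \<psi>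
  proof -
    have "integrable lebesgue \<psi>"
      using test_functions_integrable_lborel[OF that] integrable_completion[of \<psi> lborel] by auto
    then show ?thesis unfolding locally_integrable_on_def set_integrable_def
      by (intro allI impI integrable_mult_indicator) (auto dest: compact_imp_closed)
  qed
  have \<phi>i: "partial_deriv i \<phi> \<in> test_functions U"
    using test_functions_partial_derivs[OF \<phi>, of "[i]"] by simp
  show ?thesis
    unfolding is_weak_deriv_iff[OF U]
  proof (intro conjI ballI allI impI d \<phi> \<phi>i)
    fix \<psi> "is" assume \<psi>: "\<psi> \<in> test_functions U" and "mset is = {#i#}"
    then have [simp]: "is = [i]" by simp
    have sm: "smooth \<phi>" "smooth \<psi>" using \<phi> \<psi> by (auto intro: test_functions_smooth)
    have t: "(\<lambda>x. \<phi> x * \<psi> x) \<in> test_functions U" "(\<lambda>x. \<phi> x * partial_deriv i \<psi> x) \<in> test_functions U"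
      "(\<lambda>x. partial_deriv i \<phi> x * \<psi> x) \<in> test_functions U"
      using \<phi> \<phi>i sm by (auto intro!: test_functions_mult smooth_partial_deriv)
    have "partial_deriv i (\<lambda>x. \<phi> x * \<psi> x) = (\<lambda>x. \<phi> x * partial_deriv i \<psi> x + partial_deriv i \<phi> x * \<psi> x)"
      using sm by (auto simp: partial_deriv_mult smooth_differentiable)
    then have "(LINT x|lborel. \<phi> x * partial_deriv i \<psi> x + partial_deriv i \<phi> x * \<psi> x) = 0"
      using integral_partial_deriv_zero[OF t(1), of i] by simp
    then have "(LINT x|lborel. \<phi> x * partial_deriv i \<psi> x) = - (LINT x|lborel. partial_deriv i \<phi> x * \<psi> x)"
      using t(2,3)[THEN test_functions_integrable_lborel] by simp
    then show "(LINT x|lebesgue. \<phi> x * partial_derivs is \<psi> x) =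
        (-1) ^ size {#i#} * (LINT x|lebesgue. partial_deriv i \<phi> x * \<psi> x)"
      using t(2,3)[THEN test_functions_integrable_lborel] by (simp add: integral_completion)
  qed
qed

text \<open>A crude form of Jensen's inequality: the factor \<open>5\<close> instead of \<open>4\<close> avoids Hoelder's inequality.\<close>

lemma powr_le_nn_integral:
  fixes h :: "real \<Rightarrow> real"
  assumes [measurable]: "h \<in> borel_measurable borel" and p: "p \<ge> 1" and a: "a \<ge> 0"
    and le: "ennreal a \<le> (\<integral>\<^sup>+t. indicator {-2..2} t * ennreal \<bar>h t\<bar> \<partial>lborel)"
  shows "ennreal (a powr p) \<le> ennreal (5 powr p) * (\<integral>\<^sup>+t. indicator {-2..2} t * ennreal (\<bar>h t\<bar> powr p) \<partial>lborel)"
proof (cases "a = 0 \<or> (\<integral>\<^sup>+t. indicator {-2..2} t * ennreal (\<bar>h t\<bar> powr p) \<partial>lborel) = \<infinity>")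
  case True
  then show ?thesis by (auto simp: ennreal_mult_top)
next
  case False
  then obtain j where j: "j \<ge> 0" "(\<integral>\<^sup>+t. indicator {-2..2} t * ennreal (\<bar>h t\<bar> powr p) \<partial>lborel) = ennreal j"
    by (cases "\<integral>\<^sup>+t. indicator {-2..2} t * ennreal (\<bar>h t\<bar> powr p) \<partial>lborel") auto
  \<comment> \<open>With this threshold the interval of length 4 contributes 4 * s, so one copy of
    \<open>s\<close> remains on the left and yields s^p \<le> j.\<close>
  define s where "s = a / 5"
  have s: "s > 0" using False a by (simp add: s_def)
  have "ennreal a \<le> (\<integral>\<^sup>+t. indicator {-2..2} t * ennreal (s + s powr (1 - p) * \<bar>h t\<bar> powr p) \<partial>lborel)"
    using abs_le_delta_powr[OF p s]
    by (intro order.trans[OF le] nn_integral_mono mult_left_mono ennreal_leI) auto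
  also have "\<dots> = (\<integral>\<^sup>+t. ennreal s * indicator {-2..2} t +
      ennreal (s powr (1 - p)) * (indicator {-2..2} t * ennreal (\<bar>h t\<bar> powr p)) \<partial>lborel)"
    using s by (intro nn_integral_cong) (auto simp: ennreal_plus ennreal_mult indicator_def)
  also have "\<dots> = ennreal s * ennreal 4 + ennreal (s powr (1 - p)) * ennreal j"
    unfolding j(2)[symmetric] by (subst nn_integral_add; simp add: nn_integral_cmult)
  also have "\<dots> = ennreal (4 * s + s powr (1 - p) * j)"
    using s j(1) by (simp add: ennreal_plus ennreal_mult mult.commute)
  finally have "a \<le> 4 * s + s powr (1 - p) * j"
    using s j(1) by (subst (asm) ennreal_le_iff) (auto intro!: add_nonneg_nonneg)
  then have "s \<le> s powr (1 - p) * j" by (simp add: s_def)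
  then have "s powr (p - 1) * s \<le> s powr (p - 1) * (s powr (1 - p) * j)"
    by (intro mult_left_mono) auto
  also have "\<dots> = j" using s by (simp add: powr_add[symmetric] flip: mult.assoc)
  also have "s powr (p - 1) * s = s powr p" using s by (simp add: powr_diff)
  finally have "a powr p \<le> 5 powr p * j"
    using a by (simp add: s_def powr_divide field_simps)
  then show ?thesis unfolding j(2) using j(1) by (simp flip: ennreal_mult add: ennreal_leI)
qed

section \<open>Poincare inequalities\<close>

context sobolev_domain
begin

lemma Lp_test_function:
  assumes \<phi>: "\<phi> \<in> test_functions U" shows "\<phi> \<in> Lp U p"
proof -
  interpret finite_measure M by (rule finite_measure_M)
  obtain C where C: "\<And>x. \<bar>\<phi> x\<bar> \<le> C" using test_functions_bounded[OF \<phi>, of "[]"] by auto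
  have "\<phi> \<in> borel_measurable lebesgue"
    using test_functions_borel[OF \<phi>, of "[]"] by (intro measurable_completion) simp
  then have m: "\<phi> \<in> borel_measurable M" by (rule measurable_restrict_space1)
  have "integrable M (\<lambda>x. \<bar>\<phi> x\<bar> powr p)"
  proof (rule integrable_const_bound)
    show "AE x in M. norm (\<bar>\<phi> x\<bar> powr p) \<le> C powr p"
      using C p_gt_1 by (auto intro!: powr_mono2)
  qed (use m in measurable)
  then show ?thesis using m by (simp add: Lp_def)
qed

text \<open>Composition with (x, t) \<mapsto> x + t e preserves Borel measurability but is awkward
  for the completed measure, and the zero extension gives a meaning to points of a line outside
  \<open>U\<close>. Hence all work on lines is done with such versions.\<close>

definition is_borel_version :: "(real ^ 'n \<Rightarrow> real) \<Rightarrow> (real ^ 'n \<Rightarrow> real) \<Rightarrow> bool" where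
  "is_borel_version f g \<longleftrightarrow> g \<in> borel_measurable borel \<and> (\<forall>x. x \<notin> U \<longrightarrow> g x = 0) \<and>
     (AE x in lebesgue. x \<in> U \<longrightarrow> f x = g x)"

lemma borel_version_exists:
  assumes f: "f \<in> borel_measurable M"
  obtains g where "is_borel_version f g"
proof -
  have "(\<lambda>x. indicator U x * f x) \<in> borel_measurable lebesgue"
    using f U_sets by (subst (asm) borel_measurable_restrict_space_iff) auto
  then obtain h where [measurable]: "h \<in> borel_measurable lborel"
    and ae: "AE x in lborel. indicator U x * f x = h x"
    using completion_ex_borel_measurable_real by blast
  have [measurable]: "U \<in> sets borel" by (rule U_sets_borel)
  have "is_borel_version f (\<lambda>x. indicator U x * h x)"
    unfolding is_borel_version_def
  proof (intro conjI)
    show "(\<lambda>x. indicator U x * h x) \<in> borel_measurable borel" by measurable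
    show "AE x in lebesgue. x \<in> U \<longrightarrow> f x = indicator U x * h x"
      using AE_completion[OF ae] by eventually_elim auto
  qed auto
  then show thesis by (rule that)
qed

lemma borel_version_Ip:
  assumes f: "f \<in> Lp U p" and g: "is_borel_version f g"
  shows "ennreal (Ip f) = (\<integral>\<^sup>+x. ennreal (\<bar>g x\<bar> powr p) \<partial>lborel)"
proof -
  have [measurable]: "U \<in> sets borel" "g \<in> borel_measurable borel"
    using g by (auto simp: U_sets_borel is_borel_version_def)
  have "ennreal (Ip f) = (\<integral>\<^sup>+x. ennreal (\<bar>f x\<bar> powr p) \<partial>M)"
    unfolding Ip_def using f by (intro nn_integral_eq_integral[symmetric] Lp_integrable_powr) auto
  also have "\<dots> = (\<integral>\<^sup>+x. ennreal (\<bar>f x\<bar> powr p) * indicator U x \<partial>lebesgue)"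
    using U_sets by (subst nn_integral_restrict_space) auto
  also have "\<dots> = (\<integral>\<^sup>+x. ennreal (\<bar>g x\<bar> powr p) \<partial>lebesgue)"
    using g by (intro nn_integral_cong_AE) (auto simp: is_borel_version_def indicator_def)
  finally show ?thesis by (simp add: nn_integral_completion)
qed

lemma borel_version_integrable:
  assumes f: "integrable M f" and g: "is_borel_version f g"
  shows "integrable lborel g" and "(\<integral>\<^sup>+x. ennreal \<bar>g x\<bar> \<partial>lborel) = ennreal (LINT x|M. \<bar>f x\<bar>)"
proof -
  have [measurable]: "U \<in> sets borel" "g \<in> borel_measurable borel"
    using g by (auto simp: U_sets_borel is_borel_version_def)
  have "ennreal (LINT x|M. \<bar>f x\<bar>) = (\<integral>\<^sup>+x. ennreal \<bar>f x\<bar> \<partial>M)"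
    using f by (intro nn_integral_eq_integral[symmetric]) auto
  also have "\<dots> = (\<integral>\<^sup>+x. ennreal \<bar>f x\<bar> * indicator U x \<partial>lebesgue)"
    using U_sets by (subst nn_integral_restrict_space) auto
  also have "\<dots> = (\<integral>\<^sup>+x. ennreal \<bar>g x\<bar> \<partial>lebesgue)"
    using g by (intro nn_integral_cong_AE) (auto simp: is_borel_version_def indicator_def)
  finally show *: "(\<integral>\<^sup>+x. ennreal \<bar>g x\<bar> \<partial>lborel) = ennreal (LINT x|M. \<bar>f x\<bar>)"
    by (simp add: nn_integral_completion)
  show "integrable lborel g"
    by (rule integrableI_bounded) (auto simp: *)
qed

lemma borel_version_test_integral:
  assumes g: "is_borel_version f g" and \<phi>: "\<phi> \<in> test_functions U" and f: "f locally_integrable_on U"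
  shows "(LINT x|lebesgue. f x * partial_derivs is \<phi> x) = (LINT x|lborel. g x * partial_derivs is \<phi> x)"
proof -
  have [measurable]: "g \<in> borel_measurable borel" "partial_derivs is \<phi> \<in> borel_measurable borel"
    using g test_functions_borel[OF \<phi>] by (auto simp: is_borel_version_def)
  have "(LINT x|lebesgue. f x * partial_derivs is \<phi> x) = (LINT x|lebesgue. g x * partial_derivs is \<phi> x)"
  proof (rule integral_cong_AE)
    show "(\<lambda>x. f x * partial_derivs is \<phi> x) \<in> borel_measurable lebesgue"
      by (rule borel_measurable_integrable[OF test_functions_integrable[OF f test_functions_partial_derivs[OF \<phi>]]])
    show "(\<lambda>x. g x * partial_derivs is \<phi> x) \<in> borel_measurable lebesgue"
      by (rule measurable_completion) measurable
    have "AE x in lebesgue. x \<in> U \<longrightarrow> f x = g x" using g by (simp add: is_borel_version_def)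
    then show "AE x in lebesgue. f x * partial_derivs is \<phi> x = g x * partial_derivs is \<phi> x"
      by eventually_elim (use test_functions_support[OF \<phi>] in \<open>metis mult_zero_right\<close>)
  qed
  then show ?thesis by (simp add: integral_completion)
qed

text \<open>The pointwise bound is raised to the power p by \<open>powr_le_nn_integral\<close> and
  integrated by \<open>nn_integral_lines\<close>; the factor 4 is the length of the parameter
  interval.\<close>

lemma Ip_le_line_integral:
  assumes f: "f \<in> Lp U p" "is_borel_version f F" and z: "z \<in> Lp U p" "is_borel_version z Z"
    and le: "AE x in lborel. x \<in> U \<longrightarrow>
      ennreal \<bar>F x\<bar> \<le> (\<integral>\<^sup>+t. indicator {-2..2} t * ennreal \<bar>Z (x + t *\<^sub>R e)\<bar> \<partial>lborel)"
  shows "Ip f \<le> 4 * 5 powr p * Ip z"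
proof -
  have [measurable]: "F \<in> borel_measurable borel" "Z \<in> borel_measurable borel"
    using f z by (auto simp: is_borel_version_def)
  have "ennreal (Ip f) = (\<integral>\<^sup>+x. ennreal (\<bar>F x\<bar> powr p) \<partial>lborel)"
    by (rule borel_version_Ip[OF f])
  also have "\<dots> \<le> (\<integral>\<^sup>+x. ennreal (5 powr p) *
      (\<integral>\<^sup>+t. indicator {-2..2} t * ennreal (\<bar>Z (x + (1 * t) *\<^sub>R e)\<bar> powr p) \<partial>lborel) \<partial>lborel)"
  proof (rule nn_integral_mono_AE, use le in eventually_elim)
    case (elim x)
    show ?case
    proof (cases "x \<in> U")
      case True
      then show ?thesis
        using elim p_gt_1 powr_le_nn_integral[of "\<lambda>t. Z (x + t *\<^sub>R e)" p "\<bar>F x\<bar>"] by simp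
    next
      case False
      then have "F x = 0" using f by (auto simp: is_borel_version_def)
      then show ?thesis by simp
    qed
  qed
  also have "\<dots> = ennreal (5 powr p) * (ennreal (2 - (- 2)) * (\<integral>\<^sup>+x. ennreal (\<bar>Z x\<bar> powr p) \<partial>lborel))"
    by (subst nn_integral_cmult, measurable, subst nn_integral_lines) auto
  also have "\<dots> = ennreal (5 powr p) * (ennreal 4 * ennreal (Ip z))"
    by (simp add: borel_version_Ip[OF z])
  also have "\<dots> = ennreal (4 * 5 powr p * Ip z)"
    using Ip_nonneg[of z] by (simp add: ennreal_mult mult_ac)
  finally show ?thesis
    using Ip_nonneg[of z] by simp
qed

end

lemma smooth_line_FTC_test:
  fixes \<phi> :: "real ^ 'n \<Rightarrow> real"
  assumes "\<phi> \<in> test_functions U" and "a \<le> b"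
  shows "(LINT t|lborel. indicator {a..b} t * partial_deriv i \<phi> (x + t *\<^sub>R axis i 1)) =
      \<phi> (x + b *\<^sub>R axis i 1) - \<phi> (x + a *\<^sub>R axis i 1)"
    and "integrable lborel (\<lambda>t. indicator {a..b} t * partial_deriv i \<phi> (x + t *\<^sub>R axis i 1))"
  using smooth_line_FTC[OF test_functions_smooth[OF assms(1)] assms(2), of 1 i x]
  by (auto simp: has_bochner_integral_iff)

locale convex_sobolev_domain = sobolev_domain U p
  for U :: "(real ^ 'n) set" and p :: real +
  assumes convex_U: "convex U" and U_ball: "U \<subseteq> ball 0 1"
begin

text \<open>Points of the open unit ball are less than 2 apart. This is the origin of the parameter
  interval {-2..2}: it contains the part in \<open>U\<close> of each line through a point of
  \<open>U\<close>.\<close>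

lemma shift_notin:
  assumes "x \<in> U" "\<bar>c\<bar> \<ge> 2" shows "x + c *\<^sub>R axis i 1 \<notin> U"
proof
  assume "x + c *\<^sub>R axis i 1 \<in> U"
  then have "norm (x + c *\<^sub>R axis i 1) < 1" "norm x < 1" using U_ball assms(1) by auto
  then have "norm ((x + c *\<^sub>R axis i 1) - x) < 2" using norm_triangle_ineq4[of "x + c *\<^sub>R axis i 1" x] by linarith
  then show False using assms(2) by (simp add: norm_axis_1)
qed

text \<open>The function vanishes at x - 2 e, so its value at x is the integral of the directional
  derivative from there.\<close>

lemma poincare_test:
  assumes \<phi>: "\<phi> \<in> test_functions U"
  shows "Ip \<phi> \<le> 4 * 5 powr p * Ip (partial_deriv i \<phi>)"
proof -
  have \<phi>': "partial_deriv i \<phi> \<in> test_functions U" using test_functions_partial_derivs[OF \<phi>, of "[i]"] by simp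
  have v: "is_borel_version \<psi> \<psi>" if "\<psi> \<in> test_functions U" for \<psi>
    using test_functions_borel[OF that, of "[]"] test_functions_support[OF that, of _ "[]"]
    by (auto simp: is_borel_version_def)
  show ?thesis
  proof (rule Ip_le_line_integral[OF Lp_test_function[OF \<phi>] v[OF \<phi>] Lp_test_function[OF \<phi>'] v[OF \<phi>'], of "axis i 1"])
    show "AE x in lborel. x \<in> U \<longrightarrow> ennreal \<bar>\<phi> x\<bar> \<le>
      (\<integral>\<^sup>+t. indicator {-2..2} t * ennreal \<bar>partial_deriv i \<phi> (x + t *\<^sub>R axis i 1)\<bar> \<partial>lborel)"
    proof (intro AE_I2 impI)
      fix x assume x: "x \<in> U"
      have "\<phi> (x + (-2) *\<^sub>R axis i 1) = 0"
        using test_functions_support[OF \<phi> shift_notin[OF x, of "-2" i], of "[]"] by simp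
      then have eq: "\<phi> x = (LINT t|lborel. indicator {-2..0} t * partial_deriv i \<phi> (x + t *\<^sub>R axis i 1))"
        using smooth_line_FTC_test(1)[OF \<phi>, of "-2" 0 i x] by simp
      have "ennreal \<bar>\<phi> x\<bar> \<le> (\<integral>\<^sup>+t. ennreal \<bar>indicator {-2..0} t * partial_deriv i \<phi> (x + t *\<^sub>R axis i 1)\<bar> \<partial>lborel)"
        using integral_norm_bound_ennreal[OF smooth_line_FTC_test(2)[OF \<phi>, of "-2" 0 i x]] unfolding eq[symmetric] by simp
      also have "\<dots> \<le> (\<integral>\<^sup>+t. indicator {-2..2} t * ennreal \<bar>partial_deriv i \<phi> (x + t *\<^sub>R axis i 1)\<bar> \<partial>lborel)"
        by (intro nn_integral_mono) (auto simp: indicator_def)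
      finally show "ennreal \<bar>\<phi> x\<bar> \<le>
        (\<integral>\<^sup>+t. indicator {-2..2} t * ennreal \<bar>partial_deriv i \<phi> (x + t *\<^sub>R axis i 1)\<bar> \<partial>lborel)" .
    qed
  qed
qed

text \<open>Passage to the limit in the inequality for test functions. The weak triangle inequality
  is used once for \<open>v\<close> and once for \<open>w\<close>, hence the two factors
  2^p.\<close>

lemma poincare:
  assumes v: "v \<in> Lp U p" "w \<in> Lp U p"
    and \<phi>: "\<And>k. \<phi> k \<in> test_functions U" "(\<lambda>k. Ip (\<lambda>x. v x - \<phi> k x)) \<longlonglongrightarrow> 0"
      "(\<lambda>k. Ip (\<lambda>x. w x - partial_deriv i (\<phi> k) x)) \<longlonglongrightarrow> 0"
  shows "Ip v \<le> 2 powr p * (4 * 5 powr p * (2 powr p * Ip w))"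
proof (rule LIMSEQ_le_const)
  have \<phi>': "partial_deriv i (\<phi> k) \<in> test_functions U" for k using test_functions_partial_derivs[OF \<phi>(1), of "[i]"] by simp
  let ?b = "\<lambda>k. 2 powr p * (Ip (\<lambda>x. v x - \<phi> k x) + 4 * 5 powr p * (2 powr p * (Ip w + Ip (\<lambda>x. w x - partial_deriv i (\<phi> k) x))))"
  have "?b \<longlonglongrightarrow> 2 powr p * (0 + 4 * 5 powr p * (2 powr p * (Ip w + 0)))"
    by (intro tendsto_intros \<phi>)
  then show "?b \<longlonglongrightarrow> 2 powr p * (4 * 5 powr p * (2 powr p * Ip w))" by simp
  have "Ip v \<le> ?b k" for k
  proof -
    have "Ip (\<lambda>x. (v x - \<phi> k x) + \<phi> k x) \<le> 2 powr p * (Ip (\<lambda>x. v x - \<phi> k x) + Ip (\<phi> k))"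
      by (intro Ip_add_le Lp_diff v Lp_test_function \<phi>)
    moreover have "Ip (\<phi> k) \<le> 4 * 5 powr p * Ip (partial_deriv i (\<phi> k))" by (intro poincare_test \<phi>)
    moreover have "Ip (\<lambda>x. w x - (w x - partial_deriv i (\<phi> k) x)) \<le>
        2 powr p * (Ip w + Ip (\<lambda>x. w x - partial_deriv i (\<phi> k) x))"
      by (intro Ip_diff_le Lp_diff v Lp_test_function \<phi>')
    ultimately have "Ip v \<le> 2 powr p * (Ip (\<lambda>x. v x - \<phi> k x) + Ip (\<phi> k))"
      "Ip (\<phi> k) \<le> 4 * 5 powr p * (2 powr p * (Ip w + Ip (\<lambda>x. w x - partial_deriv i (\<phi> k) x)))"
      by (auto intro: order.trans)
    then show ?thesis by (smt (verit) mult_left_mono powr_ge_zero)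
  qed
  then show "\<exists>N. \<forall>n\<ge>N. Ip v \<le> ?b n" by blast
qed

text \<open>Since \<open>v\<close> vanishes on the boundary, its derivative \<open>w\<close> in direction \<open>i\<close> has mean zero on almost
  every line in that direction.\<close>

lemma line_integral_zero:
  assumes w: "w \<in> Lp U p" "is_borel_version w W"
    and \<phi>: "\<And>k. \<phi> k \<in> test_functions U" "(\<lambda>k. Ip (\<lambda>x. w x - partial_deriv i (\<phi> k) x)) \<longlonglongrightarrow> 0"
  shows "AE x in lborel. x \<in> U \<longrightarrow> (LINT t|lborel. indicator {-2..2} t * W (x + t *\<^sub>R axis i 1)) = 0"
proof -
  have [measurable]: "W \<in> borel_measurable borel" "U \<in> sets borel"
    using w by (auto simp: is_borel_version_def U_sets_borel)
  define \<psi> where "\<psi> k = partial_deriv i (\<phi> k)" for k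
  have \<psi>: "\<psi> k \<in> test_functions U" for k
    using test_functions_partial_derivs[OF \<phi>(1), of "[i]"] by (simp add: \<psi>_def)
  have [measurable]: "\<psi> k \<in> borel_measurable borel" for k
    using test_functions_borel[OF \<psi>, of "[]"] by simp
  have Wi: "integrable lborel W" by (rule borel_version_integrable(1)[OF Lp_integrable w(2)]) fact
  \<comment> \<open>The integral of \<open>A\<close> is bounded by a null sequence in
    \<open>k\<close>, so \<open>A\<close> vanishes almost everywhere.\<close>
  define A where "A x = indicator U x * ennreal \<bar>LINT t|lborel. indicator {-2..2} t * W (x + t *\<^sub>R axis i 1)\<bar>" for x
  have [measurable]: "A \<in> borel_measurable borel" unfolding A_def by measurable
  have ae: "AE x in lborel. integrable lborel (\<lambda>t. indicator {-2..2} t * W (x + t *\<^sub>R axis i 1))"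
    using lborel_pair.AE_integrable_fst[OF integrable_lines[OF Wi, of "-2" 2 1 "axis i 1"]] by simp
  have le: "(\<integral>\<^sup>+x. A x \<partial>lborel) \<le> 4 * ennreal (LINT x|M. \<bar>w x - \<psi> k x\<bar>)" for k
  proof -
    have "(\<integral>\<^sup>+x. A x \<partial>lborel) \<le> (\<integral>\<^sup>+x. \<integral>\<^sup>+t. indicator {-2..2} t * ennreal \<bar>W (x + (1 * t) *\<^sub>R axis i 1) - \<psi> k (x + (1 * t) *\<^sub>R axis i 1)\<bar> \<partial>lborel \<partial>lborel)"
    proof (rule nn_integral_mono_AE, use ae in eventually_elim)
      case (elim x)
      show ?case
      proof (cases "x \<in> U")
        case True
        \<comment> \<open>Both endpoints of the segment lie outside \<open>U\<close>, where
          \<open>\<phi> k\<close> is zero, so the derivative integrates to 0 over the segment.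
          Subtracting it does not change the line integral of \<open>W\<close>.\<close>
        let ?\<psi> = "\<lambda>t. indicator {-2..2} t * \<psi> k (x + t *\<^sub>R axis i 1)"
        have i: "integrable lborel ?\<psi>"
          using smooth_line_FTC_test(2)[OF \<phi>(1)] by (simp add: \<psi>_def)
        have "integral\<^sup>L lborel ?\<psi> = 0"
          using smooth_line_FTC_test(1)[OF \<phi>(1), of "-2" 2] True
            test_functions_support[OF \<phi>(1) shift_notin[OF True, of "-2" i], of "[]"]
            test_functions_support[OF \<phi>(1) shift_notin[OF True, of "2" i], of "[]"]
          by (simp add: \<psi>_def)
        then have eq: "(LINT t|lborel. indicator {-2..2} t * W (x + t *\<^sub>R axis i 1)) =
          (LINT t|lborel. indicator {-2..2} t * W (x + t *\<^sub>R axis i 1) - ?\<psi> t)"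
          using elim i by simp
        have "ennreal \<bar>LINT t|lborel. indicator {-2..2} t * W (x + t *\<^sub>R axis i 1) - ?\<psi> t\<bar> \<le>
            (\<integral>\<^sup>+t. ennreal \<bar>indicator {-2..2} t * W (x + t *\<^sub>R axis i 1) - ?\<psi> t\<bar> \<partial>lborel)"
          using integral_norm_bound_ennreal[OF Bochner_Integration.integrable_diff[OF elim i]] by simp
        also have "\<dots> = (\<integral>\<^sup>+t. indicator {-2..2} t * ennreal \<bar>W (x + (1 * t) *\<^sub>R axis i 1) - \<psi> k (x + (1 * t) *\<^sub>R axis i 1)\<bar> \<partial>lborel)"
          by (intro nn_integral_cong) (auto simp: indicator_def)
        finally show ?thesis using True unfolding eq[symmetric] by (simp add: A_def)
      qed (simp add: A_def)
    qed
    moreover have "(\<integral>\<^sup>+x. \<integral>\<^sup>+t. indicator {-2..2} t * ennreal \<bar>W (x + (1 * t) *\<^sub>R axis i 1) - \<psi> k (x + (1 * t) *\<^sub>R axis i 1)\<bar> \<partial>lborel \<partial>lborel)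
        = ennreal (2 - (-2)) * (\<integral>\<^sup>+x. ennreal \<bar>W x - \<psi> k x\<bar> \<partial>lborel)"
      by (rule nn_integral_lines) auto
    moreover have "(\<integral>\<^sup>+x. ennreal \<bar>W x - \<psi> k x\<bar> \<partial>lborel) = ennreal (LINT x|M. \<bar>w x - \<psi> k x\<bar>)"
    proof (rule borel_version_integrable(2))
      show "integrable M (\<lambda>x. w x - \<psi> k x)" by (intro Lp_integrable Lp_diff w Lp_test_function \<psi>)
      show "is_borel_version (\<lambda>x. w x - \<psi> k x) (\<lambda>x. W x - \<psi> k x)"
        using w(2) test_functions_support[OF \<psi>, of _ "[]"] by (auto simp: is_borel_version_def)
    qed
    ultimately show ?thesis by simp
  qed
  have "(\<lambda>k. LINT x|M. \<bar>w x - \<psi> k x\<bar>) \<longlonglongrightarrow> 0"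
    using \<phi>(2) by (intro L1_tendsto Lp_diff w Lp_test_function \<psi>) (simp add: \<psi>_def)
  then have "(\<lambda>k. 4 * ennreal (LINT x|M. \<bar>w x - \<psi> k x\<bar>)) \<longlonglongrightarrow> 4 * ennreal 0"
    by (intro ennreal_tendsto_cmult tendsto_ennrealI) auto
  then have "(\<integral>\<^sup>+x. A x \<partial>lborel) \<le> 4 * ennreal 0"
    by (rule LIMSEQ_le_const) (use le in blast)
  then have "AE x in lborel. A x = 0"
    by (subst nn_integral_0_iff_AE[symmetric]) auto
  then show ?thesis
    by eventually_elim (auto simp: A_def)
qed

text \<open>Both sides are tested against functions supported in the open set of those \<open>x\<close> for which the
  segment from \<open>x\<close> to \<open>x + t *\<^sub>R axis i 1\<close> lies in \<open>U\<close>; translates of such functions along the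
  segment are test functions on \<open>U\<close>.\<close>

lemma weak_deriv_increment:
  assumes d: "is_weak_deriv U {#i#} w z"
    and w: "w \<in> Lp U p" "is_borel_version w W" and z: "z \<in> Lp U p" "is_borel_version z Z"
  shows "AE x in lborel. x \<in> U \<and> x + t *\<^sub>R axis i 1 \<in> U \<longrightarrow>
    W (x + t *\<^sub>R axis i 1) - W x = (LINT s|lborel. indicator {0..1} s * (t * Z (x + (t * s) *\<^sub>R axis i 1)))"
proof -
  let ?e = "axis i 1 :: real ^ 'n"
  have [measurable]: "W \<in> borel_measurable borel" "Z \<in> borel_measurable borel"
    using w z by (auto simp: is_borel_version_def)
  have Wi: "integrable lborel W" by (rule borel_version_integrable(1)[OF Lp_integrable w(2)]) fact
  have Zi: "integrable lborel Z" by (rule borel_version_integrable(1)[OF Lp_integrable z(2)]) fact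
  define V where "V = U \<inter> {x. x + t *\<^sub>R ?e \<in> U}"
  have V: "open V"
  proof -
    have "{x. x + t *\<^sub>R ?e \<in> U} = (\<lambda>x. x + t *\<^sub>R ?e) -` U" by auto
    moreover have "open ((\<lambda>x. x + t *\<^sub>R ?e) -` U)"
      by (intro open_vimage open_U continuous_intros)
    ultimately show ?thesis using open_U by (simp add: V_def open_Int)
  qed
  \<comment> \<open>Convexity of \<open>U\<close> is what keeps every intermediate translate of a
    test function on \<open>V\<close> inside \<open>U\<close>.\<close>
  have seg: "x + (t * s) *\<^sub>R ?e \<in> U" if "x \<in> V" "0 \<le> s" "s \<le> 1" for x s
  proof -
    have "(1 - s) *\<^sub>R x + s *\<^sub>R (x + t *\<^sub>R ?e) \<in> U"
      using that convex_U by (intro convexD_alt) (auto simp: V_def)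
    also have "(1 - s) *\<^sub>R x + s *\<^sub>R (x + t *\<^sub>R ?e) = x + (t * s) *\<^sub>R ?e"
      by (simp add: algebra_simps)
    finally show ?thesis .
  qed
  define I where "I x = (LINT s|lborel. indicator {0..1} s * Z (x + (t * s) *\<^sub>R ?e))" for x
  have Zl: "integrable (lborel \<Otimes>\<^sub>M lborel) (\<lambda>(x, s). indicator {0..1} s * Z (x + (t * s) *\<^sub>R ?e))"
    by (rule integrable_lines[OF Zi]) simp
  \<comment> \<open>The factor 0 makes \<open>W\<close> constant in \<open>s\<close>, so that
    \<open>integrable_lines\<close> also covers this side of the Fubini exchange.\<close>
  have Wl: "integrable (lborel \<Otimes>\<^sub>M lborel) (\<lambda>(x, s). indicator {0..1} s * W (x + (0 * s) *\<^sub>R ?e))"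
    by (rule integrable_lines[OF Wi]) simp
  have Ii: "integrable lborel I"
    using lborel_pair.integrable_fst[OF Zl] by (simp add: I_def[abs_def])
  then have [measurable]: "I \<in> borel_measurable borel" by auto
  have sh: "integrable lborel (\<lambda>x. f (x + h))" if "integrable lborel f" for f :: "real ^ 'n \<Rightarrow> real" and h
  proof -
    have [measurable]: "f \<in> borel_measurable borel" using that by auto
    show ?thesis
      by (rule integrableI_bounded)
         (use that nn_integral_lborel_shift[of "\<lambda>x. ennreal (norm (f x))" h] in \<open>auto simp: integrable_iff_bounded\<close>)
  qed
  define G where "G x = W (x + t *\<^sub>R ?e) - W x - t * I x" for x
  have Gi: "integrable lborel G" unfolding G_def using sh[OF Wi] Wi Ii by auto
  have "AE x in lebesgue. x \<in> V \<longrightarrow> G x = 0"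
  proof (rule AE_zero_if_test_integrals[OF V])
    have "integrable lebesgue G" using Gi integrable_completion[of G lborel] by auto
    then show "G locally_integrable_on V" unfolding locally_integrable_on_def set_integrable_def
      by (intro allI impI integrable_mult_indicator) (auto dest: compact_imp_closed)
    fix \<zeta> assume \<zeta>: "\<zeta> \<in> test_functions V"
    have sm: "smooth \<zeta>" using \<zeta> by (rule test_functions_smooth)
    have [measurable]: "\<zeta> \<in> borel_measurable borel" "partial_deriv i \<zeta> \<in> borel_measurable borel"
      using test_functions_borel[OF \<zeta>, of "[]"] test_functions_borel[OF \<zeta>, of "[i]"] by auto
    obtain C where C: "\<And>x. \<bar>\<zeta> x\<bar> \<le> C" using test_functions_bounded[OF \<zeta>, of "[]"] by auto
    obtain C' where C': "\<And>x. \<bar>partial_deriv i \<zeta> x\<bar> \<le> C'" using test_functions_bounded[OF \<zeta>, of "[i]"] by auto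
    have C0: "C \<ge> 0" "C' \<ge> 0" using C[of 0] C'[of 0] by auto
    let ?P = "\<lambda>x s. (indicator {0..1} s * W (x + (0 * s) *\<^sub>R ?e))
        * (- t * partial_deriv i \<zeta> (x + (- t * s) *\<^sub>R ?e))"
    let ?Q = "\<lambda>x s. (indicator {0..1} s * Z (x + (t * s) *\<^sub>R ?e)) * (t * \<zeta> x)"
    have bd: "integrable N (\<lambda>x. f x * g x)"
      if "integrable N f" "g \<in> borel_measurable N" "\<And>x. \<bar>g x\<bar> \<le> D" "D \<ge> 0"
      for N :: "'b measure" and f g :: "'b \<Rightarrow> real" and D
    proof (rule Bochner_Integration.integrable_bound)
      show "integrable N (\<lambda>x. D * f x)" using that by auto
      show "(\<lambda>x. f x * g x) \<in> borel_measurable N" using that by measurable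
      show "AE x in N. norm (f x * g x) \<le> norm (D * f x)"
        using mult_right_mono[OF that(3) abs_ge_zero] that(4) by (auto simp: abs_mult mult.commute)
    qed
    \<comment> \<open>A discrete integration by parts: the difference of translates moves from
      \<open>W\<close> to the smooth function, where the fundamental theorem of calculus
      applies.\<close>
    have step1: "(LINT x|lborel. (W (x + t *\<^sub>R ?e) - W x) * \<zeta> x) =
        (LINT x|lborel. W x * (\<zeta> (x - t *\<^sub>R ?e) - \<zeta> x))"
    proof -
      have "(LINT x|lborel. (W (x + t *\<^sub>R ?e) - W x) * \<zeta> x) =
          (LINT x|lborel. W (x + t *\<^sub>R ?e) * \<zeta> x) - (LINT x|lborel. W x * \<zeta> x)"
        using bd[OF sh[OF Wi] _ C] bd[OF Wi _ C] C0 by (simp add: left_diff_distrib)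
      also have "(LINT x|lborel. W (x + t *\<^sub>R ?e) * \<zeta> x) = (LINT x|lborel. W x * \<zeta> (x - t *\<^sub>R ?e))"
        using integral_lborel_shift[of "\<lambda>x. W x * \<zeta> (x - t *\<^sub>R ?e)" "t *\<^sub>R ?e"] by simp
      also have "\<dots> - (LINT x|lborel. W x * \<zeta> x) = (LINT x|lborel. W x * (\<zeta> (x - t *\<^sub>R ?e) - \<zeta> x))"
        using bd[OF Wi _ C] bd[of lborel W "\<lambda>x. \<zeta> (x - t *\<^sub>R ?e)" C, OF Wi _ C] C0 by (simp add: right_diff_distrib)
      finally show ?thesis .
    qed
    have step2: "W x * (\<zeta> (x - t *\<^sub>R ?e) - \<zeta> x) =
        (LINT s|lborel. ?P x s)" for x
    proof -
      have "\<zeta> (x - t *\<^sub>R ?e) - \<zeta> x =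
        (LINT s|lborel. indicator {0..1} s * (- t * partial_deriv i \<zeta> (x + (- t * s) *\<^sub>R ?e)))"
        using smooth_line_FTC[OF sm, of 0 1 "- t" i x, THEN has_bochner_integral_integral_eq] by simp
      then have "W x * (\<zeta> (x - t *\<^sub>R ?e) - \<zeta> x) =
        (LINT s|lborel. W x * (indicator {0..1} s * (- t * partial_deriv i \<zeta> (x + (- t * s) *\<^sub>R ?e))))"
        by (simp only: integral_mult_right_zero)
      then show ?thesis by (simp add: mult_ac)
    qed
    \<comment> \<open>For fixed \<open>s\<close> in the unit interval the translated \<zeta> is a
      test function on \<open>U\<close>, so the definition of the weak derivative replaces
      \<open>W\<close> by \<open>Z\<close>; translating back puts the shift on \<open>Z\<close>. For
      other \<open>s\<close> both sides are 0.\<close>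
    have step3: "(LINT x|lborel. ?P x s) =
        (LINT x|lborel. ?Q x s)" for s :: real
    proof (cases "s \<in> {0..1}")
      case True
      let ?h = "(- t * s) *\<^sub>R ?e"
      have \<zeta>h: "(\<lambda>x. \<zeta> (x + ?h)) \<in> test_functions U"
        using seg[of _ s] True by (intro test_functions_shift[OF \<zeta>]) auto
      have "(LINT x|lborel. W x * partial_deriv i \<zeta> (x + ?h)) = (LINT x|lborel. W x * partial_derivs [i] (\<lambda>x. \<zeta> (x + ?h)) x)"
        using partial_derivs_shift[OF sm, of "[i]" ?h] by simp
      also have "\<dots> = (LINT x|lebesgue. w x * partial_derivs [i] (\<lambda>x. \<zeta> (x + ?h)) x)"
        by (rule borel_version_test_integral[OF w(2) \<zeta>h Lp_loc[OF w(1)], symmetric])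
      also have "\<dots> = - (LINT x|lebesgue. z x * \<zeta> (x + ?h))"
        using d \<zeta>h unfolding is_weak_deriv_iff[OF open_U] by fastforce
      also have "\<dots> = - (LINT x|lborel. Z x * \<zeta> (x + ?h))"
        using borel_version_test_integral[OF z(2) \<zeta>h Lp_loc[OF z(1)], of "[]"] by simp
      also have "(LINT x|lborel. Z x * \<zeta> (x + ?h)) = (LINT x|lborel. Z (x + (t * s) *\<^sub>R ?e) * \<zeta> x)"
        using integral_lborel_shift[of "\<lambda>x. Z x * \<zeta> (x + ?h)" "(t * s) *\<^sub>R ?e"] by simp
      finally have *: "(LINT x|lborel. W x * partial_deriv i \<zeta> (x + ?h)) = - (LINT x|lborel. Z (x + (t * s) *\<^sub>R ?e) * \<zeta> x)" .
      have "(LINT x|lborel. ?P x s) =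
         (LINT x|lborel. (- t) * (W x * partial_deriv i \<zeta> (x + ?h)))"
        using True by (intro Bochner_Integration.integral_cong) auto
      also have "\<dots> = (LINT x|lborel. t * (Z (x + (t * s) *\<^sub>R ?e) * \<zeta> x))"
        unfolding integral_mult_right_zero * by simp
      also have "\<dots> = (LINT x|lborel. ?Q x s)"
        using True by (intro Bochner_Integration.integral_cong) auto
      finally show ?thesis .
    qed simp
    have f1: "integrable (lborel \<Otimes>\<^sub>M lborel) (\<lambda>(x, s). ?P x s)"
    proof -
      have "integrable (lborel \<Otimes>\<^sub>M lborel) (\<lambda>z. (\<lambda>(x, s). indicator {0..1} s * W (x + (0 * s) *\<^sub>R ?e)) z *
          (\<lambda>(x, s). - t * partial_deriv i \<zeta> (x + (- t * s) *\<^sub>R ?e)) z)"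
        by (rule bd[OF Wl, of _ "\<bar>t\<bar> * C'"]) (use C' C0 in \<open>auto simp: abs_mult mult_left_mono\<close>)
      then show ?thesis by (simp add: case_prod_beta')
    qed
    have f2: "integrable (lborel \<Otimes>\<^sub>M lborel) (\<lambda>(x, s). ?Q x s)"
    proof -
      have "integrable (lborel \<Otimes>\<^sub>M lborel) (\<lambda>z. (\<lambda>(x, s). indicator {0..1} s * Z (x + (t * s) *\<^sub>R ?e)) z *
          (\<lambda>(x, s). t * \<zeta> x) z)"
        by (rule bd[OF Zl, of _ "\<bar>t\<bar> * C"]) (use C C0 in \<open>auto simp: abs_mult mult_left_mono\<close>)
      then show ?thesis by (simp add: case_prod_beta')
    qed
    have "(LINT x|lborel. (W (x + t *\<^sub>R ?e) - W x) * \<zeta> x) =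
      (LINT x|lborel. LINT s|lborel. ?P x s)"
      unfolding step1 step2 ..
    also have "\<dots> = (LINT s|lborel. LINT x|lborel. ?P x s)"
      by (rule lborel_pair.Fubini_integral[OF f1, symmetric])
    also have "\<dots> = (LINT s|lborel. LINT x|lborel. ?Q x s)"
      unfolding step3 ..
    also have "\<dots> = (LINT x|lborel. LINT s|lborel. ?Q x s)"
      by (rule lborel_pair.Fubini_integral[OF f2])
    also have "\<dots> = (LINT x|lborel. I x * (t * \<zeta> x))"
      unfolding integral_mult_left_zero I_def ..
    finally have eq: "(LINT x|lborel. (W (x + t *\<^sub>R ?e) - W x) * \<zeta> x) = (LINT x|lborel. I x * (t * \<zeta> x))" .
    have "(LINT x|lborel. G x * \<zeta> x) = (LINT x|lborel. (W (x + t *\<^sub>R ?e) - W x) * \<zeta> x - I x * (t * \<zeta> x))"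
      by (intro Bochner_Integration.integral_cong) (auto simp: G_def algebra_simps)
    also have "\<dots> = (LINT x|lborel. (W (x + t *\<^sub>R ?e) - W x) * \<zeta> x) - (LINT x|lborel. I x * (t * \<zeta> x))"
    proof (rule Bochner_Integration.integral_diff)
      show "integrable lborel (\<lambda>x. (W (x + t *\<^sub>R ?e) - W x) * \<zeta> x)"
        using sh[OF Wi] Wi C C0 by (intro bd[of _ _ _ C]) auto
      show "integrable lborel (\<lambda>x. I x * (t * \<zeta> x))"
        using Ii C C0 by (intro bd[of _ _ _ "\<bar>t\<bar> * C"]) (auto simp: abs_mult mult_left_mono)
    qed
    finally have "(LINT x|lborel. G x * \<zeta> x) = 0" using eq by simp
    then show "(LINT x|lebesgue. G x * \<zeta> x) = 0"
      using Gi by (simp add: integral_completion)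
  qed
  moreover have [measurable]: "V \<in> sets borel" using V by simp
  ultimately have "AE x in lborel. x \<in> V \<longrightarrow> G x = 0"
    using Gi by (subst (asm) AE_completion_iff) auto
  then show ?thesis
    by eventually_elim (auto simp: V_def G_def I_def mult.left_commute[of _ t])
qed

text \<open>On almost every line, \<open>W\<close> deviates from \<open>W x\<close> by at most \<open>G x\<close> and has mean zero, so
  \<open>\<bar>W x\<bar> \<le> G x\<close>.\<close>

lemma poincare_derivative:
  assumes d: "is_weak_deriv U {#i#} w z" and w: "w \<in> Lp U p" and z: "z \<in> Lp U p"
    and \<phi>: "\<And>k. \<phi> k \<in> test_functions U" "(\<lambda>k. Ip (\<lambda>x. w x - partial_deriv i (\<phi> k) x)) \<longlonglongrightarrow> 0"
  shows "Ip w \<le> 4 * 5 powr p * Ip z"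
proof -
  let ?e = "axis i 1 :: real ^ 'n"
  obtain W where W: "is_borel_version w W" using borel_version_exists Lp_borel[OF w] by blast
  obtain Z where Z: "is_borel_version z Z" using borel_version_exists Lp_borel[OF z] by blast
  have [measurable]: "W \<in> borel_measurable borel" "Z \<in> borel_measurable borel" "U \<in> sets borel"
    using W Z by (auto simp: is_borel_version_def U_sets_borel)
  have W0: "W x = 0" if "x \<notin> U" for x using W that by (simp add: is_borel_version_def)
  have Wi: "integrable lborel W" by (rule borel_version_integrable(1)[OF Lp_integrable[OF w] W])
  define G where "G x = (\<integral>\<^sup>+t. indicator {-2..2} t * ennreal \<bar>Z (x + t *\<^sub>R ?e)\<bar> \<partial>lborel)" for x
  have [measurable]: "G \<in> borel_measurable borel" unfolding G_def[abs_def] by measurable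
  \<comment> \<open>The bound \<open>G x\<close> depends neither on \<open>t\<close> nor on the
    point reached: the segment from x to x + t e stays in the parameter interval.\<close>
  have inc: "AE x in lborel. x \<in> U \<and> x + t *\<^sub>R ?e \<in> U \<longrightarrow> ennreal \<bar>W (x + t *\<^sub>R ?e) - W x\<bar> \<le> G x" for t
    using weak_deriv_increment[OF d w W z Z, of t]
  proof eventually_elim
    case (elim x)
    show ?case
    proof (intro impI)
      assume x: "x \<in> U \<and> x + t *\<^sub>R ?e \<in> U"
      then have t: "\<bar>t\<bar> < 2" using shift_notin[of x t i] by linarith
      have eq: "W (x + t *\<^sub>R ?e) - W x = (LINT s|lborel. indicator {0..1} s * (t * Z (x + (t * s) *\<^sub>R ?e)))"
        using elim x by blast
      show "ennreal \<bar>W (x + t *\<^sub>R ?e) - W x\<bar> \<le> G x"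
      proof (cases "integrable lborel (\<lambda>s. indicator {0..1} s * (t * Z (x + (t * s) *\<^sub>R ?e))) \<and> t \<noteq> 0")
        case True
        then have "ennreal \<bar>W (x + t *\<^sub>R ?e) - W x\<bar> \<le>
            (\<integral>\<^sup>+s. ennreal \<bar>indicator {0..1} s * (t * Z (x + (t * s) *\<^sub>R ?e))\<bar> \<partial>lborel)"
          unfolding eq using integral_norm_bound_ennreal[OF conjunct1[OF True]] by simp
        also have "\<dots> \<le> (\<integral>\<^sup>+s. ennreal \<bar>t\<bar> * (indicator {-2..2} (0 + t * s) * ennreal \<bar>Z (x + (0 + t * s) *\<^sub>R ?e)\<bar>) \<partial>lborel)"
        proof (rule nn_integral_mono)
          fix s
          have "t * s \<in> {-2..2}" if "s \<in> {0..1}"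
          proof -
            have "\<bar>t * s\<bar> \<le> 2 * 1" unfolding abs_mult using that t by (intro mult_mono) auto
            then show ?thesis by (simp add: abs_le_iff)
          qed
          then show "ennreal \<bar>indicator {0..1} s * (t * Z (x + (t * s) *\<^sub>R ?e))\<bar> \<le>
            ennreal \<bar>t\<bar> * (indicator {-2..2} (0 + t * s) * ennreal \<bar>Z (x + (0 + t * s) *\<^sub>R ?e)\<bar>)"
            by (auto simp: indicator_def abs_mult ennreal_mult)
        qed
        also have "\<dots> = ennreal \<bar>t\<bar> * (\<integral>\<^sup>+s. indicator {-2..2} (0 + t * s) * ennreal \<bar>Z (x + (0 + t * s) *\<^sub>R ?e)\<bar> \<partial>lborel)"
          by (rule nn_integral_cmult) measurable
        \<comment> \<open>The substitution of t * s for the line parameter absorbs the factor |t|,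
          which requires t to be nonzero.\<close>
        also have "\<dots> = G x"
          unfolding G_def
          by (rule nn_integral_real_affine[symmetric]) (use True in simp_all)
        finally show ?thesis .
      next
        \<comment> \<open>If the integral does not exist its value is 0 by convention, so the
          increment is 0 here as well as for t = 0.\<close>
        case False
        then have "W (x + t *\<^sub>R ?e) - W x = 0"
          unfolding eq by (auto simp: not_integrable_integral_eq)
        then show ?thesis by simp
      qed
    qed
  qed
  \<comment> \<open>The exceptional set of x depends on t; Fubini exchanges the quantifiers, so that
    one x can be fixed with the bound valid for almost every t.\<close>
  have inc': "AE x in lborel. AE t in lborel. x \<in> U \<and> x + t *\<^sub>R ?e \<in> U \<longrightarrow> ennreal \<bar>W (x + t *\<^sub>R ?e) - W x\<bar> \<le> G x"
    by (subst lborel_pair.AE_commute) (measurable, use inc in auto)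
  have ae: "AE x in lborel. integrable lborel (\<lambda>t. indicator {-2..2} t * W (x + t *\<^sub>R ?e))"
    using lborel_pair.AE_integrable_fst[OF integrable_lines[OF Wi, of "-2" 2 1 ?e]] by simp
  have "AE x in lborel. x \<in> U \<longrightarrow> ennreal \<bar>W x\<bar> \<le> G x"
    using inc' ae line_integral_zero[OF w W \<phi>]
  proof eventually_elim
    case (elim x)
    show ?case
    proof (rule impI, rule ccontr)
      assume x: "x \<in> U" and "\<not> ennreal \<bar>W x\<bar> \<le> G x"
      then obtain g where g: "G x = ennreal g" "g \<ge> 0" "g < \<bar>W x\<bar>"
        by (cases "G x") (auto simp: ennreal_le_iff)
      \<comment> \<open>If |W x| exceeded the bound, \<open>W\<close> would keep the sign of
        \<open>W x\<close> almost everywhere on the line inside \<open>U\<close>. Then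
        \<open>F\<close> is nonnegative with integral 0, hence zero almost everywhere, yet it is
        positive almost everywhere on an interval around t = 0.\<close>
      define F where "F t = sgn (W x) * (indicator {-2..2} t * W (x + t *\<^sub>R ?e))" for t
      have Fi: "integrable lborel F" unfolding F_def using elim by auto
      have F0: "integral\<^sup>L lborel F = 0" unfolding F_def using elim x by simp
      have pos: "AE t in lborel. (x + t *\<^sub>R ?e \<in> U \<longrightarrow> F t > 0) \<and> 0 \<le> F t"
        using elim(1)
      proof eventually_elim
        case (elim t)
        show ?case
        proof (cases "x + t *\<^sub>R ?e \<in> U")
          case True
          then have t: "\<bar>t\<bar> < 2" using shift_notin[of x t i] x by linarith
          have "\<bar>W (x + t *\<^sub>R ?e) - W x\<bar> \<le> g" using elim True x g by (simp add: ennreal_le_iff)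
          then have "sgn (W x) * W (x + t *\<^sub>R ?e) > 0"
            using g by (auto simp: sgn_if abs_if split: if_splits)
          moreover have "- 2 \<le> t" "t \<le> 2" using t by linarith+
          ultimately show ?thesis by (simp add: F_def)
        qed (simp add: F_def W0)
      qed
      then have "AE t in lborel. F t = 0"
        using integral_nonneg_eq_0_iff_AE[OF Fi] F0 by auto
      with pos have notin: "AE t in lborel. x + t *\<^sub>R ?e \<notin> U"
        by eventually_elim auto
      obtain r where r: "r > 0" "ball x r \<subseteq> U" using open_U x openE by blast
      have "AE t in lborel. t \<notin> {-r<..<r}"
        using notin
      proof eventually_elim
        case (elim t)
        show ?case
        proof
          assume "t \<in> {-r<..<r}"
          then have "x + t *\<^sub>R ?e \<in> ball x r" by (auto simp: dist_norm norm_axis_1)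
          then show False using r elim by auto
        qed
      qed
      then have "emeasure lborel {-r<..<r} = 0"
        by (subst (asm) AE_iff_null_sets[symmetric]) auto
      then show False using r by simp
    qed
  qed
  then show ?thesis
    unfolding G_def by (rule Ip_le_line_integral[OF w W z Z])
qed

end

section \<open>Sobolev spaces\<close>

context sobolev_domain
begin

lemma sobolev_Lp: "f \<in> sobolev U k p \<Longrightarrow> f \<in> Lp U p"
  by (simp add: sobolev_def)

lemma sobolev_is_weak_deriv:
  assumes "f \<in> sobolev U k p" "size \<alpha> \<le> k"
  shows "is_weak_deriv U \<alpha> f (weak_deriv U \<alpha> f)"
  using assms by (auto simp: sobolev_def intro: is_weak_deriv_weak_deriv)

lemma borel_measurable_AE_cong:
  fixes f g :: "real ^ 'n \<Rightarrow> real"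
  assumes f: "f \<in> borel_measurable M" and ae: "AE x in M. f x = g x"
  shows "g \<in> borel_measurable M"
proof -
  have "(\<lambda>x. indicator U x * f x) \<in> borel_measurable lebesgue"
    using f U_sets by (subst (asm) borel_measurable_restrict_space_iff) auto
  moreover have "AE x in lebesgue. indicator U x * f x = indicator U x * g x"
    using ae U_sets by (subst (asm) AE_restrict_space_iff) (auto simp: indicator_def)
  ultimately have "(\<lambda>x. indicator U x * g x) \<in> borel_measurable lebesgue"
    by (rule borel_measurable_AE)
  then show ?thesis
    using U_sets by (subst borel_measurable_restrict_space_iff) auto
qed

lemma Lp_AE_cong:
  assumes "f \<in> Lp U p" "AE x in M. f x = g x"
  shows "g \<in> Lp U p"
proof -
  have m: "g \<in> borel_measurable M" using assms borel_measurable_AE_cong Lp_borel by blast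
  have "integrable M (\<lambda>x. \<bar>g x\<bar> powr p)"
    by (rule Bochner_Integration.integrable_cong_AE_imp[OF Lp_integrable_powr[OF assms(1)]])
       (use m assms(2) in auto)
  with m show ?thesis by (simp add: Lp_def)
qed

text \<open>Membership provides some weak derivative in L^p; the chosen one agrees with it almost
  everywhere, and the Lebesgue measure is complete.\<close>

lemma sobolev_weak_deriv_Lp:
  assumes f: "f \<in> sobolev U k p" and \<alpha>: "size \<alpha> \<le> k"
  shows "weak_deriv U \<alpha> f \<in> Lp U p"
proof -
  obtain v where v: "v \<in> Lp U p" "is_weak_deriv U \<alpha> f v"
    using f \<alpha> by (auto simp: sobolev_def)
  have "AE x in M. v x = weak_deriv U \<alpha> f x"
    using weak_deriv_AE[OF open_U v(2)] by eventually_elim simp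
  then show ?thesis by (rule Lp_AE_cong[OF v(1)])
qed

lemma sobolev_mono: "j \<le> k \<Longrightarrow> sobolev U k p \<subseteq> sobolev U j p"
  by (auto simp: sobolev_def)

lemma sobolev_lincomb:
  assumes f: "f \<in> sobolev U k p" and g: "g \<in> sobolev U k p"
  shows "(\<lambda>x. a * f x + b * g x) \<in> sobolev U k p"
  unfolding sobolev_def
proof (intro CollectI conjI allI impI)
  show "(\<lambda>x. a * f x + b * g x) \<in> Lp U p"
    using f g by (intro Lp_add Lp_scale) (auto intro: sobolev_Lp)
  fix \<alpha> :: "'n multiset" assume "size \<alpha> \<le> k"
  then show "\<exists>v\<in>Lp U p. is_weak_deriv U \<alpha> (\<lambda>x. a * f x + b * g x) v"
    using f g
    by (intro bexI[of _ "\<lambda>x. a * weak_deriv U \<alpha> f x + b * weak_deriv U \<alpha> g x"]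
        is_weak_deriv_add is_weak_deriv_scale open_U Lp_add Lp_scale)
       (auto intro: sobolev_is_weak_deriv sobolev_weak_deriv_Lp)
qed

lemma weak_deriv_lincomb:
  assumes f: "f \<in> sobolev U k p" and g: "g \<in> sobolev U k p" and \<alpha>: "size \<alpha> \<le> k"
  shows "AE x in M. weak_deriv U \<alpha> (\<lambda>x. a * f x + b * g x) x =
    a * weak_deriv U \<alpha> f x + b * weak_deriv U \<alpha> g x"
  using f g \<alpha> by (intro weak_deriv_AE is_weak_deriv_add is_weak_deriv_scale open_U)
    (auto intro: sobolev_is_weak_deriv)

lemma sobolev_diff:
  "f \<in> sobolev U k p \<Longrightarrow> g \<in> sobolev U k p \<Longrightarrow> (\<lambda>x. f x - g x) \<in> sobolev U k p"
  using sobolev_lincomb[of f k g 1 "-1"] by simp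

lemma weak_deriv_diff:
  "f \<in> sobolev U k p \<Longrightarrow> g \<in> sobolev U k p \<Longrightarrow> size \<alpha> \<le> k \<Longrightarrow>
    AE x in M. weak_deriv U \<alpha> (\<lambda>x. f x - g x) x = weak_deriv U \<alpha> f x - weak_deriv U \<alpha> g x"
  using weak_deriv_lincomb[of f k g \<alpha> 1 "-1"] by simp

lemma Ip_weak_deriv_diff:
  assumes "f \<in> sobolev U k p" "g \<in> sobolev U k p" "size \<alpha> \<le> k"
  shows "Ip (weak_deriv U \<alpha> (\<lambda>x. f x - g x)) = Ip (\<lambda>x. weak_deriv U \<alpha> f x - weak_deriv U \<alpha> g x)"
  using weak_deriv_diff[OF assms] assms
  by (intro Ip_cong_AE) (auto intro!: Lp_borel Lp_diff sobolev_weak_deriv_Lp sobolev_diff)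

text \<open>Order one is enough, because test functions enter the Sobolev theory only as
  approximants in \<open>sobolev0 U 1 p\<close>.\<close>

lemma test_functions_sobolev:
  assumes \<phi>: "\<phi> \<in> test_functions U" shows "\<phi> \<in> sobolev U 1 p"
  unfolding sobolev_def
proof (intro CollectI conjI allI impI)
  show L: "\<phi> \<in> Lp U p" by (rule Lp_test_function[OF \<phi>])
  fix \<alpha> :: "'n multiset" assume "size \<alpha> \<le> 1"
  then consider "\<alpha> = {#}" | i where "\<alpha> = {#i#}"
    by (metis One_nat_def le_Suc_eq le_zero_eq size_eq_0_iff_empty size_1_singleton_mset)
  then show "\<exists>v\<in>Lp U p. is_weak_deriv U \<alpha> \<phi> v"
  proof cases
    case 1
    then show ?thesis using L Lp_loc is_weak_deriv_empty by blast
  next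
    case 2
    then show ?thesis
      using is_weak_deriv_test_function[OF open_U \<phi>] test_functions_partial_derivs[OF \<phi>, of "[i]"]
      by (auto intro: Lp_test_function)
  qed
qed

text \<open>The p-th power of the Sobolev norm; without the root, estimates can be added term by
  term.\<close>

definition sobolev_sum :: "nat \<Rightarrow> (real ^ 'n \<Rightarrow> real) \<Rightarrow> real" where
  "sobolev_sum k f = (\<Sum>\<alpha> | size \<alpha> \<le> k. Ip (weak_deriv U \<alpha> f))"

lemma sobolev_sum_nonneg: "0 \<le> sobolev_sum k f"
  unfolding sobolev_sum_def by (intro sum_nonneg Ip_nonneg)

lemma Ip_le_sobolev_sum: "size \<alpha> \<le> k \<Longrightarrow> Ip (weak_deriv U \<alpha> f) \<le> sobolev_sum k f"
  unfolding sobolev_sum_def by (intro member_le_sum) (auto simp: Ip_nonneg finite_multi_indices)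

lemma sobolev_norm_less_iff:
  assumes "\<epsilon> > 0" shows "sobolev_norm U k p f < \<epsilon> \<longleftrightarrow> sobolev_sum k f < \<epsilon> powr p"
proof -
  have eq: "sobolev_norm U k p f = sobolev_sum k f powr (1 / p)"
    by (simp add: sobolev_norm_def sobolev_sum_def Ip_def)
  have "sobolev_sum k f powr (1 / p) < (\<epsilon> powr p) powr (1 / p) \<longleftrightarrow> sobolev_sum k f < \<epsilon> powr p"
    using sobolev_sum_nonneg[of k f] p_gt_1
    by (meson not_le powr_ge_zero powr_less_mono2 powr_mono2 zero_less_divide_1_iff
        less_imp_le less_trans zero_less_one)
  then show ?thesis using assms p_gt_1 by (simp add: eq powr_powr)
qed

text \<open>Since \<epsilon> ranges over all positive reals, measuring closeness by the norm or by
  its p-th power is equivalent.\<close>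

lemma sobolev0_iff:
  "f \<in> sobolev0 U k p \<longleftrightarrow> f \<in> sobolev U k p \<and>
    (\<forall>\<epsilon>>0. \<exists>\<phi>\<in>test_functions U. sobolev_sum k (\<lambda>x. f x - \<phi> x) < \<epsilon>)"
proof -
  have "(\<forall>\<epsilon>>0. \<exists>\<phi>\<in>test_functions U. sobolev_norm U k p (\<lambda>x. f x - \<phi> x) < \<epsilon>) \<longleftrightarrow>
    (\<forall>\<epsilon>>0. \<exists>\<phi>\<in>test_functions U. sobolev_sum k (\<lambda>x. f x - \<phi> x) < \<epsilon>)" (is "?L \<longleftrightarrow> ?R")
  proof
    assume L: ?L
    show ?R
    proof (intro allI impI)
      fix \<epsilon> :: real assume e: "\<epsilon> > 0"
      then have "\<epsilon> powr (1 / p) > 0" by simp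
      with L obtain \<phi> where "\<phi> \<in> test_functions U" "sobolev_norm U k p (\<lambda>x. f x - \<phi> x) < \<epsilon> powr (1 / p)"
        by blast
      then show "\<exists>\<phi>\<in>test_functions U. sobolev_sum k (\<lambda>x. f x - \<phi> x) < \<epsilon>"
        using e p_gt_1 by (intro bexI[of _ \<phi>]) (auto simp: sobolev_norm_less_iff powr_powr)
    qed
  next
    assume R: ?R
    show ?L
    proof (intro allI impI)
      fix \<epsilon> :: real assume e: "\<epsilon> > 0"
      then have "\<epsilon> powr p > 0" by simp
      with R obtain \<phi> where "\<phi> \<in> test_functions U" "sobolev_sum k (\<lambda>x. f x - \<phi> x) < \<epsilon> powr p"
        by blast
      then show "\<exists>\<phi>\<in>test_functions U. sobolev_norm U k p (\<lambda>x. f x - \<phi> x) < \<epsilon>"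
        using e by (intro bexI[of _ \<phi>]) (auto simp: sobolev_norm_less_iff)
    qed
  qed
  then show ?thesis by (auto simp: sobolev0_def)
qed

lemma sobolev_sum_lincomb_le:
  assumes f: "f \<in> sobolev U k p" and g: "g \<in> sobolev U k p"
  shows "sobolev_sum k (\<lambda>x. a * f x + b * g x) \<le>
    2 powr p * (\<bar>a\<bar> powr p * sobolev_sum k f + \<bar>b\<bar> powr p * sobolev_sum k g)"
proof -
  have "Ip (weak_deriv U \<alpha> (\<lambda>x. a * f x + b * g x)) \<le>
      2 powr p * (\<bar>a\<bar> powr p * Ip (weak_deriv U \<alpha> f) + \<bar>b\<bar> powr p * Ip (weak_deriv U \<alpha> g))"
    if \<alpha>: "size \<alpha> \<le> k" for \<alpha>
  proof -
    have L: "weak_deriv U \<alpha> f \<in> Lp U p" "weak_deriv U \<alpha> g \<in> Lp U p"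
      "weak_deriv U \<alpha> (\<lambda>x. a * f x + b * g x) \<in> Lp U p"
      using f g \<alpha> by (auto intro!: sobolev_weak_deriv_Lp sobolev_lincomb)
    have "Ip (weak_deriv U \<alpha> (\<lambda>x. a * f x + b * g x)) =
        Ip (\<lambda>x. a * weak_deriv U \<alpha> f x + b * weak_deriv U \<alpha> g x)"
      using weak_deriv_lincomb[OF f g \<alpha>] L by (intro Ip_cong_AE) (auto intro!: Lp_borel Lp_add Lp_scale)
    also have "\<dots> \<le> 2 powr p * (Ip (\<lambda>x. a * weak_deriv U \<alpha> f x) + Ip (\<lambda>x. b * weak_deriv U \<alpha> g x))"
      using L by (intro Ip_add_le Lp_scale)
    finally show ?thesis by (simp add: Ip_scale)
  qed
  then have "sobolev_sum k (\<lambda>x. a * f x + b * g x) \<le> (\<Sum>\<alpha> | size \<alpha> \<le> k.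
      2 powr p * (\<bar>a\<bar> powr p * Ip (weak_deriv U \<alpha> f) + \<bar>b\<bar> powr p * Ip (weak_deriv U \<alpha> g)))"
    unfolding sobolev_sum_def by (intro sum_mono) auto
  also have "\<dots> = 2 powr p * (\<bar>a\<bar> powr p * sobolev_sum k f + \<bar>b\<bar> powr p * sobolev_sum k g)"
    by (simp add: sobolev_sum_def sum.distrib flip: sum_distrib_left)
  finally show ?thesis .
qed

lemma sobolev0_lincomb:
  assumes f: "f \<in> sobolev0 U 1 p" and g: "g \<in> sobolev0 U 1 p"
  shows "(\<lambda>x. a * f x + b * g x) \<in> sobolev0 U 1 p"
  unfolding sobolev0_iff
proof (intro conjI allI impI)
  have fS: "f \<in> sobolev U 1 p" and gS: "g \<in> sobolev U 1 p" using f g by (auto simp: sobolev0_iff)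
  then show "(\<lambda>x. a * f x + b * g x) \<in> sobolev U 1 p" by (rule sobolev_lincomb)
  fix \<epsilon> :: real assume e: "\<epsilon> > 0"
  \<comment> \<open>The added 1 keeps the divisor positive when both coefficients vanish; the extra
    half in \<delta> gives the strict final inequality.\<close>
  define c where "c = \<bar>a\<bar> powr p + \<bar>b\<bar> powr p + 1"
  have c: "c > 0" "\<bar>a\<bar> powr p + \<bar>b\<bar> powr p \<le> c" by (auto simp: c_def intro: add_nonneg_pos)
  define \<delta> where "\<delta> = \<epsilon> / (2 powr p * c) / 2"
  have \<delta>: "\<delta> > 0" using e c by (simp add: \<delta>_def)
  obtain \<phi> \<psi> where \<phi>: "\<phi> \<in> test_functions U" "sobolev_sum 1 (\<lambda>x. f x - \<phi> x) < \<delta>"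
    and \<psi>: "\<psi> \<in> test_functions U" "sobolev_sum 1 (\<lambda>x. g x - \<psi> x) < \<delta>"
    using f g \<delta> unfolding sobolev0_iff by meson
  have "sobolev_sum 1 (\<lambda>x. a * (f x - \<phi> x) + b * (g x - \<psi> x)) \<le>
      2 powr p * (\<bar>a\<bar> powr p * sobolev_sum 1 (\<lambda>x. f x - \<phi> x) + \<bar>b\<bar> powr p * sobolev_sum 1 (\<lambda>x. g x - \<psi> x))"
    by (intro sobolev_sum_lincomb_le sobolev_diff fS gS test_functions_sobolev \<phi> \<psi>)
  also have "\<dots> \<le> 2 powr p * (\<bar>a\<bar> powr p * \<delta> + \<bar>b\<bar> powr p * \<delta>)"
    using \<phi> \<psi> by (intro mult_left_mono add_mono) auto
  also have "\<dots> \<le> 2 powr p * (c * \<delta>)"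
    unfolding distrib_right[symmetric] using c \<delta> by (intro mult_left_mono mult_right_mono) auto
  also have "\<dots> < \<epsilon>" using e c by (simp add: \<delta>_def field_simps)
  finally have "sobolev_sum 1 (\<lambda>x. a * (f x - \<phi> x) + b * (g x - \<psi> x)) < \<epsilon>" .
  then show "\<exists>\<eta>\<in>test_functions U. sobolev_sum 1 (\<lambda>x. a * f x + b * g x - \<eta> x) < \<epsilon>"
    using \<phi> \<psi> by (intro bexI[of _ "\<lambda>x. a * \<phi> x + b * \<psi> x"])
      (auto simp: algebra_simps intro!: test_functions_add test_functions_scale)
qed

lemma sobolev0_closed:
  assumes f: "\<And>n. f n \<in> sobolev0 U 1 p" and h: "h \<in> sobolev U 1 p"
    and lim: "(\<lambda>n. sobolev_sum 1 (\<lambda>x. f n x - h x)) \<longlonglongrightarrow> 0"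
  shows "h \<in> sobolev0 U 1 p"
  unfolding sobolev0_iff
proof (intro conjI allI impI h)
  fix \<epsilon> :: real assume e: "\<epsilon> > 0"
  define \<delta> where "\<delta> = \<epsilon> / (2 powr p) / 2"
  have \<delta>: "\<delta> > 0" using e by (simp add: \<delta>_def)
  have fS: "f n \<in> sobolev U 1 p" for n using f by (auto simp: sobolev0_iff)
  obtain n where n: "sobolev_sum 1 (\<lambda>x. f n x - h x) < \<delta>"
    using LIMSEQ_D[OF lim \<delta>] sobolev_sum_nonneg by (metis abs_of_nonneg diff_zero order_refl real_norm_def)
  obtain \<phi> where \<phi>: "\<phi> \<in> test_functions U" "sobolev_sum 1 (\<lambda>x. f n x - \<phi> x) < \<delta>"
    using f \<delta> unfolding sobolev0_iff by meson
  \<comment> \<open>Writes h - \<phi> as (f n - \<phi>) - (f n - h), so a test function near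
    \<open>f n\<close> is also near \<open>h\<close>.\<close>
  have "sobolev_sum 1 (\<lambda>x. 1 * (f n x - \<phi> x) + (- 1) * (f n x - h x)) \<le>
      2 powr p * (\<bar>1\<bar> powr p * sobolev_sum 1 (\<lambda>x. f n x - \<phi> x) + \<bar>- 1\<bar> powr p * sobolev_sum 1 (\<lambda>x. f n x - h x))"
    by (intro sobolev_sum_lincomb_le sobolev_diff fS h test_functions_sobolev \<phi>)
  also have "\<dots> < 2 powr p * (\<delta> + \<delta>)"
    using n \<phi>(2) by (intro mult_strict_left_mono) auto
  also have "\<dots> = \<epsilon>" by (simp add: \<delta>_def)
  finally have "sobolev_sum 1 (\<lambda>x. 1 * (f n x - \<phi> x) + (- 1) * (f n x - h x)) < \<epsilon>" .
  then have "sobolev_sum 1 (\<lambda>x. h x - \<phi> x) < \<epsilon>" by (simp add: algebra_simps)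
  then show "\<exists>\<phi>\<in>test_functions U. sobolev_sum 1 (\<lambda>x. h x - \<phi> x) < \<epsilon>" using \<phi>(1) by blast
qed

text \<open>One sequence approximates the function and all first derivatives simultaneously, since
  the Sobolev sum dominates each of its terms.\<close>

lemma sobolev0_approx:
  assumes f: "f \<in> sobolev0 U 1 p"
  obtains \<phi> where "\<And>k. \<phi> k \<in> test_functions U" "(\<lambda>k. Ip (\<lambda>x. f x - \<phi> k x)) \<longlonglongrightarrow> 0"
    "\<And>i. (\<lambda>k. Ip (\<lambda>x. weak_deriv U {#i#} f x - partial_deriv i (\<phi> k) x)) \<longlonglongrightarrow> 0"
proof -
  have fS: "f \<in> sobolev U 1 p" using f by (auto simp: sobolev0_iff)
  have "\<exists>\<phi>\<in>test_functions U. sobolev_sum 1 (\<lambda>x. f x - \<phi> x) < inverse (real (Suc k))" for k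
    using f unfolding sobolev0_iff by simp
  then obtain \<phi> where \<phi>: "\<And>k. \<phi> k \<in> test_functions U"
    "\<And>k. sobolev_sum 1 (\<lambda>x. f x - \<phi> k x) < inverse (real (Suc k))"
    by metis
  have lim: "(\<lambda>k. Ip (weak_deriv U \<alpha> (\<lambda>x. f x - \<phi> k x))) \<longlonglongrightarrow> 0" if "size \<alpha> \<le> 1" for \<alpha>
  proof (rule tendsto_sandwich[OF _ _ tendsto_const LIMSEQ_inverse_real_of_nat])
    show "\<forall>\<^sub>F k in sequentially. Ip (weak_deriv U \<alpha> (\<lambda>x. f x - \<phi> k x)) \<le> inverse (real (Suc k))"
      using Ip_le_sobolev_sum[OF that] \<phi>(2) by (intro always_eventually allI) (meson less_imp_le order_trans)
  qed (simp add: Ip_nonneg)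
  have S: "(\<lambda>x. f x - \<phi> k x) \<in> sobolev U 1 p" for k by (intro sobolev_diff fS test_functions_sobolev \<phi>)
  show thesis
  proof (rule that[OF \<phi>(1)])
    have "Ip (weak_deriv U {#} (\<lambda>x. f x - \<phi> k x)) = Ip (\<lambda>x. f x - \<phi> k x)" for k
      using weak_deriv_AE[OF open_U is_weak_deriv_empty[OF Lp_loc[OF sobolev_Lp[OF S]]], of k]
      by (intro Ip_cong_AE) (auto intro!: Lp_borel sobolev_weak_deriv_Lp[OF S] sobolev_Lp[OF S])
    then show "(\<lambda>k. Ip (\<lambda>x. f x - \<phi> k x)) \<longlonglongrightarrow> 0" using lim[of "{#}"] by simp
    fix i
    have "Ip (weak_deriv U {#i#} (\<lambda>x. f x - \<phi> k x)) = Ip (\<lambda>x. weak_deriv U {#i#} f x - partial_deriv i (\<phi> k) x)" for k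
    proof (rule Ip_cong_AE)
      have "partial_deriv i (\<phi> k) \<in> Lp U p"
        using test_functions_partial_derivs[OF \<phi>(1), of "[i]"] by (auto intro: Lp_test_function)
      then show "(\<lambda>x. weak_deriv U {#i#} f x - partial_deriv i (\<phi> k) x) \<in> borel_measurable M"
        by (intro Lp_borel Lp_diff sobolev_weak_deriv_Lp[OF fS]) auto
      show "weak_deriv U {#i#} (\<lambda>x. f x - \<phi> k x) \<in> borel_measurable M"
        by (intro Lp_borel sobolev_weak_deriv_Lp[OF S]) auto
      show "AE x in M. weak_deriv U {#i#} (\<lambda>x. f x - \<phi> k x) x = weak_deriv U {#i#} f x - partial_deriv i (\<phi> k) x"
        by (intro weak_deriv_AE is_weak_deriv_diff open_U is_weak_deriv_test_function \<phi> sobolev_is_weak_deriv[OF fS]) auto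
    qed
    then show "(\<lambda>k. Ip (\<lambda>x. weak_deriv U {#i#} f x - partial_deriv i (\<phi> k) x)) \<longlonglongrightarrow> 0"
      using lim[of "{#i#}"] by simp
  qed
qed

lemma zero_sobolev0: "(\<lambda>_. 0) \<in> sobolev0 U 1 p"
  unfolding sobolev0_iff
proof (intro conjI allI impI)
  have 0: "(\<lambda>_. 0) \<in> sobolev U 1 p" by (intro test_functions_sobolev test_functions_zero)
  then show "(\<lambda>_. 0) \<in> sobolev U 1 p" .
  fix \<epsilon> :: real assume "\<epsilon> > 0"
  \<comment> \<open>Vanishing coefficients make the right side 0, which spares a computation of the
    weak derivatives of the zero function.\<close>
  have "sobolev_sum 1 (\<lambda>x. 0 * 0 + 0 * 0) \<le> 2 powr p * (\<bar>0\<bar> powr p * sobolev_sum 1 (\<lambda>_. 0) + \<bar>0\<bar> powr p * sobolev_sum 1 (\<lambda>_. 0))"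
    by (rule sobolev_sum_lincomb_le[OF 0 0])
  then have "sobolev_sum 1 (\<lambda>x. 0) \<le> 0" by simp
  then show "\<exists>\<phi>\<in>test_functions U. sobolev_sum 1 (\<lambda>x. 0 - \<phi> x) < \<epsilon>"
    using \<open>\<epsilon> > 0\<close> by (intro bexI[of _ "\<lambda>_. 0"]) (auto intro: test_functions_zero)
qed

text \<open>Summing over ordered pairs counts mixed derivatives twice, but matches the entries of
  \<open>weak_hessian\<close>.\<close>

definition hessian_sum :: "(real ^ 'n \<Rightarrow> real) \<Rightarrow> real" where
  "hessian_sum f = (\<Sum>i\<in>UNIV. \<Sum>j\<in>UNIV. Ip (weak_deriv U {#i, j#} f))"

lemma hessian_sum_nonneg: "0 \<le> hessian_sum f"
  unfolding hessian_sum_def by (intro sum_nonneg Ip_nonneg)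

lemma Ip_le_hessian_sum: "Ip (weak_deriv U {#i, j#} f) \<le> hessian_sum f"
proof -
  have "Ip (weak_deriv U {#i, j#} f) \<le> (\<Sum>j\<in>UNIV. Ip (weak_deriv U {#i, j#} f))"
    by (rule member_le_sum[of j UNIV "\<lambda>j. Ip (weak_deriv U {#i, j#} f)"]) (auto simp: Ip_nonneg)
  also have "\<dots> \<le> hessian_sum f"
    unfolding hessian_sum_def
    by (rule member_le_sum[of i UNIV "\<lambda>i. \<Sum>j\<in>UNIV. Ip (weak_deriv U {#i, j#} f)"])
       (auto simp: Ip_nonneg sum_nonneg)
  finally show ?thesis .
qed

end

context convex_sobolev_domain
begin

text \<open>First derivatives are controlled by pure second derivatives in the same direction, and
  the function by a first derivative; second derivatives are themselves terms of the Hessian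
  sum.\<close>

lemma sobolev_sum_le_hessian_sum:
  obtains C where "C \<ge> 0" "\<And>v. v \<in> sobolev U 2 p \<Longrightarrow> v \<in> sobolev0 U 1 p \<Longrightarrow> sobolev_sum 2 v \<le> C * hessian_sum v"
proof -
  \<comment> \<open>\<open>c1\<close> is the constant of \<open>poincare\<close> and
    \<open>c2\<close> that of \<open>poincare_derivative\<close>; \<open>c\<close> dominates c1 *
    c2, c2 and 1, the constants for the orders 0, 1 and 2.\<close>
  define c1 where "c1 = 2 powr p * (4 * 5 powr p * 2 powr p)"
  define c2 where "c2 = 4 * 5 powr p"
  define c where "c = c1 * c2 + c2 + 1"
  have c: "c1 \<ge> 0" "c2 \<ge> 0" "c \<ge> c1 * c2" "c \<ge> c2" "c \<ge> 1" "c \<ge> 0"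
    by (auto simp: c_def c1_def c2_def)
  have bound: "Ip (weak_deriv U \<alpha> v) \<le> c * hessian_sum v"
    if v: "v \<in> sobolev U 2 p" and v0: "v \<in> sobolev0 U 1 p" and \<alpha>: "size \<alpha> \<le> 2" for v \<alpha>
  proof -
    note H0 = hessian_sum_nonneg[of v]
    obtain \<phi> where \<phi>: "\<And>k. \<phi> k \<in> test_functions U" "(\<lambda>k. Ip (\<lambda>x. v x - \<phi> k x)) \<longlonglongrightarrow> 0"
      "\<And>i. (\<lambda>k. Ip (\<lambda>x. weak_deriv U {#i#} v x - partial_deriv i (\<phi> k) x)) \<longlonglongrightarrow> 0"
      using sobolev0_approx[OF v0] by blast
    have first: "Ip (weak_deriv U {#i#} v) \<le> c2 * hessian_sum v" for i
    proof -
      have "Ip (weak_deriv U {#i#} v) \<le> c2 * Ip (weak_deriv U {#i, i#} v)"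
        unfolding c2_def
        by (rule poincare_derivative[OF is_weak_deriv_of_weak_deriv[OF open_U sobolev_is_weak_deriv[OF v] sobolev_is_weak_deriv[OF v]]
            sobolev_weak_deriv_Lp[OF v] sobolev_weak_deriv_Lp[OF v] \<phi>(1,3)]) auto
      also have "\<dots> \<le> c2 * hessian_sum v" using c by (intro mult_left_mono Ip_le_hessian_sum)
      finally show ?thesis .
    qed
    have zeroth: "Ip v \<le> c1 * c2 * hessian_sum v"
    proof -
      \<comment> \<open>Any coordinate direction serves.\<close>
      fix i :: 'n
      have "Ip v \<le> c1 * Ip (weak_deriv U {#i#} v)"
        unfolding c1_def
        using poincare[OF sobolev_Lp[OF v] sobolev_weak_deriv_Lp[OF v] \<phi>(1,2,3), of i] by (simp add: mult_ac)
      also have "\<dots> \<le> c1 * (c2 * hessian_sum v)" using c by (intro mult_left_mono first)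
      finally show ?thesis by (simp add: mult_ac)
    qed
    consider "\<alpha> = {#}" | i where "\<alpha> = {#i#}" | i j where "\<alpha> = {#i, j#}"
    proof -
      have "size \<alpha> = 0 \<or> size \<alpha> = 1 \<or> size \<alpha> = 2" using \<alpha> by linarith
      then show thesis
      proof (elim disjE)
        assume "size \<alpha> = 2"
        then obtain a N where "\<alpha> = add_mset a N" "size N = 1"
          by (metis Suc_1 size_eq_Suc_imp_eq_union size_add_mset union_mset_add_mset_right add.right_neutral Suc_inject)
        then show thesis using that(3) by (metis size_1_singleton_mset)
      next
        assume "size \<alpha> = 1"
        then show thesis using that(2) size_1_singleton_mset by blast
      qed (use that(1) in simp)
    qed
    then show ?thesis
    proof cases
      case 1
      have "AE x in M. weak_deriv U {#} v x = v x"
        by (intro weak_deriv_AE open_U is_weak_deriv_empty Lp_loc sobolev_Lp[OF v])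
      then have "Ip (weak_deriv U {#} v) = Ip v"
        using sobolev_weak_deriv_Lp[OF v, of "{#}"] sobolev_Lp[OF v] by (intro Ip_cong_AE) (auto simp: Lp_borel)
      then show ?thesis using zeroth 1 mult_right_mono[OF c(3) H0] by simp
    next
      case 2
      then show ?thesis using first mult_right_mono[OF c(4) H0] by (metis order_trans)
    next
      case 3
      then show ?thesis using Ip_le_hessian_sum[of _ _ v] mult_right_mono[OF c(5) H0] by (metis mult_1 order_trans)
    qed
  qed
  show thesis
  proof
    show "real (card {\<alpha> :: 'n multiset. size \<alpha> \<le> 2}) * c \<ge> 0" using c by simp
    fix v assume v: "v \<in> sobolev U 2 p" "v \<in> sobolev0 U 1 p"
    have "sobolev_sum 2 v \<le> (\<Sum>\<alpha> | size (\<alpha> :: 'n multiset) \<le> 2. c * hessian_sum v)"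
      unfolding sobolev_sum_def using bound[OF v] by (intro sum_mono) auto
    then show "sobolev_sum 2 v \<le> real (card {\<alpha> :: 'n multiset. size \<alpha> \<le> 2}) * c * hessian_sum v"
      by simp
  qed
qed

end

section \<open>Uniform convexity and minimizing sequences\<close>

text \<open>For negative t the midpoint lies in [0, 1/2), where the p-th power is at most its base.
  Otherwise the mean value theorem on both halves of [t, 1] compares values of the strictly
  increasing derivative.\<close>

lemma powr_midpoint_strict_unit:
  fixes t p :: real
  assumes p: "p > 1" and t: "- 1 \<le> t" "t < 1"
  shows "\<bar>(1 + t) / 2\<bar> powr p < (1 + \<bar>t\<bar> powr p) / 2"
proof (cases "t < 0")
  case True
  have "((1 + t) / 2) powr p \<le> ((1 + t) / 2) powr 1"
    using p t True by (intro powr_mono') auto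
  also have "\<dots> < 1 / 2" using t True by simp
  also have "1 / 2 \<le> (1 + \<bar>t\<bar> powr p) / 2" by simp
  finally show ?thesis using t by simp
next
  case False
  define s where "s = (1 + t) / 2"
  have s: "t < s" "s < 1" "0 < s" "1 - s = s - t" using t False by (auto simp: s_def field_simps)
  let ?f = "\<lambda>x::real. x powr p"
  have mvt: "\<exists>z. a < z \<and> z < b \<and> ?f b - ?f a = (b - a) * (p * z powr (p - 1))"
    if ab: "0 \<le> a" "a < b" for a b
  proof -
    have "continuous_on {a..b} ?f" using ab p by (intro continuous_on_powr' continuous_intros) auto
    moreover have "?f differentiable (at x)" if "a < x" for x
      using has_real_derivative_powr[of x p] that ab(1) by (force simp: real_differentiable_def)
    ultimately obtain l z where z: "a < z" "z < b" "DERIV ?f z :> l" "?f b - ?f a = (b - a) * l"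
      using MVT[OF ab(2), of ?f] by blast
    moreover have "l = p * z powr (p - 1)"
      using DERIV_unique[OF z(3) has_real_derivative_powr] z(1) ab(1) by auto
    ultimately show ?thesis by blast
  qed
  obtain z1 where z1: "t < z1" "z1 < s" "?f s - ?f t = (s - t) * (p * z1 powr (p - 1))"
    using mvt[of t s] s False by auto
  obtain z2 where z2: "s < z2" "z2 < 1" "?f 1 - ?f s = (1 - s) * (p * z2 powr (p - 1))"
    using mvt[of s 1] s by auto
  have "z1 powr (p - 1) < z2 powr (p - 1)"
    using p z1 z2 False by (intro powr_less_mono2) auto
  then have "?f s - ?f t < ?f 1 - ?f s"
    unfolding z1(3) z2(3) s(4) using s p by (intro mult_strict_left_mono) auto
  then show ?thesis using s False by (simp add: s_def[symmetric])
qed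

text \<open>Reduces a symmetric, homogeneous inequality in two reals to one parameter t in [-1, 1]
  by factoring out the entry of larger absolute value.\<close>

lemma powr_abs_wlog:
  fixes P :: "real \<Rightarrow> real \<Rightarrow> bool"
  assumes sym: "\<And>a b. P a b \<Longrightarrow> P b a" and zero: "P 0 0"
    and unit: "\<And>a t. a \<noteq> 0 \<Longrightarrow> - 1 \<le> t \<Longrightarrow> t \<le> 1 \<Longrightarrow> P a (a * t)"
  shows "P a b"
proof -
  have *: "P a b" if "\<bar>b\<bar> \<le> \<bar>a\<bar>" for a b
  proof (cases "a = 0")
    case True
    then show ?thesis using that zero by simp
  next
    case False
    have "\<bar>b / a\<bar> \<le> 1" using that False by (simp add: abs_divide divide_le_eq)
    then have "- 1 \<le> b / a" "b / a \<le> 1" by linarith+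
    then show ?thesis using unit[of a "b / a"] False by simp
  qed
  then show ?thesis using sym by (cases "\<bar>b\<bar> \<le> \<bar>a\<bar>") auto
qed

lemma powr_midpoint_le:
  fixes a b p :: real
  assumes p: "p > 1"
  shows "\<bar>(a + b) / 2\<bar> powr p \<le> (\<bar>a\<bar> powr p + \<bar>b\<bar> powr p) / 2"
proof (rule powr_abs_wlog[of "\<lambda>a b. \<bar>(a + b) / 2\<bar> powr p \<le> (\<bar>a\<bar> powr p + \<bar>b\<bar> powr p) / 2"])
  fix a t :: real assume "a \<noteq> 0" "- 1 \<le> t" "t \<le> 1"
  then have "\<bar>(1 + t) / 2\<bar> powr p \<le> (1 + \<bar>t\<bar> powr p) / 2"
    using powr_midpoint_strict_unit[OF p, of t] by (cases "t = 1") auto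
  then have "\<bar>a\<bar> powr p * \<bar>(1 + t) / 2\<bar> powr p \<le> \<bar>a\<bar> powr p * ((1 + \<bar>t\<bar> powr p) / 2)"
    by (intro mult_left_mono) auto
  also have "\<bar>a\<bar> powr p * \<bar>(1 + t) / 2\<bar> powr p = \<bar>(a + a * t) / 2\<bar> powr p"
    by (simp add: abs_mult distrib_left flip: powr_mult)
       (simp add: abs_mult[symmetric] distrib_left)
  finally show "\<bar>(a + a * t) / 2\<bar> powr p \<le> (\<bar>a\<bar> powr p + \<bar>a * t\<bar> powr p) / 2"
    by (simp add: abs_mult powr_mult distrib_left)
qed (auto simp: add.commute)

text \<open>By homogeneity one may take a = 1, b = t. Where |1 - t|^p < \<epsilon> the first term
  suffices. The remaining t form a compact set without 1, on which the midpoint gap \<open>q\<close>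
  has a positive minimum \<open>q t0\<close>; there 2^p / q t0 works as constant, because |1 - t|
  \<le> 2.\<close>

lemma powr_uniform_convex:
  fixes p \<epsilon> :: real
  assumes p: "p > 1" and \<epsilon>: "\<epsilon> > 0"
  obtains C where "C > 0" "\<And>a b :: real. \<bar>a - b\<bar> powr p \<le>
    \<epsilon> * (\<bar>a\<bar> powr p + \<bar>b\<bar> powr p) + C * ((\<bar>a\<bar> powr p + \<bar>b\<bar> powr p) / 2 - \<bar>(a + b) / 2\<bar> powr p)"
proof -
  define q where "q t = (1 + \<bar>t\<bar> powr p) / 2 - \<bar>(1 + t) / 2\<bar> powr p" for t :: real
  have q0: "q t \<ge> 0" for t using powr_midpoint_le[OF p, of 1 t] by (simp add: q_def)
  have cont: "continuous_on A q" for A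
    unfolding q_def using p by (intro continuous_intros continuous_on_powr') auto
  define K where "K = {t\<in>{-1..1}. \<epsilon> \<le> \<bar>1 - t\<bar> powr p}"
  have "\<exists>C>0. \<forall>t\<in>{-1..1}. \<bar>1 - t\<bar> powr p \<le> \<epsilon> + C * q t"
  proof (cases "K = {}")
    case True
    then show ?thesis
      using q0 by (intro exI[of _ 1]) (fastforce simp: K_def intro: add_increasing2)
  next
    case False
    have "continuous_on UNIV (\<lambda>t::real. \<bar>1 - t\<bar> powr p)"
      using p by (intro continuous_intros continuous_on_powr') auto
    then have "closed {t. \<epsilon> \<le> \<bar>1 - t\<bar> powr p}" by (intro closed_Collect_le continuous_on_const)
    then have "compact ({-1..1} \<inter> {t. \<epsilon> \<le> \<bar>1 - t\<bar> powr p})" by (intro compact_Int_closed) auto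
    also have "{-1..1} \<inter> {t. \<epsilon> \<le> \<bar>1 - t\<bar> powr p} = K" by (auto simp: K_def)
    finally obtain t0 where t0: "t0 \<in> K" "\<And>t. t \<in> K \<Longrightarrow> q t0 \<le> q t"
      using continuous_attains_inf[OF _ False cont] by blast
    have "t0 \<noteq> 1" using t0(1) \<epsilon> by (auto simp: K_def)
    then have pos: "q t0 > 0" using powr_midpoint_strict_unit[OF p, of t0] t0(1) by (auto simp: q_def K_def)
    show ?thesis
    proof (intro exI[of _ "2 powr p / q t0"] conjI ballI)
      show "2 powr p / q t0 > 0" using pos by simp
      fix t :: real assume t: "t \<in> {-1..1}"
      show "\<bar>1 - t\<bar> powr p \<le> \<epsilon> + 2 powr p / q t0 * q t"
      proof (cases "t \<in> K")
        case True
        have "\<bar>1 - t\<bar> powr p \<le> 2 powr p" using t p by (intro powr_mono2) auto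
        also have "\<dots> = 2 powr p / q t0 * q t0" using pos by simp
        also have "\<dots> \<le> 2 powr p / q t0 * q t" using pos t0(2)[OF True] by (intro mult_left_mono) auto
        finally show ?thesis using \<epsilon> by simp
      next
        case False
        have "0 \<le> 2 powr p / q t0 * q t" using q0 by simp
        then show ?thesis using False t by (auto simp: K_def)
      qed
    qed
  qed
  then obtain C where C: "C > 0" "\<And>t. -1 \<le> t \<Longrightarrow> t \<le> 1 \<Longrightarrow> \<bar>1 - t\<bar> powr p \<le> \<epsilon> + C * q t"
    by auto
  show thesis
  proof (rule that[OF C(1)])
    fix a b :: real
    show "\<bar>a - b\<bar> powr p \<le>
      \<epsilon> * (\<bar>a\<bar> powr p + \<bar>b\<bar> powr p) + C * ((\<bar>a\<bar> powr p + \<bar>b\<bar> powr p) / 2 - \<bar>(a + b) / 2\<bar> powr p)"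
    proof (rule powr_abs_wlog[of "\<lambda>a b. \<bar>a - b\<bar> powr p \<le> \<epsilon> * (\<bar>a\<bar> powr p + \<bar>b\<bar> powr p) +
        C * ((\<bar>a\<bar> powr p + \<bar>b\<bar> powr p) / 2 - \<bar>(a + b) / 2\<bar> powr p)"])
      fix a t :: real assume t: "a \<noteq> 0" "- 1 \<le> t" "t \<le> 1"
      have e1: "\<bar>a - a * t\<bar> powr p = \<bar>a\<bar> powr p * \<bar>1 - t\<bar> powr p"
        by (metis abs_ge_zero abs_mult mult.right_neutral powr_mult right_diff_distrib)
      have "(a + a * t) / 2 = a * ((1 + t) / 2)" by (simp add: distrib_left)
      then have e2: "\<bar>(a + a * t) / 2\<bar> powr p = \<bar>a\<bar> powr p * \<bar>(1 + t) / 2\<bar> powr p"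
        by (simp only: abs_mult powr_mult abs_ge_zero)
      have e3: "\<bar>a * t\<bar> powr p = \<bar>a\<bar> powr p * \<bar>t\<bar> powr p" by (simp add: abs_mult powr_mult)
      have "\<bar>1 - t\<bar> powr p \<le> \<epsilon> * (1 + \<bar>t\<bar> powr p) + C * q t"
      proof -
        have "\<epsilon> * 1 \<le> \<epsilon> * (1 + \<bar>t\<bar> powr p)" using \<epsilon> by (intro mult_left_mono) auto
        then show ?thesis using C(2)[of t] t by linarith
      qed
      then have "\<bar>a\<bar> powr p * \<bar>1 - t\<bar> powr p \<le> \<bar>a\<bar> powr p * (\<epsilon> * (1 + \<bar>t\<bar> powr p) + C * q t)"
        by (intro mult_left_mono) auto
      then show "\<bar>a - a * t\<bar> powr p \<le> \<epsilon> * (\<bar>a\<bar> powr p + \<bar>a * t\<bar> powr p) +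
          C * ((\<bar>a\<bar> powr p + \<bar>a * t\<bar> powr p) / 2 - \<bar>(a + a * t) / 2\<bar> powr p)"
        unfolding e1 e2 e3 q_def by (simp add: algebra_simps add_divide_distrib)
    qed (auto simp: add.commute abs_minus_commute)
  qed
qed

text \<open>The sublevel sets of \<open>E\<close> above its infimum are closed under midpoints and nested. Choosing
  almost minimizers of the uniformly convex functional \<open>S\<close> in them yields a Cauchy sequence.\<close>

lemma minimizing_Cauchy_sequence:
  fixes E S :: "'a \<Rightarrow> real" and D :: "'a \<Rightarrow> 'a \<Rightarrow> real" and mid :: "'a \<Rightarrow> 'a \<Rightarrow> 'a"
  assumes ne: "A \<noteq> {}" and mid: "\<And>u v. u \<in> A \<Longrightarrow> v \<in> A \<Longrightarrow> mid u v \<in> A"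
    and E0: "\<And>u. u \<in> A \<Longrightarrow> 0 \<le> E u" and S0: "\<And>u. u \<in> A \<Longrightarrow> 0 \<le> S u"
    and E_mid: "\<And>u v. u \<in> A \<Longrightarrow> v \<in> A \<Longrightarrow> E (mid u v) \<le> (E u + E v) / 2"
    and coercive: "K \<ge> 0" "\<And>u. u \<in> A \<Longrightarrow> S u \<le> K * E u"
    and unif: "\<And>\<epsilon>. \<epsilon> > 0 \<Longrightarrow> \<exists>C>0. \<forall>u\<in>A. \<forall>v\<in>A.
      D u v \<le> \<epsilon> * (S u + S v) + C * ((S u + S v) / 2 - S (mid u v))"
  obtains v :: "nat \<Rightarrow> 'a" where "\<And>n. v n \<in> A"
    "\<And>u e. u \<in> A \<Longrightarrow> e > 0 \<Longrightarrow> \<exists>N. \<forall>n\<ge>N. E (v n) \<le> E u + e"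
    "\<And>e. e > 0 \<Longrightarrow> \<exists>N. \<forall>i\<ge>N. \<forall>j\<ge>N. D (v i) (v j) < e"
proof -
  define m where "m = Inf (E ` A)"
  have m_le: "m \<le> E u" if "u \<in> A" for u
    unfolding m_def using E0 that by (intro cInf_lower) (auto intro!: bdd_belowI[of _ 0])
  have m0: "0 \<le> m" unfolding m_def using ne E0 by (intro cInf_greatest) auto
  define r where "r n = inverse (real (Suc n))" for n
  have r: "r n > 0" "r n \<le> 1" for n by (auto simp: r_def inverse_le_1_iff)
  have r_mono: "r n \<le> r k" if "k \<le> n" for k n using that by (auto simp: r_def intro: le_imp_inverse_le)
  have r_lim: "r \<longlonglongrightarrow> 0" unfolding r_def by (rule LIMSEQ_inverse_real_of_nat)
  define Cs where "Cs n = {u \<in> A. E u \<le> m + r n}" for n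
  have Cs_ne: "Cs n \<noteq> {}" for n
  proof -
    obtain x where "x \<in> E ` A" "x < m + r n"
      using cInf_lessD[of "E ` A" "m + r n"] ne r by (auto simp: m_def)
    then show ?thesis by (auto simp: Cs_def intro: less_imp_le)
  qed
  have Cs_mono: "Cs n \<subseteq> Cs k" if "k \<le> n" for n k using r_mono[OF that] by (auto simp: Cs_def)
  have Cs_mid: "mid u v \<in> Cs n" if "u \<in> Cs n" "v \<in> Cs n" for u v n
    using that mid E_mid[of u v] by (auto simp: Cs_def)
  \<comment> \<open>The levels \<open>r n\<close> are at most 1, so coercivity bounds
    \<open>S\<close> by the same number on all sublevel sets.\<close>
  define B where "B = K * (m + 1)"
  have S_le: "S u \<le> B" if "u \<in> Cs n" for u n
  proof -
    have "S u \<le> K * E u" using that coercive by (auto simp: Cs_def)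
    also have "\<dots> \<le> K * (m + 1)" using that r(2)[of n] coercive by (intro mult_left_mono) (auto simp: Cs_def)
    finally show ?thesis by (simp add: B_def)
  qed
  define d where "d n = Inf (S ` Cs n)" for n
  have bdd: "bdd_below (S ` Cs n)" for n using S0 by (auto simp: Cs_def intro!: bdd_belowI[of _ 0])
  have d_le: "d n \<le> S u" if "u \<in> Cs n" for u n
    unfolding d_def using that bdd by (intro cInf_lower) auto
  \<comment> \<open>Infima over shrinking sets increase and are bounded by \<open>B\<close>. Their
    convergence is the source of the Cauchy property.\<close>
  have "incseq d" unfolding d_def incseq_def using Cs_mono Cs_ne bdd
    by (intro allI impI cInf_superset_mono) auto
  moreover have "d n \<le> B" for n using d_le S_le Cs_ne by (meson ex_in_conv order_trans)
  ultimately obtain dd where dd: "d \<longlonglongrightarrow> dd" "\<And>n. d n \<le> dd" using incseq_convergent[of d B] by auto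
  have "\<exists>u\<in>Cs n. S u < d n + r n" for n
    using cInf_lessD[of "S ` Cs n" "d n + r n"] Cs_ne r by (auto simp: d_def)
  then obtain v where v: "\<And>n. v n \<in> Cs n" "\<And>n. S (v n) < d n + r n" by metis
  have B0: "B \<ge> 0" using m0 coercive by (simp add: B_def)
  show thesis
  proof (rule that[of v])
    show "v n \<in> A" for n using v(1) by (auto simp: Cs_def)
    show "\<exists>N. \<forall>n\<ge>N. E (v n) \<le> E u + e" if ue: "u \<in> A" "e > 0" for u e
    proof -
      obtain N where N: "\<And>n. n \<ge> N \<Longrightarrow> r n < e" using LIMSEQ_D[OF r_lim ue(2)] r by fastforce
      have "E (v n) \<le> E u + e" if "n \<ge> N" for n
        using v(1)[of n] N[OF that] m_le[OF ue(1)] by (auto simp: Cs_def)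
      then show ?thesis by blast
    qed
    show "\<exists>N. \<forall>i\<ge>N. \<forall>j\<ge>N. D (v i) (v j) < e" if e: "e > 0" for e
    proof -
      \<comment> \<open>Chosen so that the first term of the uniform convexity estimate is at most e
        / 2; B + 1 is positive even if B = 0.\<close>
      define \<epsilon> where "\<epsilon> = e / (4 * (B + 1))"
      have \<epsilon>: "\<epsilon> > 0" using e B0 by (simp add: \<epsilon>_def)
      obtain C where C: "C > 0" "\<And>u v. u \<in> A \<Longrightarrow> v \<in> A \<Longrightarrow>
          D u v \<le> \<epsilon> * (S u + S v) + C * ((S u + S v) / 2 - S (mid u v))"
        using unif[OF \<epsilon>] by blast
      have "(\<lambda>n. C * (dd - d n + r n)) \<longlonglongrightarrow> C * (dd - dd + 0)"
        by (intro tendsto_intros dd r_lim)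
      then have "(\<lambda>n. C * (dd - d n + r n)) \<longlonglongrightarrow> 0" by simp
      then have "\<forall>\<^sub>F n in sequentially. C * (dd - d n + r n) < e / 2"
        using e by (intro order_tendstoD) auto
      then obtain N where N: "C * (dd - d N + r N) < e / 2"
        by (auto simp: eventually_sequentially)
      have "D (v i) (v j) < e" if "i \<ge> N" "j \<ge> N" for i j
      proof -
        \<comment> \<open>Both functions lie in the larger set \<open>Cs N\<close>, hence so does
          their midpoint. Its value of \<open>S\<close> is thus at least \<open>d N\<close>, while
          the two values are at most \<open>dd + r N\<close>, so the midpoint gap is small.\<close>
        have iN: "v i \<in> Cs N" "v j \<in> Cs N" using v(1) Cs_mono that by auto
        then have A: "v i \<in> A" "v j \<in> A" by (auto simp: Cs_def)
        have "d N \<le> S (mid (v i) (v j))" by (intro d_le Cs_mid iN)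
        moreover have "S (v i) \<le> dd + r N" "S (v j) \<le> dd + r N"
          using v(2)[of i] v(2)[of j] dd(2)[of i] dd(2)[of j] r_mono[OF that(1)] r_mono[OF that(2)] by linarith+
        ultimately have "(S (v i) + S (v j)) / 2 - S (mid (v i) (v j)) \<le> dd - d N + r N"
          by (simp add: field_simps)
        then have "C * ((S (v i) + S (v j)) / 2 - S (mid (v i) (v j))) \<le> C * (dd - d N + r N)"
          using C(1) by (intro mult_left_mono) auto
        moreover have "\<epsilon> * (S (v i) + S (v j)) \<le> \<epsilon> * (2 * (B + 1))"
          using S_le[OF iN(1)] S_le[OF iN(2)] \<epsilon> by (intro mult_left_mono) auto
        moreover have "\<epsilon> * (2 * (B + 1)) = e / 2" using B0 by (simp add: \<epsilon>_def field_simps)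
        ultimately show ?thesis using C(2)[OF A] N by linarith
      qed
      then show ?thesis by blast
    qed
  qed
qed

section \<open>Convex functions and norms on symmetric matrices\<close>

definition sym_part :: "real ^ 'n ^ 'n \<Rightarrow> real ^ 'n ^ 'n" where
  "sym_part A = (1 / 2) *\<^sub>R (A + transpose A)"

lemma sym_part_in: "sym_part A \<in> sym_matrices"
  by (simp add: sym_part_def sym_matrices_def transpose_def vec_eq_iff)

lemma sym_part_id: "A \<in> sym_matrices \<Longrightarrow> sym_part A = A"
  by (simp add: sym_part_def sym_matrices_def flip: scaleR_2)

lemma sym_part_lincomb: "sym_part (a *\<^sub>R A + b *\<^sub>R B) = a *\<^sub>R sym_part A + b *\<^sub>R sym_part B"
  by (simp add: sym_part_def transpose_def vec_eq_iff algebra_simps)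

lemma sym_matrices_lincomb:
  "A \<in> sym_matrices \<Longrightarrow> B \<in> sym_matrices \<Longrightarrow> a *\<^sub>R A + b *\<^sub>R B \<in> sym_matrices"
  by (metis sym_part_id sym_part_in sym_part_lincomb)

text \<open>Finite convex functions on a finite-dimensional space are continuous. The symmetric
  matrices are in general not open among all matrices, so the function is first extended by the
  linear projection \<open>sym_part\<close>.\<close>

lemma continuous_on_convex_sym_part:
  fixes f :: "real ^ 'n ^ 'n \<Rightarrow> real"
  assumes "convex_on sym_matrices f"
  shows "continuous_on UNIV (\<lambda>A. f (sym_part A))"
proof (rule convex_on_continuous)
  show "convex_on UNIV (\<lambda>A. f (sym_part A))"
    by (rule convex_onI) (use assms in \<open>auto simp: sym_part_lincomb intro!: convex_onD sym_part_in\<close>)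
qed auto

text \<open>Its use is that an arbitrary norm inherits continuity from the preceding lemma.\<close>

lemma is_norm_on_sym_convex:
  assumes "is_norm_on sym_matrices (N :: real ^ 'n ^ 'n \<Rightarrow> real)"
  shows "convex_on sym_matrices N"
proof (rule convex_onI)
  show "convex (sym_matrices :: (real ^ 'n ^ 'n) set)"
    by (auto intro: convexI sym_matrices_lincomb)
  fix t :: real and A B :: "real ^ 'n ^ 'n"
  assume t: "0 < t" "t < 1" and AB: "A \<in> sym_matrices" "B \<in> sym_matrices"
  have s: "c *\<^sub>R M \<in> sym_matrices" if "M \<in> sym_matrices" for c and M :: "real ^ 'n ^ 'n"
    using sym_matrices_lincomb[OF that that, of c 0] by simp
  have "N ((1 - t) *\<^sub>R A + t *\<^sub>R B) \<le> N ((1 - t) *\<^sub>R A) + N (t *\<^sub>R B)"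
    using assms s[OF AB(1)] s[OF AB(2)] unfolding is_norm_on_def by blast
  moreover have "N ((1 - t) *\<^sub>R A) = \<bar>1 - t\<bar> * N A" "N (t *\<^sub>R B) = \<bar>t\<bar> * N B"
    using assms AB unfolding is_norm_on_def by blast+
  ultimately show "N ((1 - t) *\<^sub>R A + t *\<^sub>R B) \<le> (1 - t) * N A + t * N B" using t by simp
qed

lemma compact_sym_sphere: "compact (sphere 0 1 \<inter> (sym_matrices :: (real ^ 'n ^ 'n) set))"
proof -
  have "(sym_matrices :: (real ^ 'n ^ 'n) set) = {A. \<forall>i j. A $ j $ i = A $ i $ j}"
    by (auto simp: sym_matrices_def transpose_def vec_eq_iff)
  moreover have "closed {A :: real ^ 'n ^ 'n. \<forall>i j. A $ j $ i = A $ i $ j}"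
    by (intro closed_Collect_all closed_Collect_eq continuous_intros)
  ultimately show ?thesis by (intro compact_Int_closed) auto
qed

text \<open>Equivalence of norms: \<open>N\<close> is continuous and positive on the compact unit
  sphere of symmetric matrices, and homogeneity carries the extreme values over to all of
  them.\<close>

lemma is_norm_on_sym_bounds:
  assumes N: "is_norm_on sym_matrices (N :: real ^ 'n ^ 'n \<Rightarrow> real)"
  obtains c C where "c > 0" "C > 0"
    "\<And>A. A \<in> sym_matrices \<Longrightarrow> norm A \<le> c * N A" "\<And>A. A \<in> sym_matrices \<Longrightarrow> N A \<le> C * norm A"
proof -
  let ?S = "sphere 0 1 \<inter> (sym_matrices :: (real ^ 'n ^ 'n) set)"
  have cont: "continuous_on ?S N"
  proof -
    have "continuous_on ?S (\<lambda>A. N (sym_part A))"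
      using continuous_on_convex_sym_part[OF is_norm_on_sym_convex[OF N]] continuous_on_subset by blast
    then show ?thesis by (rule continuous_on_eq) (auto simp: sym_part_id)
  qed
  have "\<exists>C c. c > 0 \<and> C > 0 \<and> (\<forall>A\<in>?S. 1 \<le> c * N A \<and> N A \<le> C)"
  proof (cases "?S = {}")
    case True
    then show ?thesis by (auto intro!: exI[of _ 1])
  next
    case False
    obtain A0 where A0: "A0 \<in> ?S" "\<And>A. A \<in> ?S \<Longrightarrow> N A0 \<le> N A"
      using continuous_attains_inf[OF compact_sym_sphere False cont] by blast
    obtain A1 where A1: "A1 \<in> ?S" "\<And>A. A \<in> ?S \<Longrightarrow> N A \<le> N A1"
      using continuous_attains_sup[OF compact_sym_sphere False cont] by blast
    have "A0 \<noteq> 0" "A0 \<in> sym_matrices" using A0(1) by auto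
    then have "N A0 > 0" using N unfolding is_norm_on_def by (metis less_eq_real_def)
    moreover have "N A1 > 0" using \<open>N A0 > 0\<close> A0(2)[OF A1(1)] by linarith
    ultimately show ?thesis using A0(2) A1(2)
      by (intro exI[of _ "N A1"] exI[of _ "1 / N A0"]) (auto simp: field_simps)
  qed
  then obtain c C where cC: "c > 0" "C > 0" "\<And>A. A \<in> ?S \<Longrightarrow> 1 \<le> c * N A \<and> N A \<le> C" by blast
  have "norm A \<le> c * N A \<and> N A \<le> C * norm A" if A: "A \<in> sym_matrices" for A
  proof (cases "A = 0")
    case True
    have "N (0 *\<^sub>R A) = \<bar>0\<bar> * N A" using N A unfolding is_norm_on_def by blast
    then show ?thesis using True by simp
  next
    case False
    let ?B = "(1 / norm A) *\<^sub>R A"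
    have "?B \<in> ?S" using False sym_matrices_lincomb[OF A A, of "1 / norm A" 0] by simp
    from cC(3)[OF this] have "1 \<le> c * N ?B" "N ?B \<le> C" by auto
    moreover have "N ?B = \<bar>1 / norm A\<bar> * N A" using N A unfolding is_norm_on_def by blast
    ultimately show ?thesis using False by (simp add: field_simps)
  qed
  then show thesis using that cC(1,2) by blast
qed

lemma norm_matrix_le_sum: "norm (A :: real ^ 'n ^ 'n) \<le> (\<Sum>i\<in>UNIV. \<Sum>j\<in>UNIV. \<bar>A $ i $ j\<bar>)"
proof -
  have "norm A \<le> (\<Sum>i\<in>UNIV. norm (A $ i))"
    unfolding norm_vec_def by (rule L2_set_le_sum) auto
  also have "\<dots> \<le> (\<Sum>i\<in>UNIV. \<Sum>j\<in>UNIV. \<bar>A $ i $ j\<bar>)"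
    by (intro sum_mono norm_le_l1_cart)
  finally show ?thesis .
qed

section \<open>The energy functional\<close>

context sobolev_domain
begin

section \<open>Midpoints, uniform convexity of the Hessian functional and completeness of the
  second-order Sobolev space\<close>

lemma Lp_abs: "f \<in> Lp U p \<Longrightarrow> (\<lambda>x. \<bar>f x\<bar>) \<in> Lp U p"
  by (auto simp: Lp_def)

lemma Lp_sum: "finite I \<Longrightarrow> (\<And>i. i \<in> I \<Longrightarrow> f i \<in> Lp U p) \<Longrightarrow> (\<lambda>x. \<Sum>i\<in>I. f i x) \<in> Lp U p"
proof (induction I rule: finite_induct)
  case empty
  then show ?case by (simp add: Lp_test_function test_functions_zero)
next
  case (insert i I)
  then show ?case by (simp add: Lp_add)
qed

definition mid :: "(real ^ 'n \<Rightarrow> real) \<Rightarrow> (real ^ 'n \<Rightarrow> real) \<Rightarrow> real ^ 'n \<Rightarrow> real" where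
  "mid u v = (\<lambda>x. (1 / 2) * u x + (1 / 2) * v x)"

lemma weak_deriv_mid:
  assumes "u \<in> sobolev U 2 p" "v \<in> sobolev U 2 p"
  shows "AE x in M. \<forall>\<alpha>\<in>{\<alpha>. size \<alpha> \<le> 2}. weak_deriv U \<alpha> (mid u v) x = (weak_deriv U \<alpha> u x + weak_deriv U \<alpha> v x) / 2"
proof (subst AE_ball_countable)
  show "countable {\<alpha> :: 'n multiset. size \<alpha> \<le> 2}" by (intro countable_finite finite_multi_indices)
  show "\<forall>\<alpha>\<in>{\<alpha>. size \<alpha> \<le> 2}. AE x in M. weak_deriv U \<alpha> (mid u v) x = (weak_deriv U \<alpha> u x + weak_deriv U \<alpha> v x) / 2"
  proof
    fix \<alpha> :: "'n multiset" assume "\<alpha> \<in> {\<alpha>. size \<alpha> \<le> 2}"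
    then have "AE x in M. weak_deriv U \<alpha> (mid u v) x = (1 / 2) * weak_deriv U \<alpha> u x + (1 / 2) * weak_deriv U \<alpha> v x"
      unfolding mid_def by (intro weak_deriv_lincomb[OF assms]) auto
    then show "AE x in M. weak_deriv U \<alpha> (mid u v) x = (weak_deriv U \<alpha> u x + weak_deriv U \<alpha> v x) / 2"
      by eventually_elim simp
  qed
qed

definition hessian_dist :: "(real ^ 'n \<Rightarrow> real) \<Rightarrow> (real ^ 'n \<Rightarrow> real) \<Rightarrow> real" where
  "hessian_dist u v = (\<Sum>i\<in>UNIV. \<Sum>j\<in>UNIV. Ip (\<lambda>x. weak_deriv U {#i, j#} u x - weak_deriv U {#i, j#} v x))"

text \<open>The real inequality is integrated for each entry, using that derivatives of the midpoint
  are midpoints almost everywhere. The constant is that of the real inequality, hence the same for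
  all functions and entries.\<close>

lemma hessian_uniform_convex:
  assumes "\<epsilon> > 0"
  shows "\<exists>C>0. \<forall>u\<in>sobolev U 2 p. \<forall>v\<in>sobolev U 2 p. hessian_dist u v \<le>
    \<epsilon> * (hessian_sum u + hessian_sum v) + C * ((hessian_sum u + hessian_sum v) / 2 - hessian_sum (mid u v))"
proof -
  obtain C where C: "C > 0" "\<And>a b :: real. \<bar>a - b\<bar> powr p \<le>
    \<epsilon> * (\<bar>a\<bar> powr p + \<bar>b\<bar> powr p) + C * ((\<bar>a\<bar> powr p + \<bar>b\<bar> powr p) / 2 - \<bar>(a + b) / 2\<bar> powr p)"
    using powr_uniform_convex[OF p_gt_1 assms] by blast
  have term_le: "Ip (\<lambda>x. weak_deriv U \<alpha> u x - weak_deriv U \<alpha> v x) \<le>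
      \<epsilon> * (Ip (weak_deriv U \<alpha> u) + Ip (weak_deriv U \<alpha> v)) +
      C * ((Ip (weak_deriv U \<alpha> u) + Ip (weak_deriv U \<alpha> v)) / 2 - Ip (weak_deriv U \<alpha> (mid u v)))"
    if u: "u \<in> sobolev U 2 p" and v: "v \<in> sobolev U 2 p" and \<alpha>: "size \<alpha> \<le> 2" for u v \<alpha>
  proof -
    define a b c where "a = weak_deriv U \<alpha> u" and "b = weak_deriv U \<alpha> v" and "c = weak_deriv U \<alpha> (mid u v)"
    have m: "mid u v \<in> sobolev U 2 p" unfolding mid_def by (intro sobolev_lincomb u v)
    have abc: "a \<in> Lp U p" "b \<in> Lp U p" "c \<in> Lp U p"
      unfolding a_def b_def c_def using u v m \<alpha> by (auto intro: sobolev_weak_deriv_Lp)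
    note i = abc[THEN Lp_integrable_powr]
    have ae: "AE x in M. c x = (a x + b x) / 2"
      using weak_deriv_mid[OF u v] unfolding a_def b_def c_def by eventually_elim (use \<alpha> in auto)
    have "Ip (\<lambda>x. a x - b x) \<le> (LINT x|M. \<epsilon> * (\<bar>a x\<bar> powr p + \<bar>b x\<bar> powr p) +
        C * ((\<bar>a x\<bar> powr p + \<bar>b x\<bar> powr p) / 2 - \<bar>c x\<bar> powr p))"
      unfolding Ip_def
    proof (rule integral_mono_AE)
      show "integrable M (\<lambda>x. \<bar>a x - b x\<bar> powr p)" by (rule Lp_integrable_powr[OF Lp_diff[OF abc(1,2)]])
      show "AE x in M. \<bar>a x - b x\<bar> powr p \<le> \<epsilon> * (\<bar>a x\<bar> powr p + \<bar>b x\<bar> powr p) +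
        C * ((\<bar>a x\<bar> powr p + \<bar>b x\<bar> powr p) / 2 - \<bar>c x\<bar> powr p)"
        using ae
      proof eventually_elim
        case (elim x)
        show ?case unfolding elim by (rule C(2))
      qed
    qed (use i in simp)
    also have "\<dots> = \<epsilon> * (Ip a + Ip b) + C * ((Ip a + Ip b) / 2 - Ip c)"
      using i by (simp add: Ip_def)
    finally show ?thesis by (simp add: a_def b_def c_def)
  qed
  show ?thesis
  proof (intro exI[of _ C] conjI ballI C(1))
    fix u v assume uv: "u \<in> sobolev U 2 p" "v \<in> sobolev U 2 p"
    let ?I = "\<lambda>u i j. Ip (weak_deriv U {#i, j#} u)"
    have "hessian_dist u v \<le> (\<Sum>i\<in>UNIV. \<Sum>j\<in>UNIV. \<epsilon> * (?I u i j + ?I v i j) +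
        C * ((?I u i j + ?I v i j) / 2 - ?I (mid u v) i j))"
      unfolding hessian_dist_def using uv by (intro sum_mono term_le) auto
    also have "\<dots> = \<epsilon> * (hessian_sum u + hessian_sum v) +
        C * ((hessian_sum u + hessian_sum v) / 2 - hessian_sum (mid u v))"
      unfolding hessian_sum_def
      by (simp add: sum.distrib sum_subtractf flip: sum_distrib_left sum_divide_distrib)
    finally show "hessian_dist u v \<le> \<epsilon> * (hessian_sum u + hessian_sum v) +
        C * ((hessian_sum u + hessian_sum v) / 2 - hessian_sum (mid u v))" .
  qed
qed

text \<open>Each derivative has an L^p limit by completeness; the limit of order 0 is the function
  sought, and closedness of weak differentiation identifies the others as its derivatives.\<close>

lemma sobolev2_limit:
  assumes v: "\<And>n. v n \<in> sobolev U 2 p"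
    and C: "\<And>e. e > 0 \<Longrightarrow> \<exists>N. \<forall>i\<ge>N. \<forall>j\<ge>N. sobolev_sum 2 (\<lambda>x. v i x - v j x) < e"
  obtains u where "u \<in> sobolev U 2 p"
    "\<And>\<alpha>. size \<alpha> \<le> 2 \<Longrightarrow> (\<lambda>n. Ip (\<lambda>x. weak_deriv U \<alpha> (v n) x - weak_deriv U \<alpha> u x)) \<longlonglongrightarrow> 0"
    "(\<lambda>n. Ip (\<lambda>x. v n x - u x)) \<longlonglongrightarrow> 0"
proof -
  have "\<exists>f\<in>Lp U p. (\<lambda>n. Ip (\<lambda>x. weak_deriv U \<alpha> (v n) x - f x)) \<longlonglongrightarrow> 0" if \<alpha>: "size \<alpha> \<le> 2" for \<alpha>
  proof -
    have "\<exists>N. \<forall>i\<ge>N. \<forall>j\<ge>N. Ip (\<lambda>x. weak_deriv U \<alpha> (v i) x - weak_deriv U \<alpha> (v j) x) < e" if e: "e > 0" for e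
    proof -
      obtain N where "\<forall>i\<ge>N. \<forall>j\<ge>N. sobolev_sum 2 (\<lambda>x. v i x - v j x) < e" using C[OF e] by blast
      then have "\<forall>i\<ge>N. \<forall>j\<ge>N. Ip (\<lambda>x. weak_deriv U \<alpha> (v i) x - weak_deriv U \<alpha> (v j) x) < e"
        unfolding Ip_weak_deriv_diff[OF v v \<alpha>, symmetric]
        by (intro allI impI le_less_trans[OF Ip_le_sobolev_sum[OF \<alpha>]]) blast
      then show ?thesis by blast
    qed
    from Lp_complete[OF sobolev_weak_deriv_Lp[OF v \<alpha>] this] show ?thesis by blast
  qed
  then have "\<forall>\<alpha>\<in>{\<alpha>. size \<alpha> \<le> 2}. \<exists>f. f \<in> Lp U p \<and>
      (\<lambda>n. Ip (\<lambda>x. weak_deriv U \<alpha> (v n) x - f x)) \<longlonglongrightarrow> 0"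
    by blast
  from bchoice[OF this] obtain f where f: "\<And>\<alpha>. size \<alpha> \<le> 2 \<Longrightarrow> f \<alpha> \<in> Lp U p"
    "\<And>\<alpha>. size \<alpha> \<le> 2 \<Longrightarrow> (\<lambda>n. Ip (\<lambda>x. weak_deriv U \<alpha> (v n) x - f \<alpha> x)) \<longlonglongrightarrow> 0"
    by auto
  define u where "u = f {#}"
  have uL: "u \<in> Lp U p" using f(1)[of "{#}"] by (simp add: u_def)
  have "Ip (\<lambda>x. weak_deriv U {#} (v n) x - f {#} x) = Ip (\<lambda>x. v n x - u x)" for n
  proof (rule Ip_cong_AE)
    have "AE x in M. weak_deriv U {#} (v n) x = v n x"
      by (intro weak_deriv_AE open_U is_weak_deriv_empty Lp_loc sobolev_Lp[OF v])
    then show "AE x in M. weak_deriv U {#} (v n) x - f {#} x = v n x - u x"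
      by eventually_elim (simp add: u_def)
  qed (auto intro!: Lp_borel Lp_diff sobolev_weak_deriv_Lp[OF v] sobolev_Lp[OF v] uL f)
  then have lim: "(\<lambda>n. Ip (\<lambda>x. v n x - u x)) \<longlonglongrightarrow> 0" using f(2)[of "{#}"] by simp
  have d: "is_weak_deriv U \<alpha> u (f \<alpha>)" if "size \<alpha> \<le> 2" for \<alpha>
    by (rule is_weak_deriv_limit[OF sobolev_Lp[OF v] uL lim sobolev_weak_deriv_Lp[OF v that] f(1)[OF that] f(2)[OF that]
          sobolev_is_weak_deriv[OF v that]])
  have uS: "u \<in> sobolev U 2 p" using uL d f(1) by (auto simp: sobolev_def)
  show thesis
  proof (rule that[OF uS _ lim])
    fix \<alpha> :: "'n multiset" assume \<alpha>: "size \<alpha> \<le> 2"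
    have "Ip (\<lambda>x. weak_deriv U \<alpha> (v n) x - f \<alpha> x) = Ip (\<lambda>x. weak_deriv U \<alpha> (v n) x - weak_deriv U \<alpha> u x)" for n
    proof (rule Ip_cong_AE)
      show "AE x in M. weak_deriv U \<alpha> (v n) x - f \<alpha> x = weak_deriv U \<alpha> (v n) x - weak_deriv U \<alpha> u x"
        using weak_deriv_AE[OF open_U d[OF \<alpha>]] by eventually_elim simp
    qed (auto intro!: Lp_borel Lp_diff sobolev_weak_deriv_Lp[OF v] sobolev_weak_deriv_Lp[OF uS] f \<alpha>)
    then show "(\<lambda>n. Ip (\<lambda>x. weak_deriv U \<alpha> (v n) x - weak_deriv U \<alpha> u x)) \<longlonglongrightarrow> 0"
      using f(2)[OF \<alpha>] by simp
  qed
qed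

end

locale energy_problem = convex_sobolev_domain U p
  for U :: "(real ^ 'n) set" and p :: real +
  fixes F N :: "real ^ 'n ^ 'n \<Rightarrow> real" and g :: "real ^ 'n \<Rightarrow> real" and \<gamma>1 \<gamma>2 l L :: real
  assumes \<gamma>: "\<gamma>1 \<ge> 0" "\<gamma>2 \<ge> 0" and l: "0 < l" and L: "l \<le> L"
    and N: "is_norm_on sym_matrices N" and F_convex: "convex_on sym_matrices F"
    and F_bounds: "\<And>A. A \<in> sym_matrices \<Longrightarrow> l * N A \<le> F A \<and> F A \<le> L * N A"
    and g: "g \<in> sobolev U 2 p"
begin

abbreviation "H \<equiv> weak_hessian U"
abbreviation "Adm \<equiv> admissible U p g"
abbreviation "E \<equiv> energy U F p \<gamma>1 \<gamma>2"

section \<open>Measurability, growth, coercivity and convexity of the energy\<close>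

definition integrand :: "real ^ 'n ^ 'n \<Rightarrow> real \<Rightarrow> real" where
  "integrand A s = F A powr p + \<gamma>1 * max s 0 - \<gamma>2 * min s 0"

lemma E_eq: "E u = (LINT x|M. integrand (H u x) (u x))"
  by (simp add: energy_def integrand_def)

lemma F_nonneg: "A \<in> sym_matrices \<Longrightarrow> 0 \<le> F A"
  using F_bounds[of A] l N unfolding is_norm_on_def by (metis mult_nonneg_nonneg less_imp_le order_trans)

lemma integrand_nonneg: "0 \<le> integrand A s"
proof -
  have "\<gamma>2 * min s 0 \<le> 0" "0 \<le> \<gamma>1 * max s 0"
    using \<gamma> by (auto intro: mult_nonneg_nonpos)
  then show ?thesis unfolding integrand_def by (smt (verit) powr_ge_zero)
qed

lemma weak_hessian_measurable:
  assumes "u \<in> sobolev U 2 p"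
  shows "H u \<in> borel_measurable M"
proof (subst borel_measurable_euclidean_space, intro ballI)
  fix b :: "real ^ 'n ^ 'n" assume "b \<in> Basis"
  then obtain i j where b: "b = axis i (axis j 1)"
    by (auto simp: Basis_vec_def)
  have "(\<lambda>x. H u x \<bullet> b) = weak_deriv U {#i, j#} u"
    by (simp add: b inner_axis weak_hessian_def fun_eq_iff)
  then show "(\<lambda>x. H u x \<bullet> b) \<in> borel_measurable M"
    using sobolev_weak_deriv_Lp[OF assms, of "{#i, j#}"] by (simp add: Lp_borel)
qed

lemma F_sym_part_continuous: "continuous_on UNIV (\<lambda>A. F (sym_part A))"
  by (rule continuous_on_convex_sym_part[OF F_convex])

text \<open>Nothing is known of \<open>F\<close> off the symmetric matrices; this replaces it by its
  continuous extension.\<close>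

lemma F_weak_hessian: "F (H u x) = F (sym_part (H u x))"
  by (simp add: sym_part_id weak_hessian_sym)

lemma F_weak_hessian_measurable:
  assumes "u \<in> sobolev U 2 p"
  shows "(\<lambda>x. F (H u x)) \<in> borel_measurable M"
  unfolding F_weak_hessian
  by (rule measurable_compose[OF weak_hessian_measurable[OF assms]
      borel_measurable_continuous_onI[OF F_sym_part_continuous]])

lemma integrand_measurable:
  assumes "u \<in> sobolev U 2 p"
  shows "(\<lambda>x. integrand (H u x) (u x)) \<in> borel_measurable M"
proof -
  have [measurable]: "(\<lambda>x. F (H u x)) \<in> borel_measurable M" "u \<in> borel_measurable M"
    using assms F_weak_hessian_measurable by (auto intro: Lp_borel sobolev_Lp)
  show ?thesis unfolding integrand_def by measurable
qed

text \<open>The upper bound on \<open>F\<close> and the equivalence of norms dominate it by a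
  multiple of the sum of the absolute Hessian entries, which is in L^p.\<close>

lemma F_weak_hessian_integrable:
  assumes u: "u \<in> sobolev U 2 p"
  shows "integrable M (\<lambda>x. F (H u x) powr p)"
proof -
  obtain c C where C: "C > 0" "\<And>A. A \<in> sym_matrices \<Longrightarrow> N A \<le> C * norm A"
    using is_norm_on_sym_bounds[OF N] by metis
  define h where "h x = L * C * (\<Sum>i\<in>UNIV. \<Sum>j\<in>UNIV. \<bar>weak_deriv U {#i, j#} u x\<bar>)" for x
  have h: "h \<in> Lp U p"
    unfolding h_def by (intro Lp_scale Lp_sum Lp_abs sobolev_weak_deriv_Lp[OF u]) auto
  have [measurable]: "(\<lambda>x. F (H u x)) \<in> borel_measurable M"
    by (rule F_weak_hessian_measurable[OF u])
  show ?thesis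
  proof (rule Bochner_Integration.integrable_bound[OF Lp_integrable_powr[OF h]])
    show "AE x in M. norm (F (H u x) powr p) \<le> norm (\<bar>h x\<bar> powr p)"
    proof (rule AE_I2)
      fix x
      have s: "H u x \<in> sym_matrices" by (rule weak_hessian_sym)
      have "F (H u x) \<le> L * N (H u x)" using F_bounds[OF s] by simp
      also have "\<dots> \<le> L * (C * norm (H u x))" using C(2)[OF s] l L by (intro mult_left_mono) auto
      also have "\<dots> \<le> L * (C * (\<Sum>i\<in>UNIV. \<Sum>j\<in>UNIV. \<bar>H u x $ i $ j\<bar>))"
        using l L C(1) by (intro mult_left_mono norm_matrix_le_sum) auto
      also have "\<dots> = h x" by (simp add: h_def weak_hessian_def)
      finally show "norm (F (H u x) powr p) \<le> norm (\<bar>h x\<bar> powr p)"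
        using F_nonneg[OF s] p_gt_1 by (auto intro!: powr_mono2)
    qed
  qed measurable
qed

lemma integrand_integrable:
  assumes u: "u \<in> sobolev U 2 p"
  shows "integrable M (\<lambda>x. integrand (H u x) (u x))"
proof -
  have [simp]: "integrable M u" using u by (intro Lp_integrable sobolev_Lp)
  show ?thesis
    unfolding integrand_def using F_weak_hessian_integrable[OF u]
    by (intro Bochner_Integration.integrable_add Bochner_Integration.integrable_diff
        integrable_mult_right integrable_max integrable_min) auto
qed

lemma E_nonneg: "0 \<le> E u"
  unfolding E_eq by (intro integral_nonneg_AE) (auto simp: integrand_nonneg)

text \<open>Each Hessian entry is at most (c / l) * F by the lower bound on \<open>F\<close>, and
  the terms in \<open>u\<close> are nonnegative, so the power of \<open>F\<close> is at most the
  integrand.\<close>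

lemma E_coercive:
  obtains K where "K \<ge> 0" "\<And>u. u \<in> sobolev U 2 p \<Longrightarrow> hessian_sum u \<le> K * E u"
proof -
  obtain c C where c: "c > 0" "\<And>A. A \<in> sym_matrices \<Longrightarrow> norm A \<le> c * N A"
    using is_norm_on_sym_bounds[OF N] by metis
  define k where "k = (c / l) powr p"
  have "Ip (weak_deriv U {#i, j#} u) \<le> k * E u" if u: "u \<in> sobolev U 2 p" for u i j
  proof -
    have "Ip (weak_deriv U {#i, j#} u) \<le> (LINT x|M. k * integrand (H u x) (u x))"
      unfolding Ip_def
    proof (rule integral_mono)
      show "integrable M (\<lambda>x. \<bar>weak_deriv U {#i, j#} u x\<bar> powr p)"
        by (rule Lp_integrable_powr[OF sobolev_weak_deriv_Lp[OF u]]) simp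
      show "integrable M (\<lambda>x. k * integrand (H u x) (u x))" using integrand_integrable[OF u] by simp
      fix x
      have s: "H u x \<in> sym_matrices" by (rule weak_hessian_sym)
      have "\<bar>weak_deriv U {#i, j#} u x\<bar> = \<bar>H u x $ i $ j\<bar>" by (simp add: weak_hessian_def)
      also have "\<dots> \<le> norm (H u x)"
        by (metis component_le_norm_cart Finite_Cartesian_Product.norm_nth_le order_trans)
      also have "\<dots> \<le> c * N (H u x)" by (rule c(2)[OF s])
      also have "\<dots> \<le> (c / l) * F (H u x)"
      proof -
        have "(c / l) * (l * N (H u x)) \<le> (c / l) * F (H u x)"
          using F_bounds[OF s] c(1) l by (intro mult_left_mono) auto
        then show ?thesis using l by simp
      qed
      finally have "\<bar>weak_deriv U {#i, j#} u x\<bar> powr p \<le> ((c / l) * F (H u x)) powr p"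
        using p_gt_1 by (intro powr_mono2) auto
      also have "\<dots> = k * F (H u x) powr p"
        unfolding k_def by (rule powr_mult)
      also have "\<dots> \<le> k * integrand (H u x) (u x)"
      proof (intro mult_left_mono)
        have "\<gamma>2 * min (u x) 0 \<le> 0" "0 \<le> \<gamma>1 * max (u x) 0"
          using \<gamma> by (auto intro: mult_nonneg_nonpos)
        then show "F (H u x) powr p \<le> integrand (H u x) (u x)" by (simp add: integrand_def)
      qed (simp add: k_def)
      finally show "\<bar>weak_deriv U {#i, j#} u x\<bar> powr p \<le> k * integrand (H u x) (u x)" .
    qed
    then show ?thesis by (simp add: E_eq)
  qed
  then have "hessian_sum u \<le> (\<Sum>i\<in>(UNIV :: 'n set). \<Sum>j\<in>(UNIV :: 'n set). k * E u)" if "u \<in> sobolev U 2 p" for u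
    unfolding hessian_sum_def using that by (intro sum_mono)
  then have "hessian_sum u \<le> (real CARD('n) * real CARD('n) * k) * E u" if "u \<in> sobolev U 2 p" for u
    using that by (simp add: mult_ac)
  moreover have "real CARD('n) * real CARD('n) * k \<ge> 0" by (simp add: k_def)
  ultimately show thesis by (rule that[rotated])
qed

lemma admissible_sobolev: "u \<in> Adm \<Longrightarrow> u \<in> sobolev U 2 p"
  by (simp add: admissible_def)

lemma admissible_mid:
  assumes "u \<in> Adm" "v \<in> Adm" shows "mid u v \<in> Adm"
proof -
  have "(\<lambda>x. (1 / 2) * (u x - g x) + (1 / 2) * (v x - g x)) \<in> sobolev0 U 1 p"
    using assms by (intro sobolev0_lincomb) (auto simp: admissible_def)
  moreover have "(\<lambda>x. (1 / 2) * (u x - g x) + (1 / 2) * (v x - g x)) = (\<lambda>x. mid u v x - g x)"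
    by (simp add: mid_def fun_eq_iff field_simps)
  moreover have "mid u v \<in> sobolev U 2 p"
    unfolding mid_def using assms by (intro sobolev_lincomb) (auto simp: admissible_def)
  ultimately show ?thesis by (simp add: admissible_def)
qed

text \<open>Convexity of \<open>F\<close>, then monotonicity and convexity of the p-th power on
  nonnegative reals. The positive part is convex; the minimum is concave but enters with a minus
  sign.\<close>

lemma integrand_mid_le:
  assumes A: "A \<in> sym_matrices" and B: "B \<in> sym_matrices"
  shows "integrand ((1 / 2) *\<^sub>R A + (1 / 2) *\<^sub>R B) ((1 / 2) * s + (1 / 2) * t) \<le> (integrand A s + integrand B t) / 2"
proof -
  have "F ((1 - 1 / 2) *\<^sub>R A + (1 / 2) *\<^sub>R B) \<le> (1 - 1 / 2) * F A + (1 / 2) * F B"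
    by (rule convex_onD[OF F_convex _ _ A B]) auto
  then have "F ((1 / 2) *\<^sub>R A + (1 / 2) *\<^sub>R B) \<le> \<bar>(F A + F B) / 2\<bar>"
    by simp
  then have "F ((1 / 2) *\<^sub>R A + (1 / 2) *\<^sub>R B) powr p \<le> \<bar>(F A + F B) / 2\<bar> powr p"
    using p_gt_1 F_nonneg[OF sym_matrices_lincomb[OF A B]] by (intro powr_mono2) auto
  also have "\<dots> \<le> (\<bar>F A\<bar> powr p + \<bar>F B\<bar> powr p) / 2" by (rule powr_midpoint_le[OF p_gt_1])
  finally have 1: "F ((1 / 2) *\<^sub>R A + (1 / 2) *\<^sub>R B) powr p \<le> (F A powr p + F B powr p) / 2"
    using F_nonneg A B by simp
  have "max ((1 / 2) * s + (1 / 2) * t) 0 \<le> (max s 0 + max t 0) / 2"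
    by (auto simp: max_def)
  from mult_left_mono[OF this \<gamma>(1)]
  have 2: "\<gamma>1 * max ((1 / 2) * s + (1 / 2) * t) 0 \<le> (\<gamma>1 * max s 0 + \<gamma>1 * max t 0) / 2"
    by (simp add: distrib_left)
  have "(min s 0 + min t 0) / 2 \<le> min ((1 / 2) * s + (1 / 2) * t) 0"
    by (auto simp: min_def)
  from mult_left_mono[OF this \<gamma>(2)]
  have 3: "(\<gamma>2 * min s 0 + \<gamma>2 * min t 0) / 2 \<le> \<gamma>2 * min ((1 / 2) * s + (1 / 2) * t) 0"
    by (simp add: distrib_left)
  show ?thesis unfolding integrand_def using 1 2 3 by (simp add: field_simps)
qed

lemma E_mid_le:
  assumes u: "u \<in> sobolev U 2 p" and v: "v \<in> sobolev U 2 p"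
  shows "E (mid u v) \<le> (E u + E v) / 2"
proof -
  have m: "mid u v \<in> sobolev U 2 p" unfolding mid_def by (intro sobolev_lincomb u v)
  have "E (mid u v) \<le> (LINT x|M. (integrand (H u x) (u x) + integrand (H v x) (v x)) / 2)"
    unfolding E_eq
  proof (rule integral_mono_AE)
    show "integrable M (\<lambda>x. integrand (H (mid u v) x) (mid u v x))" by (rule integrand_integrable[OF m])
    show "integrable M (\<lambda>x. (integrand (H u x) (u x) + integrand (H v x) (v x)) / 2)"
      using integrand_integrable u v by simp
    show "AE x in M. integrand (H (mid u v) x) (mid u v x) \<le> (integrand (H u x) (u x) + integrand (H v x) (v x)) / 2"
      using weak_deriv_mid[OF u v]
    proof eventually_elim
      case (elim x)
      have "weak_deriv U {#i, j#} (mid u v) x = (weak_deriv U {#i, j#} u x + weak_deriv U {#i, j#} v x) / 2" for i j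
        using bspec[OF elim, of "{#i, j#}"] by simp
      then have "H (mid u v) x = (1 / 2) *\<^sub>R H u x + (1 / 2) *\<^sub>R H v x"
        by (simp add: vec_eq_iff weak_hessian_def add_divide_distrib)
      then show ?case
        using integrand_mid_le[OF weak_hessian_sym[of U u x] weak_hessian_sym[of U v x], of "u x" "v x"]
        by (simp add: mid_def)
    qed
  qed
  also have "\<dots> = (E u + E v) / 2"
    using integrand_integrable u v by (simp add: E_eq)
  finally show ?thesis .
qed

lemma g_admissible: "g \<in> Adm"
  using g zero_sobolev0 by (simp add: admissible_def)

text \<open>Along a subsequence the functions and all Hessian entries converge almost everywhere, so
  continuity of the integrand and Fatou's lemma apply. Assuming only an eventual bound lets the
  hypothesis pass to the subsequence.\<close>

lemma E_lower_semicontinuous: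
  assumes v: "\<And>n. v n \<in> sobolev U 2 p" and u: "u \<in> sobolev U 2 p"
    and lim: "\<And>i j. (\<lambda>n. Ip (\<lambda>x. weak_deriv U {#i, j#} (v n) x - weak_deriv U {#i, j#} u x)) \<longlonglongrightarrow> 0"
      "(\<lambda>n. Ip (\<lambda>x. v n x - u x)) \<longlonglongrightarrow> 0"
    and le: "\<forall>\<^sub>F n in sequentially. E (v n) \<le> c"
  shows "E u \<le> c"
proof -
  \<comment> \<open>\<open>None\<close> stands for the function and \<open>Some (i, j)\<close> for a
    Hessian entry; the index type is finite, so one subsequence serves all of them.\<close>
  define f where "f a n = (case a of None \<Rightarrow> (\<lambda>x. v n x - u x) |
     Some (i, j) \<Rightarrow> (\<lambda>x. weak_deriv U {#i, j#} (v n) x - weak_deriv U {#i, j#} u x))" for a n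
  have f_Lp: "f a n \<in> Lp U p" for a n
    by (auto simp: f_def split: option.splits intro!: Lp_diff sobolev_Lp[OF v] sobolev_Lp[OF u]
        sobolev_weak_deriv_Lp[OF v] sobolev_weak_deriv_Lp[OF u])
  have f_lim: "(\<lambda>n. Ip (f a n)) \<longlonglongrightarrow> 0" for a
    using lim by (cases a) (auto simp: f_def split: prod.splits)
  obtain r where r: "strict_mono r" "AE x in M. \<forall>a\<in>UNIV. (\<lambda>n. f a (r n) x) \<longlonglongrightarrow> 0"
    by (rule Lp_AE_subseq[of UNIV f, OF finite_class.finite_UNIV f_Lp f_lim]) blast
  have cont: "(\<lambda>n. integrand (H (v (r n)) x) (v (r n) x)) \<longlonglongrightarrow> integrand (H u x) (u x)"
    if x: "\<forall>a\<in>UNIV. (\<lambda>n. f a (r n) x) \<longlonglongrightarrow> 0" for x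
  proof -
    have 1: "(\<lambda>n. v (r n) x) \<longlonglongrightarrow> u x"
      using x[rule_format, of None] by (simp add: f_def LIM_zero_iff)
    have "(\<lambda>n. H (v (r n)) x $ i $ j) \<longlonglongrightarrow> H u x $ i $ j" for i j
      using x[rule_format, of "Some (i, j)"] by (simp add: f_def LIM_zero_iff weak_hessian_def)
    then have "(\<lambda>n. H (v (r n)) x) \<longlonglongrightarrow> H u x"
      by (intro vec_tendstoI)
    then have 2: "(\<lambda>n. F (sym_part (H (v (r n)) x))) \<longlonglongrightarrow> F (sym_part (H u x))"
      using F_sym_part_continuous by (intro continuous_on_tendsto_compose[of UNIV "\<lambda>A. F (sym_part A)"]) auto
    have nn: "0 \<le> F (sym_part A)" for A by (rule F_nonneg[OF sym_part_in])
    show ?thesis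
      unfolding integrand_def F_weak_hessian
      by (intro tendsto_intros 1 tendsto_powr2[OF 2 tendsto_const]) (use nn p_gt_1 in auto)
  qed
  have "ennreal (E u) = (\<integral>\<^sup>+x. ennreal (integrand (H u x) (u x)) \<partial>M)"
    unfolding E_eq by (rule nn_integral_eq_integral[symmetric]) (auto simp: integrand_nonneg integrand_integrable[OF u])
  also have "\<dots> = (\<integral>\<^sup>+x. liminf (\<lambda>n. ennreal (integrand (H (v (r n)) x) (v (r n) x))) \<partial>M)"
  proof (rule nn_integral_cong_AE, use r(2) in eventually_elim)
    case (elim x)
    from tendsto_ennrealI[OF cont[OF elim]]
    show ?case by (intro lim_imp_Liminf[symmetric]) auto
  qed
  also have "\<dots> \<le> liminf (\<lambda>n. \<integral>\<^sup>+x. ennreal (integrand (H (v (r n)) x) (v (r n) x)) \<partial>M)"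
    by (rule nn_integral_liminf) (use integrand_measurable[OF v] in measurable)
  also have "\<dots> = liminf (\<lambda>n. ennreal (E (v (r n))))"
    unfolding E_eq by (subst nn_integral_eq_integral) (auto simp: integrand_nonneg integrand_integrable[OF v])
  also have "\<dots> \<le> ennreal c"
  proof (rule Liminf_le)
    show "\<forall>\<^sub>F n in sequentially. ennreal (E (v (r n))) \<le> ennreal c"
      using eventually_subseq[OF r(1) le] by eventually_elim (rule ennreal_leI)
  qed auto
  finally have "ennreal (E u) \<le> ennreal c" .
  \<comment> \<open>Negative reals are sent to 0 by \<open>ennreal\<close>, so nonnegativity of
    \<open>c\<close> is required to return to the reals.\<close>
  moreover have "0 \<le> c"
    using le E_nonneg by (auto simp: eventually_sequentially) (meson order_refl order_trans)
  ultimately show ?thesis by simp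
qed

theorem minimizer_exists: "\<exists>u0\<in>Adm. \<forall>u\<in>Adm. E u0 \<le> E u"
proof -
  obtain K where K: "K \<ge> 0" "\<And>u. u \<in> sobolev U 2 p \<Longrightarrow> hessian_sum u \<le> K * E u"
    using E_coercive by blast
  have ne: "Adm \<noteq> {}" using g_admissible by blast
  have E_mid: "E (mid u v) \<le> (E u + E v) / 2" if "u \<in> Adm" "v \<in> Adm" for u v
    using that by (intro E_mid_le admissible_sobolev)
  have coercive: "hessian_sum u \<le> K * E u" if "u \<in> Adm" for u
    using that by (intro K admissible_sobolev)
  have unif: "\<exists>C>0. \<forall>u\<in>Adm. \<forall>v\<in>Adm. hessian_dist u v \<le>
      \<epsilon> * (hessian_sum u + hessian_sum v) + C * ((hessian_sum u + hessian_sum v) / 2 - hessian_sum (mid u v))"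
    if "\<epsilon> > 0" for \<epsilon>
    using hessian_uniform_convex[OF that] admissible_sobolev by meson
  obtain v :: "nat \<Rightarrow> real ^ 'n \<Rightarrow> real" where v: "\<And>n. v n \<in> Adm"
    and Ev: "\<And>u e. u \<in> Adm \<Longrightarrow> e > 0 \<Longrightarrow> \<exists>N. \<forall>n\<ge>N. E (v n) \<le> E u + e"
    and Cauchy: "\<And>e. e > 0 \<Longrightarrow> \<exists>N. \<forall>i\<ge>N. \<forall>j\<ge>N. hessian_dist (v i) (v j) < e"
    by (rule minimizing_Cauchy_sequence[of Adm mid E hessian_sum K hessian_dist, OF ne admissible_mid
        E_nonneg hessian_sum_nonneg E_mid K(1) coercive unif]) (assumption | blast)+
  have vS: "v n \<in> sobolev U 2 p" for n using v by (rule admissible_sobolev)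
  obtain C where C: "C \<ge> 0" "\<And>w. w \<in> sobolev U 2 p \<Longrightarrow> w \<in> sobolev0 U 1 p \<Longrightarrow> sobolev_sum 2 w \<le> C * hessian_sum w"
    using sobolev_sum_le_hessian_sum by blast
  have le: "sobolev_sum 2 (\<lambda>x. v i x - v j x) \<le> C * hessian_dist (v i) (v j)" for i j
  proof -
    \<comment> \<open>The boundary datum cancels, which puts the difference into the class where
      Hessians control all lower orders.\<close>
    have "(\<lambda>x. 1 * (v i x - g x) + (-1) * (v j x - g x)) \<in> sobolev0 U 1 p"
      using v by (intro sobolev0_lincomb) (auto simp: admissible_def)
    then have "(\<lambda>x. v i x - v j x) \<in> sobolev0 U 1 p" by simp
    then have "sobolev_sum 2 (\<lambda>x. v i x - v j x) \<le> C * hessian_sum (\<lambda>x. v i x - v j x)"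
      by (intro C(2) sobolev_diff vS)
    also have "hessian_sum (\<lambda>x. v i x - v j x) = hessian_dist (v i) (v j)"
      unfolding hessian_sum_def hessian_dist_def by (intro sum.cong refl Ip_weak_deriv_diff[OF vS vS]) auto
    finally show ?thesis .
  qed
  have Cauchy2: "\<exists>N. \<forall>i\<ge>N. \<forall>j\<ge>N. sobolev_sum 2 (\<lambda>x. v i x - v j x) < e" if e: "e > 0" for e
  proof -
    obtain N where N: "\<And>i j. i \<ge> N \<Longrightarrow> j \<ge> N \<Longrightarrow> hessian_dist (v i) (v j) < e / (C + 1)"
      \<comment> \<open>Dividing by C + 1 allows for C = 0 and keeps the resulting bound strictly
        below e.\<close>
      using Cauchy[of "e / (C + 1)"] e C(1) by auto
    have "sobolev_sum 2 (\<lambda>x. v i x - v j x) < e" if "i \<ge> N" "j \<ge> N" for i j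
    proof -
      have "C * hessian_dist (v i) (v j) \<le> C * (e / (C + 1))"
        using N[OF that] C(1) by (intro mult_left_mono) auto
      also have "\<dots> < e" using e C(1) by (simp add: field_simps)
      finally show ?thesis using le[of i j] by linarith
    qed
    then show ?thesis by blast
  qed
  obtain u where u: "u \<in> sobolev U 2 p"
    "\<And>\<alpha>. size \<alpha> \<le> 2 \<Longrightarrow> (\<lambda>n. Ip (\<lambda>x. weak_deriv U \<alpha> (v n) x - weak_deriv U \<alpha> u x)) \<longlonglongrightarrow> 0"
    "(\<lambda>n. Ip (\<lambda>x. v n x - u x)) \<longlonglongrightarrow> 0"
    by (rule sobolev2_limit[of v, OF vS Cauchy2]) (assumption | blast)+
  have "(\<lambda>x. u x - g x) \<in> sobolev0 U 1 p"
  proof (rule sobolev0_closed)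
    show "(\<lambda>x. v n x - g x) \<in> sobolev0 U 1 p" for n using v by (simp add: admissible_def)
    show "(\<lambda>x. u x - g x) \<in> sobolev U 1 p"
      using sobolev_diff[OF u(1) g] sobolev_mono[of 1 2] by auto
    \<comment> \<open>Again \<open>g\<close> cancels, so first-order convergence of
      \<open>v n\<close> to \<open>u\<close> shows that the boundary condition is preserved.\<close>
    have "sobolev_sum 1 (\<lambda>x. (v n x - g x) - (u x - g x)) =
        (\<Sum>\<alpha> | size \<alpha> \<le> 1. Ip (\<lambda>x. weak_deriv U \<alpha> (v n) x - weak_deriv U \<alpha> u x))" for n
      unfolding sobolev_sum_def by (intro sum.cong refl) (simp add: Ip_weak_deriv_diff[OF vS u(1)])
    then show "(\<lambda>n. sobolev_sum 1 (\<lambda>x. (v n x - g x) - (u x - g x))) \<longlonglongrightarrow> 0"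
      using u(2) by (auto intro!: tendsto_null_sum)
  qed
  then have "u \<in> Adm" using u(1) by (simp add: admissible_def)
  moreover have "E u \<le> E w" if w: "w \<in> Adm" for w
  \<comment> \<open>The sequence is only asymptotically minimizing, so it is compared with each
    competitor \<open>w\<close> up to an arbitrary slack.\<close>
  proof (rule field_le_epsilon)
    fix e :: real assume "e > 0"
    then have "\<forall>\<^sub>F n in sequentially. E (v n) \<le> E w + e"
      using Ev[OF w] by (simp add: eventually_sequentially)
    then show "E u \<le> E w + e"
      by (intro E_lower_semicontinuous[OF vS u(1) u(2) u(3)]) auto
  qed
  ultimately show ?thesis by blast
qed

end

theorem proposition3:
  fixes F :: "real ^ 'n ^ 'n \<Rightarrow> real"
    and N :: "real ^ 'n ^ 'n \<Rightarrow> real"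
    and g :: "real ^ 'n \<Rightarrow> real"
    and p \<gamma>1 \<gamma>2 l L :: real
  assumes "p > 1" and "p > real CARD('n) / 2" and "p \<le> real CARD('n)"
    and "\<gamma>1 \<ge> 0" and "\<gamma>2 \<ge> 0" and "\<gamma>1 + \<gamma>2 > 0"
    and "0 < l" and "l \<le> L"
    and "is_norm_on sym_matrices N"
    and "convex_on sym_matrices F"
    and "\<And>M. M \<in> sym_matrices \<Longrightarrow> l * N M \<le> F M \<and> F M \<le> L * N M"
    and "g \<in> sobolev (ball 0 1) 2 p"
    and "\<not> (AE x in lebesgue_on (ball 0 1). g x = 0)"
  shows "\<exists>u0 \<in> admissible (ball 0 1) p g. \<forall>u \<in> admissible (ball 0 1) p g.
           energy (ball 0 1) F p \<gamma>1 \<gamma>2 u0 \<le> energy (ball 0 1) F p \<gamma>1 \<gamma>2 u"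
proof -
  interpret energy_problem "ball 0 1" p F N g \<gamma>1 \<gamma>2 l L
    using assms by unfold_locales auto
  show ?thesis by (rule minimizer_exists)
qed

end
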